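(* Let $(\mathcal{T}_0,\mathrm{ref}_{\mathcal{T}_0})$ be an (extended) conforming triangulation of a polygonal domain $\Omega\subset\mathbb{R}^2$ that has the weak BDD-property, and let $(\mathcal{T},\mathrm{ref}_{\mathcal{T}})$ be an arbitrary red-green-blue (RGB) refinement of $(\mathcal{T}_0,\mathrm{ref}_{\mathcal{T}_0})$. Define a sequence of triangulations $(\mathcal{T}^{(i)})_{i=0,1,\ldots}$ by $$\mathcal{T}^{(0)}:=\mathcal{T},\qquad \bigl(\mathcal{T}^{(i+1)},\mathrm{ref}_{\mathcal{T}^{(i+1)}}\bigr):=\mathrm{COARSEN}\bigl(\mathcal{T}^{(i)},\mathrm{ref}_{\mathcal{T}^{(i)}},\mathcal{N}(\mathcal{T}^{(i)})\bigr),$$ i.e. in each step all nodes are marked for coarsening. Then there is a finite number of steps $M\in\mathbb{N}_0$ such that $\mathcal{T}^{(M)}=\mathcal{T}_0$.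
   Context: **Triangulations.** Let $\Omega\subset\mathbb{R}^2$ be a polygonal domain. A triangulation $\mathcal{T}$ of $\Omega$ is a finite set of closed triangles (elements) of positive area, with pairwise disjoint interiors, whose union is $\overline{\Omega}$. It is conforming if any two distinct elements intersect in the empty set, a common vertex, or a common edge (so there are no hanging nodes). $\mathcal{N}=\mathcal{N}(\mathcal{T})$ is the set of vertices (nodes) of $\mathcal{T}$; $\mathcal{N}(T)$ and $\mathcal{E}(T)$ are the sets of vertices and edges of $T$. An extended conforming triangulation $(\mathcal{T},\mathrm{ref}_{\mathcal{T}})$ is a conforming triangulation with a map assigning to each $T\in\mathcal{T}$ a reference edge $\mathrm{ref}_{\mathcal{T}}(T)\in\mathcal{E}(T)$. Write $T=(v_1,v_2,v_3)$ for the triangle with vertices $v_1,v_2,v_3$ in counterclockwise order and reference edge $v_1v_2$. **Weak BDD-property.** An element $T\in\mathcal{T}$ is called isolated if its reference edge $\mathrm{ref}_{\mathcal{T}}(T)$ is shared with another element $\tilde T\in\mathcal{T}$ and $\mathrm{ref}_{\mathcal{T}}(\tilde T)\neq\mathrm{ref}_{\mathcal{T}}(T)$. $(\mathcal{T},\mathrm{ref}_{\mathcal{T}})$ has the weak BDD-property (is of weak BDD-type) if two distinct isolated elements $T_1,T_2\in\mathcal{T}$ never share an edge. **RGB patterns.** For $T=(v_1,v_2,v_3)$ let $m_{12},m_{23},m_{31}$ be the midpoints of $v_1v_2$, $v_2v_3$, $v_3v_1$. The allowed refinements of $T$ (the father) into its children are: - none: $T$ is unchanged; - red: $r_1=(v_1,m_{12},m_{31})$,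 $r_2=(m_{12},v_2,m_{23})$, $r_3=(m_{31},m_{23},v_3)$, $r_4=(m_{23},m_{31},m_{12})$; - green: $(v_3,v_1,m_{12})$, $(v_2,v_3,m_{12})$; - blue$_r$: $(v_3,v_1,m_{12})$, $(m_{12},v_2,m_{23})$, $(v_3,m_{12},m_{23})$; - blue$_\ell$: $(m_{12},v_3,m_{31})$, $(v_1,m_{12},m_{31})$, $(v_2,v_3,m_{12})$. A blue refinement equals a green refinement of $T$ followed by a green refinement of one of the two green children, and for genealogy (father/child relations) it is treated as these two successive green refinements. An RGB refinement step applies one of these patterns to each element of an extended conforming triangulation such that the result is again an extended conforming triangulation. An RGB refinement of $\mathcal{T}_0$ is a triangulation obtained by finitely many such steps. $\mathcal{N}_0$ is the set of vertices of $\mathcal{T}_0$ (fixed throughout the whole coarsening sequence). **Newest vertices.** The newest vertex of an element $T\in\mathcal{T}$ is the vertex opposite to its reference edge, with the exception that an element of type $r_3$ of a red refinement has no newest vertex (its vertex opposite to the reference edge is an old vertex of the father). Hence an unrefined red pattern has the newest vertices $m_{12},m_{23},m_{31}$, an unrefined green pattern has $m_{12}$, and nodes of $\mathcal{N}_0$ are never counted. **Red middle elements.** An element of $\mathcal{T}$ is a red middle element if it is the child $r_4$ of a red refinement of some father $F$ and all its siblings $r_1,r_2,r_3$ also belong to $\mathcal{T}$. **Procedure $\mathrm{COARSEN}(\mathcal{T},\mathrm{ref}_{\mathcal{T}},\mathcal{N}_{\mathrm{mark}})$**, where $\mathcal{N}_{\mathrm{mark}}\subset\mathcal{N}=\mathcal{N}(\mathcal{T})$.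 1. $\mathcal{N}_{\mathrm{new}}:=\{v\in\mathcal{N}\setminus\mathcal{N}_0 : v \text{ is newest vertex of some } T\in\mathcal{T}\}$. 2. $\mathcal{M}:=\{T\in\mathcal{T}: T\text{ is a red middle element}\}$ and $\tilde{\mathcal{R}}_v:=\{T\in\mathcal{T}\setminus\mathcal{M}: v\in\mathcal{N}(T)\}$ for $v\in\mathcal{N}$. 3. $\mathcal{N}_{\mathrm{adm}}:=\{v\in\mathcal{N}_{\mathrm{new}}\cap\mathcal{N}_{\mathrm{mark}}: \#\tilde{\mathcal{R}}_v\in\{2,4\}\}$ and $\mathcal{N}_{\mathrm{block}}:=\mathcal{N}\setminus\mathcal{N}_{\mathrm{adm}}$. 4. Repeat until $\mathcal{N}_{\mathrm{block}}$ no longer changes: let $\mathcal{M}_{\mathrm{block}}:=\{T\in\mathcal{M}:\mathcal{N}(T)\cap\mathcal{N}_{\mathrm{block}}\neq\emptyset\}$ and add to $\mathcal{N}_{\mathrm{block}}$, for every $T\in\mathcal{M}_{\mathrm{block}}$, the vertex of $T$ opposite to $\mathrm{ref}_{\mathcal{T}}(T)$. 5. $\mathcal{N}_{\mathrm{hang}}:=\mathcal{N}_{\mathrm{block}}\cap\mathcal{N}_{\mathrm{new}}$ and replace $\mathcal{N}_{\mathrm{adm}}$ by $\mathcal{N}_{\mathrm{adm}}\setminus\mathcal{N}_{\mathrm{hang}}$. 6. Create the new elements and reference edges $(\hat{\mathcal{T}},\mathrm{ref}_{\hat{\mathcal{T}}})$ as follows. - For every red pattern $r_1,\dots,r_4\in\mathcal{T}$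 with red middle element $r_4\in\mathcal{M}$ and father $F=(v_1,v_2,v_3)$: if $m_{12},m_{23},m_{31}\in\mathcal{N}_{\mathrm{adm}}$, replace the four elements by $F$; if $m_{12}\in\mathcal{N}_{\mathrm{hang}}$ and $m_{23},m_{31}\in\mathcal{N}_{\mathrm{adm}}$, replace them by the green children of $F$; if $m_{12},m_{31}\in\mathcal{N}_{\mathrm{hang}}$ and $m_{23}\in\mathcal{N}_{\mathrm{adm}}$, by the blue$_\ell$ children of $F$; if $m_{12},m_{23}\in\mathcal{N}_{\mathrm{hang}}$ and $m_{31}\in\mathcal{N}_{\mathrm{adm}}$, by the blue$_r$ children of $F$; if $m_{12},m_{23},m_{31}\in\mathcal{N}_{\mathrm{hang}}$, keep the four elements. - For every pair of elements of $\mathcal{T}$ that are the two green children of a common father $F=(v_1,v_2,v_3)$: if $m_{12}\in\mathcal{N}_{\mathrm{adm}}$, replace the pair by $F$ (with reference edge $v_1v_2$); if $m_{12}\in\mathcal{N}_{\mathrm{hang}}$, keep the pair. - All other elements are kept unchanged. The output is $(\hat{\mathcal{T}},\mathrm{ref}_{\hat{\mathcal{T}}})$. Elements newly created from a red pattern as green or blue children of $F$ are regarded as green/blue children of $F$ in the genealogy used by subsequent calls of COARSEN. *)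

theory Defs
  imports "HOL-Analysis.Analysis" "HOL-Library.While_Combinator"
begin

type_synonym point = "real ^ 2"

text \<open>A bounded open connected set whose boundary consists of finitely many line segments.
  Holes and slits are not excluded.\<close>

definition polygonal_domain :: "point set \<Rightarrow> bool" where
  "polygonal_domain \<Omega> \<longleftrightarrow>
     open \<Omega> \<and> connected \<Omega> \<and> \<Omega> \<noteq> {} \<and> bounded \<Omega> \<and>
     (\<exists>S. finite S \<and> (\<forall>(a, b) \<in> S. a \<noteq> b) \<and> frontier \<Omega> = (\<Union>(a, b) \<in> S. closed_segment a b))"

text \<open>The triple \<open>(v1, v2, v3)\<close> is the triangle with these vertices, listed counterclockwise,
  and with reference edge \<open>v1 v2\<close>. A nondegenerate triangle together with one of its edges has
  exactly one such representation, so an extended triangulation, i.e. a set of triangles with a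
  map to reference edges, is a set of triples.\<close>

type_synonym ref_triangle = "point \<times> point \<times> point"

text \<open>Twice the signed area is positive: the triangle is nondegenerate and its vertices are in
  counterclockwise order.\<close>

fun ccw :: "ref_triangle \<Rightarrow> bool" where
  "ccw (a, b, c) \<longleftrightarrow> (b - a) $ 1 * (c - a) $ 2 - (b - a) $ 2 * (c - a) $ 1 > 0"

fun verts :: "ref_triangle \<Rightarrow> point set" where
  "verts (a, b, c) = {a, b, c}"

fun edges :: "ref_triangle \<Rightarrow> point set set" where
  "edges (a, b, c) = {closed_segment a b, closed_segment b c, closed_segment c a}"

fun ref_edge :: "ref_triangle \<Rightarrow> point set" where
  "ref_edge (a, b, c) = closed_segment a b"

fun apex :: "ref_triangle \<Rightarrow> point" where
  "apex (a, b, c) = c"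

definition triangle :: "ref_triangle \<Rightarrow> point set" where
  "triangle t = convex hull (verts t)"

definition nodes :: "ref_triangle set \<Rightarrow> point set" where
  "nodes T = (\<Union>t\<in>T. verts t)"

text \<open>Disjointness of the interiors is required for distinct triples, so no triangle of the
  triangulation carries two different reference edges.\<close>

definition triangulation :: "point set \<Rightarrow> ref_triangle set \<Rightarrow> bool" where
  "triangulation \<Omega> T \<longleftrightarrow>
     finite T \<and> (\<forall>t\<in>T. ccw t) \<and>
     (\<forall>s\<in>T. \<forall>t\<in>T. s \<noteq> t \<longrightarrow> interior (triangle s) \<inter> interior (triangle t) = {}) \<and>
     (\<Union>t\<in>T. triangle t) = closure \<Omega>"

definition conforming :: "ref_triangle set \<Rightarrow> bool" where
  "conforming T \<longleftrightarrow>
     (\<forall>s\<in>T. \<forall>t\<in>T. s \<noteq> t \<longrightarrow>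
        triangle s \<inter> triangle t = {} \<or>
        (\<exists>v \<in> verts s \<inter> verts t. triangle s \<inter> triangle t = {v}) \<or>
        (\<exists>e \<in> edges s \<inter> edges t. triangle s \<inter> triangle t = e))"

definition conforming_triangulation :: "point set \<Rightarrow> ref_triangle set \<Rightarrow> bool" where
  "conforming_triangulation \<Omega> T \<longleftrightarrow> triangulation \<Omega> T \<and> conforming T"

definition isolated :: "ref_triangle set \<Rightarrow> ref_triangle \<Rightarrow> bool" where
  "isolated T t \<longleftrightarrow>
     t \<in> T \<and> (\<exists>s\<in>T. s \<noteq> t \<and> ref_edge t \<in> edges s \<and> ref_edge s \<noteq> ref_edge t)"

definition weak_BDD :: "ref_triangle set \<Rightarrow> bool" where
  "weak_BDD T \<longleftrightarrow>
     (\<forall>s t. isolated T s \<and> isolated T t \<and> s \<noteq> t \<longrightarrow> edges s \<inter> edges t = {})"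

text \<open>An element remembers how it arose from an element of the initial triangulation:
  \<open>Red1 F\<close>, ..., \<open>Red4 F\<close> are the children of the red refinement of \<open>F\<close>, and \<open>Green1 F\<close>,
  \<open>Green2 F\<close> are those of the green refinement. A blue refinement is two successive green ones.\<close>

datatype element =
    Initial ref_triangle
  | Red1 element | Red2 element | Red3 element | Red4 element
  | Green1 element | Green2 element

text \<open>The midpoints of the edges of \<open>(v1, v2, v3)\<close>; \<open>mid12\<close> is that of the reference edge.\<close>

fun mid12 :: "ref_triangle \<Rightarrow> point" where "mid12 (v1, v2, v3) = midpoint v1 v2"
fun mid23 :: "ref_triangle \<Rightarrow> point" where "mid23 (v1, v2, v3) = midpoint v2 v3"
fun mid31 :: "ref_triangle \<Rightarrow> point" where "mid31 (v1, v2, v3) = midpoint v3 v1"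

primrec tri :: "element \<Rightarrow> ref_triangle" where
  "tri (Initial t) = t"
| "tri (Red1 F) = (case tri F of (v1, v2, v3) \<Rightarrow> (v1, mid12 (tri F), mid31 (tri F)))"
| "tri (Red2 F) = (case tri F of (v1, v2, v3) \<Rightarrow> (mid12 (tri F), v2, mid23 (tri F)))"
| "tri (Red3 F) = (case tri F of (v1, v2, v3) \<Rightarrow> (mid31 (tri F), mid23 (tri F), v3))"
| "tri (Red4 F) = (mid23 (tri F), mid31 (tri F), mid12 (tri F))"
| "tri (Green1 F) = (case tri F of (v1, v2, v3) \<Rightarrow> (v3, v1, mid12 (tri F)))"
| "tri (Green2 F) = (case tri F of (v1, v2, v3) \<Rightarrow> (v2, v3, mid12 (tri F)))"

datatype pattern = Unrefined | Red | Green | Blue_r | Blue_l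

fun children :: "pattern \<Rightarrow> element \<Rightarrow> element set" where
  "children Unrefined F = {F}"
| "children Red F = {Red1 F, Red2 F, Red3 F, Red4 F}"
| "children Green F = {Green1 F, Green2 F}"
| "children Blue_r F = {Green1 F, Green1 (Green2 F), Green2 (Green2 F)}"
| "children Blue_l F = {Green1 (Green1 F), Green2 (Green1 F), Green2 F}"

lemma tri_children:
  assumes "tri F = (v1, v2, v3)"
  defines "m12 \<equiv> midpoint v1 v2" and "m23 \<equiv> midpoint v2 v3" and "m31 \<equiv> midpoint v3 v1"
  shows "tri ` children Red F =
           {(v1, m12, m31), (m12, v2, m23), (m31, m23, v3), (m23, m31, m12)}"
    and "tri ` children Green F = {(v3, v1, m12), (v2, v3, m12)}"
    and "tri ` children Blue_r F = {(v3, v1, m12), (m12, v2, m23), (v3, m12, m23)}"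
    and "tri ` children Blue_l F = {(m12, v3, m31), (v1, m12, m31), (v2, v3, m12)}"
  using assms by auto

definition rgb_step :: "point set \<Rightarrow> element set \<Rightarrow> element set \<Rightarrow> bool" where
  "rgb_step \<Omega> T T' \<longleftrightarrow>
     (\<exists>p. T' = (\<Union>e\<in>T. children (p e) e)) \<and> conforming_triangulation \<Omega> (tri ` T')"

inductive rgb_refinement :: "point set \<Rightarrow> ref_triangle set \<Rightarrow> element set \<Rightarrow> bool"
  for \<Omega> :: "point set" and T0 :: "ref_triangle set" where
  initial: "rgb_refinement \<Omega> T0 (Initial ` T0)"
| step: "rgb_refinement \<Omega> T0 T \<Longrightarrow> rgb_step \<Omega> T T' \<Longrightarrow> rgb_refinement \<Omega> T0 T'"

definition newest_vertex :: "point \<Rightarrow> element \<Rightarrow> bool" where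
  "newest_vertex v e \<longleftrightarrow> v = apex (tri e) \<and> (\<nexists>F. e = Red3 F)"

definition new_nodes :: "point set \<Rightarrow> element set \<Rightarrow> point set" where
  "new_nodes N0 T = {v \<in> nodes (tri ` T) - N0. \<exists>e\<in>T. newest_vertex v e}"

definition red_middle :: "element set \<Rightarrow> element set" where
  "red_middle T = {e \<in> T. \<exists>F. e = Red4 F \<and> {Red1 F, Red2 F, Red3 F} \<subseteq> T}"

definition elems_at :: "element set \<Rightarrow> point \<Rightarrow> element set" where
  "elems_at T v = {e \<in> T - red_middle T. v \<in> verts (tri e)}"

text \<open>The value of \<open>N\<^sub>a\<^sub>d\<^sub>m\<close> before the blocked nodes are propagated.\<close>

definition pre_adm :: "point set \<Rightarrow> element set \<Rightarrow> point set \<Rightarrow> point set" where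
  "pre_adm N0 T mark = {v \<in> new_nodes N0 T \<inter> mark. card (elems_at T v) \<in> {2, 4}}"

definition block_step :: "element set \<Rightarrow> point set \<Rightarrow> point set" where
  "block_step T B = B \<union> {apex (tri e) | e. e \<in> red_middle T \<and> verts (tri e) \<inter> B \<noteq> {}}"

definition blocked :: "point set \<Rightarrow> element set \<Rightarrow> point set \<Rightarrow> point set" where
  "blocked N0 T mark =
     while (\<lambda>B. block_step T B \<noteq> B) (block_step T) (nodes (tri ` T) - pre_adm N0 T mark)"

definition hanging :: "point set \<Rightarrow> element set \<Rightarrow> point set \<Rightarrow> point set" where
  "hanging N0 T mark = blocked N0 T mark \<inter> new_nodes N0 T"

definition admissible :: "point set \<Rightarrow> element set \<Rightarrow> point set \<Rightarrow> point set" where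
  "admissible N0 T mark = pre_adm N0 T mark - hanging N0 T mark"

text \<open>What replaces the red, respectively green, children of \<open>F\<close>, given the admissible nodes \<open>A\<close>
  and the hanging nodes \<open>H\<close>. Every such midpoint is admissible or hanging, and \<open>m12\<close> hangs as soon
  as \<open>m23\<close> or \<open>m31\<close> does, so the last case of \<open>coarsen_red\<close> is that all three are hanging.\<close>

definition coarsen_red :: "point set \<Rightarrow> point set \<Rightarrow> element \<Rightarrow> element set" where
  "coarsen_red A H F =
    (let m12 = mid12 (tri F); m23 = mid23 (tri F); m31 = mid31 (tri F) in
     if m12 \<in> A \<and> m23 \<in> A \<and> m31 \<in> A then {F}
     else if m12 \<in> H \<and> m23 \<in> A \<and> m31 \<in> A then children Green F
     else if m12 \<in> H \<and> m31 \<in> H \<and> m23 \<in> A then children Blue_l F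
     else if m12 \<in> H \<and> m23 \<in> H \<and> m31 \<in> A then children Blue_r F
     else children Red F)"

definition coarsen_green :: "point set \<Rightarrow> element \<Rightarrow> element set" where
  "coarsen_green A F = (if mid12 (tri F) \<in> A then {F} else children Green F)"

definition coarsen :: "point set \<Rightarrow> element set \<Rightarrow> point set \<Rightarrow> element set" where
  "coarsen N0 T mark =
    (let A = admissible N0 T mark;
         H = hanging N0 T mark;
         \<R> = {F. Red4 F \<in> red_middle T};
         \<G> = {F. children Green F \<subseteq> T}
     in (T - (\<Union>F\<in>\<R>. children Red F) - (\<Union>F\<in>\<G>. children Green F))
        \<union> (\<Union>F\<in>\<R>. coarsen_red A H F) \<union> (\<Union>F\<in>\<G>. coarsen_green A F))"

end

theory Submission
  imports Defs
begin

text \<open>A coarsening step removes at least one node, and it never creates hanging nodes, so it suffices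
  to find in every triangulation other than the initial one a node that is removed. Locally, inside one
  initial triangle, the midpoint of a refined edge has a generation. Choosing a refined midpoint of maximal
  generation would make all elements around it unrefined children, so that it is admissible and not
  blocked; but across an initial edge that is the reference edge of only one of its two triangles the two
  generations differ by one. The remedy is to maximise the sum of the generations on both sides. This is
  compatible with the order by generation inside each initial triangle unless two isolated triangles share
  an edge, which is exactly what the weak BDD-property excludes.

  That a node is really removed when the test \<open>#R \<in> {2, 4}\<close> succeeds follows by counting: at least two
  elements lie on each side of a refined edge at its midpoint, and exactly two only if the children at the
  midpoint are unrefined, where the generations show that the refined edges on both sides coincide.\<close>

section \<open>Triangles in barycentric coordinates\<close>

text \<open>The obstacle is that COARSEN sees little more than the number of elements at a node,
  while the patterns on both sides of the node must disappear together. Hence the history is kept as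
  a forest \<open>X\<close> of all current and former elements: a coarsening step prunes
  \<open>X\<close> and then refines partially, and a node is described by its splitters, the refined
  elements having it as an edge midpoint. The generation must depend on the point alone, since
  elements of different size and shape meet at it. In a suitable chart every descendant of an
  initial triangle is similar to it, each bisection scales by a unit divided by \<open>cc\<close>,
  and the parity of Gaussian integers makes the exponent a function of the point. This exponent also
  fixes the length of every refined edge with that midpoint, which is how edges on two sides are
  compared without following the refinement steps. The maximal choice also takes care of blocking:
  the apex of a red middle element has a smaller generation than the other two midpoints of the red
  pattern, so a maximal node is never such an apex.\<close>

definition cross2 :: "point \<Rightarrow> point \<Rightarrow> real" where
  "cross2 x y = x $ 1 * y $ 2 - x $ 2 * y $ 1"

definition area2 :: "point \<Rightarrow> point \<Rightarrow> point \<Rightarrow> real" where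
  "area2 a b c = cross2 (b - a) (c - a)"

fun signed_area :: "ref_triangle \<Rightarrow> real" where
  "signed_area (a, b, c) = area2 a b c"

text \<open>Barycentric coordinates times twice the area of the triangle. Without the division, the
  coordinates in a child are linear in those in the father, so inclusion and disjointness of
  children become linear arithmetic.\<close>

fun bary :: "ref_triangle \<Rightarrow> point \<Rightarrow> real \<times> real \<times> real" where
  "bary (a, b, c) x = (area2 b c x, area2 c a x, area2 a b x)"

definition closed_tri :: "ref_triangle \<Rightarrow> point set" where
  "closed_tri t = {x. case bary t x of (p, q, r) \<Rightarrow> 0 \<le> p \<and> 0 \<le> q \<and> 0 \<le> r}"

definition open_tri :: "ref_triangle \<Rightarrow> point set" where
  "open_tri t = {x. case bary t x of (p, q, r) \<Rightarrow> 0 < p \<and> 0 < q \<and> 0 < r}"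

lemmas area_simps = area2_def cross2_def

lemma midpoint_nth: "midpoint a b $ i = (a $ i + b $ i) / (2::real)"
  by (simp add: midpoint_def)

lemma ccw_iff_signed_area: "ccw t \<longleftrightarrow> 0 < signed_area t"
  by (cases t) (simp add: area_simps)

lemma bary_sum: "bary t x = (p, q, r) \<Longrightarrow> p + q + r = signed_area t"
  by (cases t) (auto simp: area_simps algebra_simps)

lemma vec2_eq_iff: "x = y \<longleftrightarrow> x $ 1 = y $ 1 \<and> x $ 2 = (y :: point) $ 2"
  by (simp add: vec_eq_iff forall_2)

lemma bary_inj:
  assumes "ccw t" "bary t x = bary t y"
  shows "x = y"
proof -
  obtain a b c where t: "t = (a, b, c)" by (cases t)
  have pos: "area2 a b c \<noteq> 0" using assms(1) by (simp add: t ccw_iff_signed_area)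
  have e1: "cross2 (b - a) (x - y) = 0" and e2: "cross2 (c - a) (x - y) = 0"
    using assms(2) by (auto simp: t area_simps algebra_simps)
  \<comment> \<open>Cramer's rule for \<open>x - y\<close> in the basis of the two edge vectors at
    \<open>a\<close>.\<close>
  have "area2 a b c * (x $ 1 - y $ 1) =
      (b - a) $ 1 * cross2 (c - a) (x - y) * -1 + (c - a) $ 1 * cross2 (b - a) (x - y)"
    by (simp add: area_simps algebra_simps)
  moreover have "area2 a b c * (x $ 2 - y $ 2) =
      (b - a) $ 2 * cross2 (c - a) (x - y) * -1 + (c - a) $ 2 * cross2 (b - a) (x - y)"
    by (simp add: area_simps algebra_simps)
  ultimately show ?thesis using pos by (simp add: e1 e2 vec2_eq_iff)
qed

lemma bary_vertex:
  "bary (a, b, c) a = (area2 a b c, 0, 0)"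
  "bary (a, b, c) b = (0, area2 a b c, 0)"
  "bary (a, b, c) c = (0, 0, area2 a b c)"
  by (auto simp: area_simps algebra_simps)

lemma bary_midpoint:
  assumes "bary t x = (p, q, r)" "bary t y = (p', q', r')"
  shows "bary t (midpoint x y) = ((p + p') / 2, (q + q') / 2, (r + r') / 2)"
  using assms by (cases t) (auto simp: area_simps midpoint_nth field_simps)

lemma verts_iff_bary:
  assumes "ccw t"
  shows "x \<in> verts t \<longleftrightarrow> bary t x \<in> {(signed_area t, 0, 0), (0, signed_area t, 0), (0, 0, signed_area t)}"
proof -
  obtain a b c where t: "t = (a, b, c)" by (cases t)
  show ?thesis
    unfolding t verts.simps signed_area.simps
    using bary_inj[OF assms, of x] bary_vertex[of a b c] unfolding t by (auto simp del: bary.simps)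
qed

lemma triangle_eq_closed_tri:
  assumes "ccw t"
  shows "triangle t = closed_tri t"
proof -
  obtain a b c where t: "t = (a, b, c)" by (cases t)
  let ?A = "area2 a b c"
  have pos: "0 < ?A" using assms by (simp add: t ccw_iff_signed_area)
  show ?thesis
  proof (intro set_eqI iffI)
    fix x assume "x \<in> triangle t"
    then obtain u v w where uvw: "0 \<le> u" "0 \<le> v" "0 \<le> w" "u + v + w = 1"
      and x: "x = u *\<^sub>R a + v *\<^sub>R b + w *\<^sub>R c"
      by (auto simp: triangle_def t convex_hull_3)
    have u: "u = 1 - v - w" using uvw by simp
    have "bary t x = (u * ?A, v * ?A, w * ?A)"
      unfolding x t u by (auto simp: area_simps algebra_simps)
    then show "x \<in> closed_tri t" using uvw pos by (simp add: closed_tri_def)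
  next
    fix x assume x: "x \<in> closed_tri t"
    let ?u = "area2 b c x / ?A" and ?v = "area2 c a x / ?A" and ?w = "area2 a b x / ?A"
    have s: "?u + ?v + ?w = 1"
      using bary_sum[of t x] pos by (simp add: t flip: add_divide_distrib)
    have "area2 b c x *\<^sub>R a + area2 c a x *\<^sub>R b + area2 a b x *\<^sub>R c = ?A *\<^sub>R x"
      by (simp add: vec2_eq_iff) (simp add: area_simps algebra_simps)
    then have "(1 / ?A) *\<^sub>R (area2 b c x *\<^sub>R a + area2 c a x *\<^sub>R b + area2 a b x *\<^sub>R c) = x"
      using pos by simp
    then have "x = ?u *\<^sub>R a + ?v *\<^sub>R b + ?w *\<^sub>R c"
      by (simp add: scaleR_add_right)
    moreover have "0 \<le> ?u" "0 \<le> ?v" "0 \<le> ?w"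
      using x pos by (auto simp: closed_tri_def t)
    ultimately show "x \<in> triangle t"
      using s unfolding triangle_def t verts.simps convex_hull_3 by blast
  qed
qed

lemma open_tri_subset_closed_tri: "open_tri t \<subseteq> closed_tri t"
  by (auto simp: open_tri_def closed_tri_def)

lemma open_tri_subset_interior:
  assumes "ccw t"
  shows "open_tri t \<subseteq> interior (triangle t)"
proof (rule interior_maximal)
  obtain a b c where t: "t = (a, b, c)" by (cases t)
  have "open_tri t = {x. 0 < area2 b c x} \<inter> {x. 0 < area2 c a x} \<inter> {x. 0 < area2 a b x}"
    by (auto simp: open_tri_def t)
  moreover have "open {x. 0 < area2 p q x}" for p q
    unfolding area_simps by (intro open_Collect_less continuous_intros)
  ultimately show "open (open_tri t)" by (simp add: open_Int)
  show "open_tri t \<subseteq> triangle t"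
    using open_tri_subset_closed_tri triangle_eq_closed_tri[OF assms] by blast
qed

lemma verts_subset_closed_tri: "ccw t \<Longrightarrow> verts t \<subseteq> closed_tri t"
  by (auto simp: verts_iff_bary closed_tri_def ccw_iff_signed_area)

lemma midpoint_closed_tri:
  assumes "x \<in> closed_tri t" "y \<in> closed_tri t"
  shows "midpoint x y \<in> closed_tri t"
  using assms bary_midpoint[of t x _ _ _ y] unfolding closed_tri_def
  by (cases "bary t x"; cases "bary t y") auto

text \<open>Vertices are extreme points: a coordinate that vanishes at the midpoint vanishes at both
  end points, where it is nonnegative.\<close>

lemma midpoint_not_vertex:
  assumes "ccw t" "x \<in> closed_tri t" "y \<in> closed_tri t" "x \<noteq> y"
  shows "midpoint x y \<notin> verts t"
proof
  assume m: "midpoint x y \<in> verts t"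
  obtain p q r where x: "bary t x = (p, q, r)" using prod_cases3 by blast
  obtain p' q' r' where y: "bary t y = (p', q', r')" using prod_cases3 by blast
  have pos: "p \<ge> 0" "q \<ge> 0" "r \<ge> 0" "p' \<ge> 0" "q' \<ge> 0" "r' \<ge> 0"
    using assms by (auto simp: closed_tri_def x y)
  have s: "p + q + r = signed_area t" "p' + q' + r' = signed_area t"
    using bary_sum x y by blast+
  have "bary t x = bary t y"
    using m pos s unfolding verts_iff_bary[OF assms(1)] bary_midpoint[OF x y] x y by auto
  then show False using bary_inj assms by blast
qed

section \<open>Oriented edges and their inner sides\<close>

fun oriented_edges :: "ref_triangle \<Rightarrow> (point \<times> point) set" where
  "oriented_edges (a, b, c) = {(a, b), (b, c), (c, a)}"

lemma oriented_edges_verts: "(a, b) \<in> oriented_edges t \<Longrightarrow> a \<in> verts t \<and> b \<in> verts t"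
  by (cases t) auto

lemma ccw_distinct: "ccw (a, b, c) \<Longrightarrow> distinct [a, b, c]"
  by (auto simp: ccw_iff_signed_area area_simps)

lemma oriented_edges_distinct: "ccw t \<Longrightarrow> (a, b) \<in> oriented_edges t \<Longrightarrow> a \<noteq> b"
  using ccw_distinct by (cases t) fastforce

lemma oriented_edges_rotate:
  assumes "(a, b) \<in> oriented_edges t" "ccw t"
  obtains c where "ccw (a, b, c)" "open_tri t = open_tri (a, b, c)" "closed_tri t = closed_tri (a, b, c)" "verts t = {a, b, c}"
proof -
  obtain v1 v2 v3 where t: "t = (v1, v2, v3)" by (cases t)
  have cyc: "area2 v1 v2 v3 = area2 v2 v3 v1" "area2 v1 v2 v3 = area2 v3 v1 v2"
    by (auto simp: area_simps algebra_simps)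
  consider "(a, b) = (v1, v2)" | "(a, b) = (v2, v3)" | "(a, b) = (v3, v1)"
    using assms(1) by (auto simp: t)
  then show thesis
  proof cases
    case 1 then show thesis using assms(2) that[of v3] by (auto simp: t)
  next
    case 2 then show thesis
      using assms(2) cyc that[of v1] by (auto simp: t open_tri_def closed_tri_def ccw_iff_signed_area simp del: ccw.simps)
  next
    case 3 then show thesis
      using assms(2) cyc that[of v2] by (auto simp: t open_tri_def closed_tri_def ccw_iff_signed_area simp del: ccw.simps)
  qed
qed

text \<open>At the midpoint of \<open>ab\<close> the coordinates of \<open>a\<close> and
  \<open>b\<close> are half the area, so a small move to the inner side of \<open>ab\<close> keeps
  them positive; \<open>?m\<close> bounds their rate of change.\<close>

lemma half_plane_open_tri:
  assumes "ccw t" "(a, b) \<in> oriented_edges t" "0 < cross2 (b - a) y"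
  shows "\<exists>e>0. \<forall>s. 0 < s \<longrightarrow> s < e \<longrightarrow> midpoint a b + s *\<^sub>R y \<in> open_tri t"
proof -
  obtain c where c: "ccw (a, b, c)" and ot: "open_tri t = open_tri (a, b, c)"
    using oriented_edges_rotate assms by metis
  let ?A = "area2 a b c"
  have pos: "0 < ?A" using c by (simp add: ccw_iff_signed_area)
  let ?m = "\<bar>cross2 (c - b) y\<bar> + \<bar>cross2 (a - c) y\<bar> + 1"
  have bary: "bary (a, b, c) (midpoint a b + s *\<^sub>R y) =
      (?A / 2 + s * cross2 (c - b) y, ?A / 2 + s * cross2 (a - c) y, s * cross2 (b - a) y)" for s
    by (auto simp: area_simps midpoint_nth field_simps)
  show ?thesis
  proof (intro exI[of _ "?A / (2 * ?m)"] conjI allI impI)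
    show "0 < ?A / (2 * ?m)" using pos by simp
  next
    fix s :: real assume s: "0 < s" "s < ?A / (2 * ?m)"
    have "s * ?m < ?A / 2" using s by (simp add: field_simps)
    moreover have "\<bar>s * cross2 (c - b) y\<bar> \<le> s * ?m" "\<bar>s * cross2 (a - c) y\<bar> \<le> s * ?m"
      unfolding abs_mult using s(1) by (auto intro!: mult_mono)
    ultimately show "midpoint a b + s *\<^sub>R y \<in> open_tri t"
      unfolding ot unfolding open_tri_def mem_Collect_eq bary using assms(3) s(1) by auto
  qed
qed

lemma parallel_scale:
  assumes "cross2 x y = 0"
  shows "(x $ 1 * x $ 1 + x $ 2 * x $ 2) *\<^sub>R y = (x $ 1 * y $ 1 + x $ 2 * y $ 2) *\<^sub>R x"
proof -
  have e: "x $ 1 * y $ 2 = x $ 2 * y $ 1" using assms by (simp add: cross2_def)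
  have "x $ 2 * (x $ 2 * y $ 1) = x $ 2 * (x $ 1 * y $ 2)" "x $ 1 * (x $ 1 * y $ 2) = x $ 1 * (x $ 2 * y $ 1)"
    using e by simp_all
  then show ?thesis by (simp add: vec2_eq_iff) (simp add: algebra_simps)
qed

text \<open>Near the common midpoint each triangle fills the inner half-plane of its edge, and two
  open half-planes bounded by lines through one point are disjoint only if they are
  opposite.\<close>

lemma opposite_edges:
  assumes "ccw t" "ccw t'" and disj: "open_tri t \<inter> open_tri t' = {}"
    and ab: "(a, b) \<in> oriented_edges t" and ab': "(a', b') \<in> oriented_edges t'"
    and mid: "midpoint a b = midpoint a' b'"
  obtains k :: real where "0 < k" "b' - a' = - k *\<^sub>R (b - a)"
proof -
  let ?d = "b - a" and ?d' = "b' - a'"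
  have no: "\<not> (0 < cross2 ?d y \<and> 0 < cross2 ?d' y)" for y
  proof
    assume y: "0 < cross2 ?d y \<and> 0 < cross2 ?d' y"
    obtain e where e: "e > 0" "\<And>s. 0 < s \<Longrightarrow> s < e \<Longrightarrow> midpoint a b + s *\<^sub>R y \<in> open_tri t"
      using half_plane_open_tri[OF assms(1) ab] y by meson
    obtain e' where e': "e' > 0" "\<And>s. 0 < s \<Longrightarrow> s < e' \<Longrightarrow> midpoint a b + s *\<^sub>R y \<in> open_tri t'"
      using half_plane_open_tri[OF assms(2) ab'] y mid by metis
    define s where "s = min e e' / 2"
    have "0 < s" "s < e" "s < e'" using e(1) e'(1) by (auto simp: s_def)
    then show False using e(2) e'(2) disj by blast
  qed
  \<comment> \<open>Both cross products with \<open>?d' - ?d\<close> equal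
    \<open>cross2 ?d ?d'\<close>, and both with \<open>?d - ?d'\<close> equal its negative; neither
    sign is possible.\<close>
  have par: "cross2 ?d ?d' = 0"
    using no[of "?d' - ?d"] no[of "?d - ?d'"]
    by (auto simp: cross2_def algebra_simps not_less)
  have "?d \<noteq> 0" "?d' \<noteq> 0"
    using oriented_edges_distinct[OF assms(1) ab] oriented_edges_distinct[OF assms(2) ab'] by auto
  then obtain n where n: "n > 0" "n = ?d $ 1 * ?d $ 1 + ?d $ 2 * ?d $ 2"
    by (metis sum_squares_gt_zero_iff vec2_eq_iff zero_index)
  define k where "k = - (?d $ 1 * ?d' $ 1 + ?d $ 2 * ?d' $ 2) / n"
  have "- k * n = ?d $ 1 * ?d' $ 1 + ?d $ 2 * ?d' $ 2" using n(1) by (simp add: k_def)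
  then have "n *\<^sub>R ?d' = (- k * n) *\<^sub>R ?d" using parallel_scale[OF par] n(2) by simp
  then have "n *\<^sub>R ?d' = n *\<^sub>R (- k *\<^sub>R ?d)" by (simp add: mult.commute)
  then have eq: "?d' = - k *\<^sub>R ?d" using n(1) by (metis less_irrefl scaleR_cancel_left)
  have "k \<noteq> 0" using eq \<open>?d' \<noteq> 0\<close> by auto
  have "\<not> k < 0"
  proof
    assume "k < 0"
    \<comment> \<open>The inner normal of the first edge; for \<open>k < 0\<close> it would be an
      inner direction of the second edge too.\<close>
    let ?y = "vector [- ?d $ 2, ?d $ 1] :: point"
    have "cross2 ?d ?y = n" by (simp add: cross2_def n algebra_simps)
    moreover have "cross2 ?d' ?y = - k * n" unfolding eq
      by (simp add: cross2_def n algebra_simps)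
    ultimately show False using no[of ?y] n(1) \<open>k < 0\<close> by (simp add: mult_neg_pos)
  qed
  then show thesis using that[OF _ eq] \<open>k \<noteq> 0\<close> by simp
qed

section \<open>Children of an element\<close>

definition kids :: "element \<Rightarrow> element set" where
  "kids F = children Red F \<union> children Green F"

primrec root_of :: "element \<Rightarrow> ref_triangle" where
  "root_of (Initial t) = t"
| "root_of (Red1 F) = root_of F"
| "root_of (Red2 F) = root_of F"
| "root_of (Red3 F) = root_of F"
| "root_of (Red4 F) = root_of F"
| "root_of (Green1 F) = root_of F"
| "root_of (Green2 F) = root_of F"

text \<open>Counted in bisections: red quarters the area and counts twice. This makes
  \<open>gen\<close> the exponent of \<open>cc\<close> in the scale of the element, see
  \<open>lattice_pos\<close>.\<close>

primrec gen :: "element \<Rightarrow> nat" where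
  "gen (Initial t) = 0"
| "gen (Red1 F) = Suc (Suc (gen F))"
| "gen (Red2 F) = Suc (Suc (gen F))"
| "gen (Red3 F) = Suc (Suc (gen F))"
| "gen (Red4 F) = Suc (Suc (gen F))"
| "gen (Green1 F) = Suc (gen F)"
| "gen (Green2 F) = Suc (gen F)"

primrec ancs :: "element \<Rightarrow> element set" where
  "ancs (Initial t) = {Initial t}"
| "ancs (Red1 F) = insert (Red1 F) (ancs F)"
| "ancs (Red2 F) = insert (Red2 F) (ancs F)"
| "ancs (Red3 F) = insert (Red3 F) (ancs F)"
| "ancs (Red4 F) = insert (Red4 F) (ancs F)"
| "ancs (Green1 F) = insert (Green1 F) (ancs F)"
| "ancs (Green2 F) = insert (Green2 F) (ancs F)"

definition mids :: "element \<Rightarrow> point set" where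
  "mids F = {mid12 (tri F), mid23 (tri F), mid31 (tri F)}"

lemma kids_eq: "kids F = {Red1 F, Red2 F, Red3 F, Red4 F, Green1 F, Green2 F}"
  by (auto simp: kids_def)

lemma kids_cases [consumes 1, case_names R1 R2 R3 R4 G1 G2]:
  assumes "c \<in> kids F"
  obtains "c = Red1 F" | "c = Red2 F" | "c = Red3 F" | "c = Red4 F" | "c = Green1 F" | "c = Green2 F"
  using assms by (auto simp: kids_eq)

lemma element_kids_induct [case_names Initial kid]:
  assumes "\<And>t. P (Initial t)" "\<And>F c. c \<in> kids F \<Longrightarrow> P F \<Longrightarrow> P c"
  shows "P e"
  by (induction e) (use assms in \<open>auto simp: kids_eq\<close>)

lemma element_exhaust_kids:
  obtains t where "e = Initial t" | F where "e \<in> kids F"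
  by (cases e) (auto simp: kids_eq)

lemma kids_unique: "c \<in> kids F \<Longrightarrow> c \<in> kids F' \<Longrightarrow> F = F'"
  by (auto simp: kids_eq)

lemma Initial_not_kid: "Initial t \<notin> kids F"
  by (auto simp: kids_eq)

lemma children_subset_kids: "children Red F \<subseteq> kids F" "children Green F \<subseteq> kids F"
  by (auto simp: kids_eq)

lemma root_kid: "c \<in> kids F \<Longrightarrow> root_of c = root_of F"
  by (auto simp: kids_eq)

lemma ancs_kid: "c \<in> kids F \<Longrightarrow> ancs c = insert c (ancs F)"
  by (auto simp: kids_eq)

lemma ancs_refl: "e \<in> ancs e"
  by (cases e) auto

lemma gen_kid: "c \<in> kids F \<Longrightarrow> gen F < gen c"
  by (auto simp: kids_eq)

lemma gen_ancs: "f \<in> ancs e \<Longrightarrow> f = e \<or> gen f < gen e"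
proof (induction e rule: element_kids_induct)
  case (kid F c)
  then show ?case using gen_kid[OF kid(1)] by (auto simp: ancs_kid)
qed simp

lemma ancs_trans: "f \<in> ancs e \<Longrightarrow> e \<in> ancs d \<Longrightarrow> f \<in> ancs d"
proof (induction d rule: element_kids_induct)
  case (kid F c)
  then show ?case by (auto simp: ancs_kid)
qed simp

lemma ancs_linear: "f \<in> ancs e \<Longrightarrow> f' \<in> ancs e \<Longrightarrow> f \<in> ancs f' \<or> f' \<in> ancs f"
proof (induction e rule: element_kids_induct)
  case (kid F c)
  then show ?case by (auto simp: ancs_kid ancs_trans)
qed simp

lemma Initial_root_ancs: "Initial (root_of e) \<in> ancs e"
proof (induction e rule: element_kids_induct)
  case (kid F c)
  then show ?case by (auto simp: ancs_kid root_kid)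
qed simp

lemma ancs_via_kid:
  assumes "F \<in> ancs e" "F \<noteq> e"
  obtains k where "k \<in> kids F" "k \<in> ancs e"
proof -
  have "F \<in> ancs e \<Longrightarrow> F \<noteq> e \<Longrightarrow> \<exists>k. k \<in> kids F \<and> k \<in> ancs e"
  proof (induction e rule: element_kids_induct)
    case (kid E c)
    then show ?case by (cases "F = E") (auto simp: ancs_kid ancs_refl)
  qed simp
  then show thesis using assms that by blast
qed

section \<open>Children in the coordinates of their father\<close>

lemma bary_kids:
  assumes "bary (tri F) x = (p, q, r)"
  shows "bary (tri (Red1 F)) x = ((p - q - r) / 4, q / 2, r / 2)"
    and "bary (tri (Red2 F)) x = (p / 2, (q - p - r) / 4, r / 2)"
    and "bary (tri (Red3 F)) x = (p / 2, q / 2, (r - p - q) / 4)"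
    and "bary (tri (Red4 F)) x = ((q + r - p) / 4, (p + r - q) / 4, (p + q - r) / 4)"
    and "bary (tri (Green1 F)) x = (r / 2, (p - q) / 2, q)"
    and "bary (tri (Green2 F)) x = ((q - p) / 2, r / 2, p)"
  using assms
  by (cases "tri F"; auto simp: area_simps midpoint_nth field_simps)+

lemma signed_area_kid:
  assumes "c \<in> kids F"
  shows "signed_area (tri c) = signed_area (tri F) / (if c \<in> children Red F then 4 else 2)"
  using assms
  by (cases "tri F"; cases rule: kids_cases; auto simp: area_simps midpoint_nth field_simps)

lemma ccw_kid: "ccw (tri F) \<Longrightarrow> c \<in> kids F \<Longrightarrow> ccw (tri c)"
  by (auto simp: ccw_iff_signed_area signed_area_kid)

lemma kid_closed_tri: "c \<in> kids F \<Longrightarrow> closed_tri (tri c) \<subseteq> closed_tri (tri F)"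
proof
  fix x assume c: "c \<in> kids F" and x: "x \<in> closed_tri (tri c)"
  obtain p q r where b: "bary (tri F) x = (p, q, r)" using prod_cases3 by blast
  show "x \<in> closed_tri (tri F)"
    using c x unfolding closed_tri_def mem_Collect_eq
    by (cases rule: kids_cases) (simp_all only: bary_kids[OF b] b prod.case, auto)
qed

lemma kid_open_tri: "c \<in> kids F \<Longrightarrow> open_tri (tri c) \<subseteq> open_tri (tri F)"
proof
  fix x assume c: "c \<in> kids F" and x: "x \<in> open_tri (tri c)"
  obtain p q r where b: "bary (tri F) x = (p, q, r)" using prod_cases3 by blast
  show "x \<in> open_tri (tri F)"
    using c x unfolding open_tri_def mem_Collect_eq
    by (cases rule: kids_cases) (simp_all only: bary_kids[OF b] b prod.case, auto)
qed

lemma sibling_open_tri_disjoint: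
  assumes "p \<in> {Red, Green}" "c \<in> children p F" "c' \<in> children p F" "c \<noteq> c'"
  shows "open_tri (tri c) \<inter> open_tri (tri c') = {}"
proof (intro equals0I)
  fix x assume x: "x \<in> open_tri (tri c) \<inter> open_tri (tri c')"
  obtain u v w where b: "bary (tri F) x = (u, v, w)" using prod_cases3 by blast
  show False
    using assms x unfolding open_tri_def
    by (auto simp: bary_kids[OF b] simp del: tri.simps)
qed

lemma children_cover:
  assumes "p \<in> {Red, Green}" "x \<in> closed_tri (tri F)"
  shows "\<exists>c\<in>children p F. x \<in> closed_tri (tri c)"
proof -
  obtain u v w where b: "bary (tri F) x = (u, v, w)" using prod_cases3 by blast
  have "u \<ge> 0" "v \<ge> 0" "w \<ge> 0" using assms(2) by (auto simp: closed_tri_def b)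
  then show ?thesis
    using assms(1) unfolding closed_tri_def
    by (auto simp: bary_kids[OF b] simp del: tri.simps)
qed

lemma bary_corner:
  assumes "ccw (tri F)" "x \<in> verts (tri F)"
  shows "\<exists>A>0. bary (tri F) x \<in> {(A, 0, 0), (0, A, 0), (0, 0, A)} \<and> signed_area (tri F) = A"
  using assms verts_iff_bary ccw_iff_signed_area by blast

lemma bary_mids:
  "bary t (mid12 t) = (signed_area t / 2, signed_area t / 2, 0)"
  "bary t (mid23 t) = (0, signed_area t / 2, signed_area t / 2)"
  "bary t (mid31 t) = (signed_area t / 2, 0, signed_area t / 2)"
  by (cases t; auto simp: area_simps midpoint_nth field_simps)+

lemma kid_corner:
  assumes "ccw (tri F)" "c \<in> kids F" "x \<in> verts (tri F)" "x \<in> closed_tri (tri c)"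
  shows "x \<in> verts (tri c)"
proof -
  obtain A where A: "A > 0" "bary (tri F) x \<in> {(A, 0, 0), (0, A, 0), (0, 0, A)}" "signed_area (tri F) = A"
    using bary_corner assms by blast
  then consider (1) "bary (tri F) x = (A, 0, 0)" | (2) "bary (tri F) x = (0, A, 0)" | (3) "bary (tri F) x = (0, 0, A)"
    by blast
  then show ?thesis
    unfolding verts_iff_bary[OF ccw_kid[OF assms(1,2)]] signed_area_kid[OF assms(2)]
    using assms(2,4) A(1,3) unfolding closed_tri_def
    by cases (erule kids_cases; simp add: bary_kids del: tri.simps)+
qed

lemma red_mids_corner:
  assumes "ccw (tri F)" "c \<in> children Red F" "x \<in> mids F" "x \<in> closed_tri (tri c)"
  shows "x \<in> verts (tri c)"
proof -
  have c: "c \<in> kids F" using assms(2) children_subset_kids by blast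
  have A: "signed_area (tri F) > 0" using assms(1) ccw_iff_signed_area by blast
  show ?thesis
    unfolding verts_iff_bary[OF ccw_kid[OF assms(1) c]] signed_area_kid[OF c]
    using assms(2,3,4) A unfolding closed_tri_def mids_def
    by (auto simp: bary_kids[OF bary_mids(1)] bary_kids[OF bary_mids(2)] bary_kids[OF bary_mids(3)] simp del: tri.simps)
qed

lemma green_mid_corner:
  "c \<in> children Green F \<Longrightarrow> mid12 (tri F) \<in> verts (tri c)"
  by (cases "tri F") auto

lemma green_mids_not_in:
  assumes "ccw (tri F)"
  shows "mid31 (tri F) \<notin> closed_tri (tri (Green2 F))" "mid23 (tri F) \<notin> closed_tri (tri (Green1 F))"
proof -
  have A: "signed_area (tri F) > 0" using assms(1) ccw_iff_signed_area by blast
  then show "mid31 (tri F) \<notin> closed_tri (tri (Green2 F))" "mid23 (tri F) \<notin> closed_tri (tri (Green1 F))"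
    unfolding closed_tri_def
    by (simp_all add: bary_kids[OF bary_mids(2)] bary_kids[OF bary_mids(3)] del: tri.simps)
qed

lemma kid_verts:
  "c \<in> kids F \<Longrightarrow> verts (tri c) \<subseteq> verts (tri F) \<union> mids F"
  "c \<in> children Green F \<Longrightarrow> verts (tri c) \<subseteq> verts (tri F) \<union> {mid12 (tri F)}"
  by (cases "tri F"; auto simp: kids_eq mids_def)+

lemma mids_closed_tri: "ccw (tri F) \<Longrightarrow> mids F \<subseteq> closed_tri (tri F)"
  by (auto simp: mids_def closed_tri_def bary_mids ccw_iff_signed_area)

lemma mids_not_verts: "ccw (tri F) \<Longrightarrow> x \<in> mids F \<Longrightarrow> x \<notin> verts (tri F)"
  by (auto simp: verts_iff_bary mids_def bary_mids ccw_iff_signed_area)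

lemma six_points_distinct:
  assumes "ccw (a, b, c)"
  shows "distinct [a, b, c, midpoint a b, midpoint b c, midpoint c a]"
proof -
  let ?t = "(a, b, c)"
  have A: "signed_area ?t > 0" using assms ccw_iff_signed_area by blast
  have "distinct (map (bary ?t) [a, b, c, mid12 ?t, mid23 ?t, mid31 ?t])"
    using A by (simp add: bary_vertex bary_mids del: bary.simps mid12.simps mid23.simps mid31.simps)
  then show ?thesis unfolding distinct_map by simp
qed

lemma anc_closed_tri: "f \<in> ancs e \<Longrightarrow> closed_tri (tri e) \<subseteq> closed_tri (tri f)"
proof (induction e rule: element_kids_induct)
  case (kid F c)
  then show ?case using kid_closed_tri[OF kid(1)] by (auto simp: ancs_kid)
qed simp

lemma anc_open_tri: "f \<in> ancs e \<Longrightarrow> open_tri (tri e) \<subseteq> open_tri (tri f)"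
proof (induction e rule: element_kids_induct)
  case (kid F c)
  then show ?case using kid_open_tri[OF kid(1)] by (auto simp: ancs_kid)
qed simp

lemma ccw_root: "ccw (root_of e) \<Longrightarrow> ccw (tri e)"
proof (induction e rule: element_kids_induct)
  case (kid F c)
  then show ?case using ccw_kid by (auto simp: root_kid)
qed simp

text \<open>Vertices persist. Elements are nested, so the point lies in every element between
  \<open>f\<close> and \<open>e\<close>, and \<open>kid_corner\<close> passes it on as a corner one
  generation at a time.\<close>

lemma anc_corner:
  assumes "ccw (root_of e)" "f \<in> ancs e" "x \<in> verts (tri f)" "x \<in> closed_tri (tri e)"
  shows "x \<in> verts (tri e)"
  using assms
proof (induction e rule: element_kids_induct)
  case (kid F c)
  show ?case
  proof (cases "f = c")
    case False
    then have "x \<in> verts (tri F)"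
      using kid kid_closed_tri[OF kid(1)] by (auto simp: ancs_kid root_kid)
    then show ?thesis using kid kid_corner ccw_root by (auto simp: root_kid)
  qed (use kid in auto)
qed simp

section \<open>Refinement forests\<close>

lemma card_three:
  assumes "finite A" "finite B" "finite C" "A \<inter> B = {}" "A \<inter> C = {}" "B \<inter> C = {}"
  shows "card (A \<union> B \<union> C) = card A + card B + card C"
proof -
  have "(A \<union> B) \<inter> C = {}" using assms by blast
  then show ?thesis using assms by (simp add: card_Un_disjoint)
qed

definition leaves :: "element set \<Rightarrow> element set" where
  "leaves X = {e \<in> X. kids e \<inter> X = {}}"

text \<open>Midpoints of the refined edges. Siblings are present all together or not at all, so
  \<open>Red1\<close> and \<open>Green1\<close> decide which pattern was used.\<close>

definition split_mids :: "element set \<Rightarrow> element \<Rightarrow> point set" where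
  "split_mids X F = (if Red1 F \<in> X then mids F else if Green1 F \<in> X then {mid12 (tri F)} else {})"

text \<open>The refined elements in which \<open>a\<close> arises as an edge midpoint, one for each
  side of the refined edge.\<close>

definition splitters :: "element set \<Rightarrow> point \<Rightarrow> element set" where
  "splitters X a = {F \<in> X. a \<in> split_mids X F}"

definition leaves_below :: "element set \<Rightarrow> element \<Rightarrow> point \<Rightarrow> element set" where
  "leaves_below X k a = {e \<in> leaves X. k \<in> ancs e \<and> a \<in> verts (tri e)}"

locale initial_triangulation =
  fixes T0 :: "ref_triangle set"
  assumes finite_T0: "finite T0"
    and ccw_T0: "t \<in> T0 \<Longrightarrow> ccw t"
    and disjoint_T0: "s \<in> T0 \<Longrightarrow> t \<in> T0 \<Longrightarrow> s \<noteq> t \<Longrightarrow> open_tri s \<inter> open_tri t = {}"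
    and common_edge: "s \<in> T0 \<Longrightarrow> t \<in> T0 \<Longrightarrow> s \<noteq> t \<Longrightarrow> p \<in> closed_tri s \<Longrightarrow> p \<in> closed_tri t \<Longrightarrow>
      p \<notin> verts t \<Longrightarrow> \<exists>E \<in> edges s \<inter> edges t. p \<in> E"

text \<open>\<open>X\<close> holds the current elements and all their ancestors; the current
  triangulation is \<open>leaves X\<close>. Blue patterns appear as two nested green families, so
  only red and green families occur.\<close>

locale forest = initial_triangulation +
  fixes X :: "element set"
  assumes finite_X: "finite X"
    and Initial_X: "Initial t \<in> X \<longleftrightarrow> t \<in> T0"
    and parent_X: "c \<in> kids F \<Longrightarrow> c \<in> X \<Longrightarrow> F \<in> X"
    and kids_X: "kids F \<inter> X = {} \<or> kids F \<inter> X = children Red F \<or> kids F \<inter> X = children Green F"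

section \<open>Conformity and hanging nodes\<close>

lemma edge_oriented: "E \<in> edges t \<longleftrightarrow> (\<exists>(u, v) \<in> oriented_edges t. E = closed_segment u v)"
  by (cases t) auto

lemma vertex_on_edge:
  assumes "ccw t" "(u, v) \<in> oriented_edges t" "x \<in> verts t" "x \<in> closed_segment u v"
  shows "x = u \<or> x = v"
proof -
  obtain w where w: "ccw (u, v, w)" "verts t = {u, v, w}"
    using oriented_edges_rotate assms by metis
  obtain l where x: "x = (1 - l) *\<^sub>R u + l *\<^sub>R v" using assms(4) by (auto simp: in_segment)
  have "area2 u v x = 0" unfolding x by (simp add: area_simps algebra_simps)
  then have "x \<noteq> w" using w(1) by (auto simp: ccw_iff_signed_area)
  then show ?thesis using assms(3) w(2) by blast
qed

lemma vertex_on_common_edge: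
  assumes "ccw s" "E \<in> edges s \<inter> edges t" "x \<in> E" "x \<in> verts s"
  shows "x \<in> verts t"
proof -
  obtain u v where uv: "(u, v) \<in> oriented_edges s" "E = closed_segment u v"
    using assms(2) edge_oriented by auto
  obtain u' v' where uv': "(u', v') \<in> oriented_edges t" "E = closed_segment u' v'"
    using assms(2) edge_oriented by auto
  have "x = u \<or> x = v" using vertex_on_edge assms uv by blast
  moreover have "{u, v} = {u', v'}" using uv(2) uv'(2) closed_segment_eq by metis
  ultimately show ?thesis using oriented_edges_verts[OF uv'(1)] by auto
qed

lemma conforming_common_edge:
  assumes "conforming T" "s \<in> T" "t \<in> T" "s \<noteq> t" "p \<in> triangle s" "p \<in> triangle t" "p \<notin> verts t"
  shows "\<exists>E \<in> edges s \<inter> edges t. p \<in> E"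
proof -
  consider "triangle s \<inter> triangle t = {}" | v where "v \<in> verts s \<inter> verts t" "triangle s \<inter> triangle t = {v}"
    | E where "E \<in> edges s \<inter> edges t" "triangle s \<inter> triangle t = E"
    using assms(1-4) unfolding conforming_def by blast
  then show ?thesis
  proof cases
    case 1
    then show ?thesis using assms(5,6) by blast
  next
    case 2
    then have "p = v" using assms(5,6) by blast
    then show ?thesis using 2(1) assms(7) by blast
  next
    case 3
    then have "p \<in> E" using assms(5,6) by blast
    then show ?thesis using 3(1) by blast
  qed
qed

lemma conforming_triangulation_initial:
  assumes "conforming_triangulation \<Omega> T0"
  shows "initial_triangulation T0"
proof
  have tri: "triangulation \<Omega> T0" and conf: "conforming T0"
    using assms by (auto simp: conforming_triangulation_def)
  show "finite T0" using tri by (simp add: triangulation_def)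
  show ccw: "ccw t" if "t \<in> T0" for t using tri that by (auto simp: triangulation_def)
  show "open_tri s \<inter> open_tri t = {}" if "s \<in> T0" "t \<in> T0" "s \<noteq> t" for s t
    using tri that open_tri_subset_interior[OF ccw] unfolding triangulation_def by blast
  show "\<exists>E\<in>edges s \<inter> edges t. p \<in> E"
    if "s \<in> T0" "t \<in> T0" "s \<noteq> t" "p \<in> closed_tri s" "p \<in> closed_tri t" "p \<notin> verts t" for s t p
    using conforming_common_edge[OF conf] that ccw triangle_eq_closed_tri by auto
qed

text \<open>The invariant of the coarsening sequence: a consequence of conformity that speaks only
  of points and elements, so it can be checked for one new element at a time.\<close>

definition no_hanging :: "ref_triangle set \<Rightarrow> bool" where
  "no_hanging T \<longleftrightarrow> (\<forall>t\<in>T. \<forall>n\<in>nodes T. n \<in> closed_tri t \<longrightarrow> n \<in> verts t)"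

lemma conforming_triangulation_no_hanging:
  assumes "conforming_triangulation \<Omega> T"
  shows "no_hanging T"
  unfolding no_hanging_def
proof (intro ballI impI)
  have tri: "triangulation \<Omega> T" and conf: "conforming T"
    using assms by (auto simp: conforming_triangulation_def)
  have ccw: "ccw t" if "t \<in> T" for t using tri that by (auto simp: triangulation_def)
  fix t n assume t: "t \<in> T" and n: "n \<in> nodes T" "n \<in> closed_tri t"
  then obtain s where s: "s \<in> T" "n \<in> verts s" by (auto simp: nodes_def)
  show "n \<in> verts t"
  proof (rule ccontr)
    assume nt: "n \<notin> verts t"
    have "n \<in> triangle s" "n \<in> triangle t"
      using s t n ccw verts_subset_closed_tri triangle_eq_closed_tri by blast+
    then obtain E where "E \<in> edges s \<inter> edges t" "n \<in> E"
      using conforming_common_edge[OF conf s(1) t _ _ _ nt] s(2) nt by blast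
    then show False using vertex_on_common_edge s nt ccw by blast
  qed
qed

context forest
begin

lemma anc_X: "f \<in> ancs e \<Longrightarrow> e \<in> X \<Longrightarrow> f \<in> X"
proof (induction e rule: element_kids_induct)
  case (kid F c)
  then show ?case using parent_X by (auto simp: ancs_kid)
qed simp

lemma root_T0: "e \<in> X \<Longrightarrow> root_of e \<in> T0"
  using anc_X Initial_root_ancs Initial_X by blast

lemma ccw_X: "e \<in> X \<Longrightarrow> ccw (tri e)"
  using root_T0 ccw_T0 ccw_root by blast

lemma kids_X_cases:
  obtains (leaf) "kids F \<inter> X = {}" "Red1 F \<notin> X" "Green1 F \<notin> X"
  | (red) "kids F \<inter> X = children Red F" "Red1 F \<in> X" "Green1 F \<notin> X"
  | (green) "kids F \<inter> X = children Green F" "Red1 F \<notin> X" "Green1 F \<in> X"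
proof -
  have k: "Red1 F \<in> kids F" "Green1 F \<in> kids F" by (simp_all add: kids_eq)
  from kids_X[of F] show thesis
  proof (elim disjE)
    assume "kids F \<inter> X = {}"
    then show thesis using k leaf by blast
  next
    assume *: "kids F \<inter> X = children Red F"
    then have "Red1 F \<in> kids F \<inter> X" "Green1 F \<notin> kids F \<inter> X" by simp_all
    then show thesis using * k red by blast
  next
    assume *: "kids F \<inter> X = children Green F"
    then have "Red1 F \<notin> kids F \<inter> X" "Green1 F \<in> kids F \<inter> X" by simp_all
    then show thesis using * k green by blast
  qed
qed

lemma leaves_X: "e \<in> leaves X \<Longrightarrow> e \<in> X"
  by (simp add: leaves_def)

lemma inner_X: "c \<in> kids F \<Longrightarrow> c \<in> X \<Longrightarrow> F \<notin> leaves X"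
  by (auto simp: leaves_def)

lemma leaf_anc: "f \<in> leaves X \<Longrightarrow> f \<in> ancs e \<Longrightarrow> e \<in> X \<Longrightarrow> f = e"
  by (meson ancs_via_kid anc_X inner_X)

lemma siblings_disjoint:
  assumes "c \<in> kids F" "c' \<in> kids F" "c \<in> X" "c' \<in> X" "c \<noteq> c'"
  shows "open_tri (tri c) \<inter> open_tri (tri c') = {}"
  using kids_X[of F] assms sibling_open_tri_disjoint[of Red c F c'] sibling_open_tri_disjoint[of Green c F c']
  by blast

text \<open>Incomparable elements have different roots, or lie in two different children of a common
  ancestor; in both cases these larger triangles are already disjoint.\<close>

lemma incomparable_disjoint:
  assumes "e \<in> X" "f \<in> X" "e \<notin> ancs f" "f \<notin> ancs e"
  shows "open_tri (tri e) \<inter> open_tri (tri f) = {}"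
  using assms
proof (induction e rule: element_kids_induct)
  case (Initial t)
  have "root_of f \<noteq> t" using Initial_root_ancs[of f] Initial.prems(3) by blast
  then have "open_tri t \<inter> open_tri (root_of f) = {}"
    using disjoint_T0 root_T0[OF Initial.prems(2)] Initial.prems(1) Initial_X by auto
  then show ?case using anc_open_tri[OF Initial_root_ancs[of f]] by auto
next
  case (kid E c)
  have E: "E \<in> X" using kid parent_X by blast
  show ?case
  proof (cases "E \<in> ancs f")
    case True
    have "E \<noteq> f" using kid.prems(4) kid.hyps by (auto simp: ancs_kid ancs_refl)
    then obtain k where k: "k \<in> kids E" "k \<in> ancs f" using True ancs_via_kid by blast
    then have "open_tri (tri c) \<inter> open_tri (tri k) = {}"
      using kid siblings_disjoint anc_X by blast
    then show ?thesis using anc_open_tri[OF k(2)] by blast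
  next
    case False
    then have "open_tri (tri E) \<inter> open_tri (tri f) = {}"
      using kid E by (auto simp: ancs_kid)
    then show ?thesis using kid_open_tri[OF kid.hyps] by blast
  qed
qed

section \<open>The refined elements at a node\<close>

lemma splittersD:
  assumes "F \<in> splitters X a"
  shows "F \<in> X" "a \<in> mids F" "F \<notin> leaves X" "a \<notin> verts (tri F)" "a \<in> closed_tri (tri F)"
proof -
  show F: "F \<in> X" "a \<in> mids F" "F \<notin> leaves X"
    using assms inner_X[of _ F]
    by (auto simp: splitters_def split_mids_def mids_def kids_eq split: if_splits)
  show "a \<notin> verts (tri F)" "a \<in> closed_tri (tri F)"
    using F mids_not_verts mids_closed_tri ccw_X by blast+
qed

lemma splitter_cases:
  assumes "F \<in> splitters X a"
  obtains (red) "kids F \<inter> X = children Red F" "Red1 F \<in> X" "a \<in> mids F"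
  | (green) "kids F \<inter> X = children Green F" "Green1 F \<in> X" "a = mid12 (tri F)"
  using assms by (cases rule: kids_X_cases[of F]) (auto simp: splitters_def split_mids_def)

lemma splitter_kid_corner:
  assumes "F \<in> splitters X a" "k \<in> kids F" "k \<in> X" "a \<in> closed_tri (tri k)"
  shows "a \<in> verts (tri k)"
  using assms(1)
proof (cases rule: splitter_cases)
  case red
  then show ?thesis using assms red_mids_corner[of F k a] ccw_X splittersD(1) by blast
next
  case green
  then show ?thesis using assms green_mid_corner by blast
qed

text \<open>Once \<open>F\<close> is refined at \<open>a\<close>, the node is a corner of every
  descendant of \<open>F\<close> that contains it, and a corner is not an edge midpoint of the same
  element.\<close>

lemma splitter_unique:
  assumes "F \<in> splitters X a" "F' \<in> splitters X a" "F \<in> ancs F'"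
  shows "F = F'"
proof (rule ccontr)
  assume "F \<noteq> F'"
  then obtain k where k: "k \<in> kids F" "k \<in> ancs F'" using assms(3) ancs_via_kid by blast
  have "a \<in> closed_tri (tri k)"
    using splittersD(5)[OF assms(2)] anc_closed_tri[OF k(2)] by blast
  then have "a \<in> verts (tri k)"
    using splitter_kid_corner assms(1) k anc_X splittersD(1)[OF assms(2)] by blast
  then have "a \<in> verts (tri F')"
    using anc_corner k(2) splittersD[OF assms(2)] root_T0 ccw_T0 by blast
  then show False using splittersD(4)[OF assms(2)] by blast
qed

lemma splitters_disjoint:
  assumes "F \<in> splitters X a" "F' \<in> splitters X a" "F \<noteq> F'"
  shows "open_tri (tri F) \<inter> open_tri (tri F') = {}"
  using incomparable_disjoint splitter_unique assms splittersD(1) by metis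

text \<open>Going up from \<open>e\<close>, some father must be the first that no longer has
  \<open>a\<close> as a vertex; \<open>a\<close> was created by refining it.\<close>

lemma vertex_splitter:
  assumes "e \<in> X" "a \<in> verts (tri e)" "a \<notin> verts (root_of e)"
  shows "\<exists>F k. F \<in> splitters X a \<and> k \<in> kids F \<and> k \<in> ancs e \<and> a \<in> verts (tri k)"
  using assms
proof (induction e rule: element_kids_induct)
  case (kid F c)
  have F: "F \<in> X" using kid parent_X by blast
  show ?case
  proof (cases "a \<in> verts (tri F)")
    case True
    then show ?thesis using kid F by (auto simp: ancs_kid root_kid)
  next
    case False
    have "a \<in> split_mids X F"
      using kids_X[of F] kid_verts[of c F] kid.hyps kid.prems(1,2) False
      by (auto simp: split_mids_def)
    then show ?thesis using F kid.hyps kid.prems(2) ancs_refl by (auto simp: splitters_def)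
  qed
qed simp

text \<open>By conformity of \<open>T0\<close>, an initial node in an initial triangle is one of its
  vertices, hence a corner of each descendant containing it and no edge midpoint there.\<close>

lemma splitter_not_node0:
  assumes "F \<in> splitters X a"
  shows "a \<notin> nodes T0"
proof
  note F = splittersD[OF assms]
  assume "a \<in> nodes T0"
  then obtain s where s: "s \<in> T0" "a \<in> verts s" by (auto simp: nodes_def)
  let ?t = "root_of F"
  have t: "?t \<in> T0" using F(1) root_T0 by blast
  have at: "a \<in> closed_tri ?t"
    using anc_closed_tri[OF Initial_root_ancs[of F]] F(5) by auto
  have nat: "a \<notin> verts ?t"
    using anc_corner[OF ccw_T0[OF t] Initial_root_ancs, of a] F(4,5) by auto
  then obtain E where "E \<in> edges s \<inter> edges ?t" "a \<in> E"
    using common_edge[OF s(1) t] s verts_subset_closed_tri[OF ccw_T0[OF s(1)]] at by auto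
  then show False using vertex_on_common_edge s nat ccw_T0 by blast
qed

section \<open>Counting the elements at a node\<close>

lemma finite_leaves_below: "finite (leaves_below X k a)"
  using finite_X by (auto simp: leaves_below_def leaves_def)

lemma leaves_below_leaf:
  "k \<in> leaves X \<Longrightarrow> a \<in> verts (tri k) \<Longrightarrow> leaves_below X k a = {k}"
  using leaf_anc leaves_X ancs_refl by (auto simp: leaves_below_def)

lemma leaves_below_disjoint:
  "k \<in> kids F \<Longrightarrow> k' \<in> kids F \<Longrightarrow> k \<noteq> k' \<Longrightarrow> leaves_below X k a \<inter> leaves_below X k' a = {}"
proof (rule equals0I)
  fix e assume k: "k \<in> kids F" "k' \<in> kids F" "k \<noteq> k'"
    and "e \<in> leaves_below X k a \<inter> leaves_below X k' a"
  then have "k \<in> ancs k' \<or> k' \<in> ancs k" using ancs_linear by (auto simp: leaves_below_def)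
  then have "k \<in> ancs F \<or> k' \<in> ancs F" using k by (auto simp: ancs_kid)
  then show False using gen_ancs[of _ F] gen_kid[OF k(1)] gen_kid[OF k(2)] by fastforce
qed

text \<open>The recursion behind all counts: under either assumption a child containing
  \<open>a\<close> has it as a corner, so the leaves at \<open>a\<close> are reached only through
  such children.\<close>

lemma leaves_below_inner:
  assumes "k \<in> X" "k \<notin> leaves X" "a \<in> verts (tri k) \<or> k \<in> splitters X a"
  shows "leaves_below X k a = (\<Union>c\<in>{c \<in> kids k \<inter> X. a \<in> verts (tri c)}. leaves_below X c a)"
proof (intro set_eqI iffI)
  fix e assume "e \<in> leaves_below X k a"
  then have e: "e \<in> leaves X" "k \<in> ancs e" "a \<in> verts (tri e)" by (auto simp: leaves_below_def)
  have "k \<noteq> e" using e(1) assms(2) by blast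
  then obtain c where c: "c \<in> kids k" "c \<in> ancs e" by (rule ancs_via_kid[OF e(2)])
  have cX: "c \<in> X" using c e anc_X leaves_X by blast
  have "a \<in> closed_tri (tri e)"
    using verts_subset_closed_tri[OF ccw_X[OF leaves_X[OF e(1)]]] e(3) by blast
  then have ac: "a \<in> closed_tri (tri c)"
    using anc_closed_tri[OF c(2)] by blast
  from assms(3) have "a \<in> verts (tri c)"
    using kid_corner[OF ccw_X[OF assms(1)] c(1) _ ac] splitter_kid_corner[OF _ c(1) cX ac] by metis
  then show "e \<in> (\<Union>c\<in>{c \<in> kids k \<inter> X. a \<in> verts (tri c)}. leaves_below X c a)"
    using c cX e by (auto simp: leaves_below_def)
next
  fix e assume "e \<in> (\<Union>c\<in>{c \<in> kids k \<inter> X. a \<in> verts (tri c)}. leaves_below X c a)"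
  then obtain c where c: "c \<in> kids k" "e \<in> leaves X" "c \<in> ancs e" "a \<in> verts (tri e)"
    by (auto simp: leaves_below_def)
  have "k \<in> ancs c" using c(1) by (simp add: ancs_kid ancs_refl)
  then show "e \<in> leaves_below X k a"
    using c ancs_trans[OF _ c(3)] by (auto simp: leaves_below_def)
qed

text \<open>No edge of a descendant starts at an endpoint of the reference edge and enters the
  interior of the triangle, whereas the apex angle is bisected by a green refinement.\<close>

lemma corner_count:
  assumes "k \<in> X" "tri k = (v1, v2, v3)"
  shows "card (leaves_below X k v1) = 1 \<and> card (leaves_below X k v2) = 1 \<and>
    card (leaves_below X k v3) \<in> {1, 2} \<and> (Green1 k \<in> X \<longrightarrow> card (leaves_below X k v3) = 2)"
  using assms
\<comment> \<open>\<open>gen\<close> grows from father to child and is bounded on the finite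
  \<open>X\<close>, so the measure decreases towards the leaves.\<close>
proof (induction "Max (gen ` X) - gen k" arbitrary: k v1 v2 v3 rule: less_induct)
  case less
  note k = less.prems
  have "ccw (v1, v2, v3)" using ccw_X k by metis
  from six_points_distinct[OF this] have dist: "distinct [v1, v2, v3, midpoint v1 v2, midpoint v2 v3, midpoint v3 v1]" .
  have IH: "card (leaves_below X c w1) = 1 \<and> card (leaves_below X c w2) = 1 \<and>
    card (leaves_below X c w3) \<in> {1, 2}" if "c \<in> kids k" "c \<in> X" "tri c = (w1, w2, w3)" for c w1 w2 w3
  proof -
    have "gen c \<le> Max (gen ` X)" using that(2) finite_X by simp
    then have "Max (gen ` X) - gen c < Max (gen ` X) - gen k"
      using gen_kid[OF that(1)] by linarith
    then show ?thesis using less.hyps that by blast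
  qed
  show ?case
  proof (cases rule: kids_X_cases[of k])
    case leaf
    then have "k \<in> leaves X" using k by (simp add: leaves_def)
    then show ?thesis using leaves_below_leaf leaf k by simp
  next
    case red
    then have nl: "k \<notin> leaves X" by (auto simp: leaves_def)
    have in_X: "Red1 k \<in> X" "Red2 k \<in> X" "Red3 k \<in> X" using red(1) by auto
    have "{c \<in> kids k \<inter> X. v1 \<in> verts (tri c)} = {Red1 k}"
      "{c \<in> kids k \<inter> X. v2 \<in> verts (tri c)} = {Red2 k}"
      "{c \<in> kids k \<inter> X. v3 \<in> verts (tri c)} = {Red3 k}"
      unfolding red(1) using dist k(2) by auto
    then have "leaves_below X k v1 = leaves_below X (Red1 k) v1"
      "leaves_below X k v2 = leaves_below X (Red2 k) v2"
      "leaves_below X k v3 = leaves_below X (Red3 k) v3"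
      using leaves_below_inner[OF k(1) nl] k(2) by simp_all
    then show ?thesis
      using IH[of "Red1 k"] IH[of "Red2 k"] IH[of "Red3 k"] k(2) in_X red(3) by (simp add: kids_eq)
  next
    case green
    then have nl: "k \<notin> leaves X" by (auto simp: leaves_def)
    have in_X: "Green1 k \<in> X" "Green2 k \<in> X" using green(1) by auto
    have "{c \<in> kids k \<inter> X. v1 \<in> verts (tri c)} = {Green1 k}"
      "{c \<in> kids k \<inter> X. v2 \<in> verts (tri c)} = {Green2 k}"
      "{c \<in> kids k \<inter> X. v3 \<in> verts (tri c)} = {Green1 k, Green2 k}"
      unfolding green(1) using dist k(2) by auto
    then have "leaves_below X k v1 = leaves_below X (Green1 k) v1"
      "leaves_below X k v2 = leaves_below X (Green2 k) v2"
      "leaves_below X k v3 = leaves_below X (Green1 k) v3 \<union> leaves_below X (Green2 k) v3"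
      using leaves_below_inner[OF k(1) nl] k(2) by simp_all
    moreover have "leaves_below X (Green1 k) v3 \<inter> leaves_below X (Green2 k) v3 = {}"
      by (rule leaves_below_disjoint[of _ k]) (auto simp: kids_eq)
    ultimately show ?thesis
      using IH[of "Green1 k"] IH[of "Green2 k"] k(2) in_X
      by (simp add: kids_eq card_Un_disjoint finite_leaves_below)
  qed
qed

lemma leaves_below_card_pos:
  assumes "k \<in> X" "a \<in> verts (tri k)"
  shows "card (leaves_below X k a) \<in> {1, 2}"
  using corner_count[OF assms(1)] assms(2) by (cases "tri k") auto

lemma leaves_below_card_apex:
  assumes "k \<in> X" "a \<in> verts (tri k)" "a \<noteq> apex (tri k)"
  shows "card (leaves_below X k a) = 1"
  using corner_count[OF assms(1)] assms(2,3) by (cases "tri k") auto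

lemma vertex_is_node:
  assumes "e \<in> X" "a \<in> verts (tri e)"
  shows "a \<in> nodes (tri ` leaves X)"
proof -
  have "leaves_below X e a \<noteq> {}" using leaves_below_card_pos[OF assms] by auto
  then show ?thesis by (auto simp: leaves_below_def nodes_def)
qed

section \<open>The share of one side of a refined edge\<close>

abbreviation middles :: "element set" where "middles \<equiv> red_middle (leaves X)"

text \<open>The vertices of a red middle element are edge midpoints of its father, whereas a vertex
  of a proper ancestor that lies in the father is a corner of the father.\<close>

lemma middle_below:
  assumes "e \<in> middles" "k \<in> ancs e" "a \<in> verts (tri k)" "a \<in> verts (tri e)"
  shows "e = k"
proof (rule ccontr)
  obtain E where E: "e = Red4 E" "e \<in> leaves X" using assms(1) by (auto simp: red_middle_def)
  have EX: "E \<in> X" "e \<in> kids E" using E leaves_X parent_X[of e E] by (auto simp: kids_eq)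
  assume "e \<noteq> k"
  then have k: "k \<in> ancs E" using assms(2) E(1) by simp
  have "a \<in> mids E" using assms(4) E(1) by (auto simp: mids_def)
  moreover have "a \<in> verts (tri E)"
    using anc_corner[OF _ k assms(3)] ccw_T0 root_T0 EX(1) mids_closed_tri ccw_X calculation by blast
  ultimately show False using mids_not_verts ccw_X EX(1) by blast
qed

definition side_count :: "element \<Rightarrow> point \<Rightarrow> nat" where
  "side_count F a = card (leaves_below X F a - middles)"

text \<open>At an edge midpoint of a red pattern the middle child meets two outer ones.
  \<open>l\<close> is the child among the three that has \<open>a\<close> as newest vertex; in the
  other two \<open>a\<close> is an end point of the reference edge, where by
  \<open>corner_count\<close> exactly one leaf is found.\<close>

lemma red_side_count:
  assumes F: "F \<in> splitters X a" and red: "Red1 F \<in> X"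
  obtains k\<^sub>1 k\<^sub>2 l where
    "{k \<in> children Red F. a \<in> verts (tri k)} = {k\<^sub>1, k\<^sub>2, Red4 F}"
    "\<And>k. k \<in> children Red F \<Longrightarrow> a = apex (tri k) \<Longrightarrow> \<nexists>G. k = Red3 G \<Longrightarrow> k = l"
    "\<And>k. k \<in> {k\<^sub>1, k\<^sub>2, Red4 F} \<Longrightarrow> k \<noteq> l \<Longrightarrow> a \<noteq> apex (tri k)"
    "side_count F a = card (leaves_below X (Red4 F) a - middles)
      + card (leaves_below X k\<^sub>1 a) + card (leaves_below X k\<^sub>2 a)"
proof -
  note FX = splittersD[OF F]
  have kX: "kids F \<inter> X = children Red F" using red by (cases rule: kids_X_cases[of F]) blast+
  obtain v1 v2 v3 where t: "tri F = (v1, v2, v3)" by (cases "tri F")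
  have "ccw (v1, v2, v3)" using ccw_X FX(1) t by metis
  from six_points_distinct[OF this] have dist: "distinct [v1, v2, v3, midpoint v1 v2, midpoint v2 v3, midpoint v3 v1]" .
  then have dist': "distinct [midpoint v3 v1, midpoint v2 v3, midpoint v1 v2, v3, v2, v1]" by auto
  have Un: "leaves_below X F a = (\<Union>c\<in>{c \<in> children Red F. a \<in> verts (tri c)}. leaves_below X c a)"
    using leaves_below_inner[OF FX(1,3)] F kX by simp
  have main: "side_count F a = card (leaves_below X (Red4 F) a - middles)
      + card (leaves_below X k1 a) + card (leaves_below X k2 a)"
    if K: "{c \<in> children Red F. a \<in> verts (tri c)} = {k1, k2, Red4 F}"
      and ne: "k1 \<noteq> k2" "k1 \<noteq> Red4 F" "k2 \<noteq> Red4 F" for k1 k2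
  proof -
    have kk: "k1 \<in> kids F" "k2 \<in> kids F" "Red4 F \<in> kids F" "a \<in> verts (tri k1)" "a \<in> verts (tri k2)"
    proof -
      have "k1 \<in> {c \<in> children Red F. a \<in> verts (tri c)}" "k2 \<in> {c \<in> children Red F. a \<in> verts (tri c)}"
        unfolding K by simp_all
      then show "k1 \<in> kids F" "k2 \<in> kids F" "Red4 F \<in> kids F" "a \<in> verts (tri k1)" "a \<in> verts (tri k2)"
        unfolding kids_def by simp_all
    qed
    have "k \<notin> middles" if "k \<in> kids F" "k \<noteq> Red4 F" for k
      using that by (auto simp: red_middle_def kids_eq)
    moreover have "e = k" if "e \<in> leaves_below X k a \<inter> middles" "a \<in> verts (tri k)" for e k
      using that middle_below[of e k a] by (simp add: leaves_below_def)
    ultimately have nm: "leaves_below X k1 a \<inter> middles = {}" "leaves_below X k2 a \<inter> middles = {}"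
      using kk ne by blast+
    have "leaves_below X F a - middles =
      (leaves_below X (Red4 F) a - middles) \<union> leaves_below X k1 a \<union> leaves_below X k2 a"
      unfolding Un K UN_insert UN_empty using nm by blast
    moreover have "leaves_below X k1 a \<inter> leaves_below X k2 a = {}"
      "leaves_below X (Red4 F) a \<inter> leaves_below X k1 a = {}"
      "leaves_below X (Red4 F) a \<inter> leaves_below X k2 a = {}"
      using leaves_below_disjoint[of _ F] kk(1-3) ne by simp_all
    ultimately show ?thesis
      unfolding side_count_def
      using card_three[OF finite_Diff[OF finite_leaves_below] finite_leaves_below finite_leaves_below]
      by (metis (no_types, lifting) Diff_Int_distrib2 empty_Diff)
  qed
  have "a \<in> mids F" using FX by simp
  then consider "a = midpoint v1 v2" | "a = midpoint v2 v3" | "a = midpoint v3 v1"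
    unfolding mids_def t by fastforce
  then show thesis
  proof cases
    case 1
    then have K: "{c \<in> children Red F. a \<in> verts (tri c)} = {Red1 F, Red2 F, Red4 F}"
      using t dist by auto
    show thesis
    proof (rule that[OF K])
      show "side_count F a = card (leaves_below X (Red4 F) a - middles)
        + card (leaves_below X (Red1 F) a) + card (leaves_below X (Red2 F) a)"
        by (rule main[OF K]) simp_all
      show "k = Red4 F" if "k \<in> children Red F" "a = apex (tri k)" "\<nexists>G. k = Red3 G" for k
        using that 1 t dist by auto
      show "a \<noteq> apex (tri k)" if "k \<in> {Red1 F, Red2 F, Red4 F}" "k \<noteq> Red4 F" for k
      proof -
        have "k = Red1 F \<or> k = Red2 F" using that by blast
        then show ?thesis using 1 t dist dist' by (elim disjE) simp_all
      qed
    qed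
  next
    case 2
    then have K: "{c \<in> children Red F. a \<in> verts (tri c)} = {Red2 F, Red3 F, Red4 F}"
      using t dist by auto
    show thesis
    proof (rule that[OF K])
      show "side_count F a = card (leaves_below X (Red4 F) a - middles)
        + card (leaves_below X (Red2 F) a) + card (leaves_below X (Red3 F) a)"
        by (rule main[OF K]) simp_all
      show "k = Red2 F" if "k \<in> children Red F" "a = apex (tri k)" "\<nexists>G. k = Red3 G" for k
        using that 2 t dist by auto
      show "a \<noteq> apex (tri k)" if "k \<in> {Red2 F, Red3 F, Red4 F}" "k \<noteq> Red2 F" for k
      proof -
        have "k = Red3 F \<or> k = Red4 F" using that by blast
        then show ?thesis using 2 t dist dist' by (elim disjE) simp_all
      qed
    qed
  next
    case 3
    then have K: "{c \<in> children Red F. a \<in> verts (tri c)} = {Red1 F, Red3 F, Red4 F}"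
      using t dist by auto
    show thesis
    proof (rule that[OF K])
      show "side_count F a = card (leaves_below X (Red4 F) a - middles)
        + card (leaves_below X (Red1 F) a) + card (leaves_below X (Red3 F) a)"
        by (rule main[OF K]) simp_all
      show "k = Red1 F" if "k \<in> children Red F" "a = apex (tri k)" "\<nexists>G. k = Red3 G" for k
        using that 3 t dist by auto
      show "a \<noteq> apex (tri k)" if "k \<in> {Red1 F, Red3 F, Red4 F}" "k \<noteq> Red1 F" for k
      proof -
        have "k = Red3 F \<or> k = Red4 F" using that by blast
        then show ?thesis using 3 t dist dist' by (elim disjE) simp_all
      qed
    qed
  qed
qed

lemma green_side_count:
  assumes F: "F \<in> splitters X a" and green: "Green1 F \<in> X"
  shows "side_count F a = card (leaves_below X (Green1 F) a) + card (leaves_below X (Green2 F) a)"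
    and "a = apex (tri (Green1 F))" "a = apex (tri (Green2 F))"
    and "a \<in> verts (tri (Green1 F))" "a \<in> verts (tri (Green2 F))"
    and "Green2 F \<in> X"
proof -
  have kX: "kids F \<inter> X = children Green F" and a: "a = mid12 (tri F)"
    using F green by (cases rule: splitter_cases; auto simp: kids_eq)+
  show ap: "a = apex (tri (Green1 F))" "a = apex (tri (Green2 F))"
    and v: "a \<in> verts (tri (Green1 F))" "a \<in> verts (tri (Green2 F))"
    by (cases "tri F"; simp add: a)+
  show "Green2 F \<in> X" using kX by auto
  have "{c \<in> kids F \<inter> X. a \<in> verts (tri c)} = {Green1 F, Green2 F}"
    unfolding kX using v by (auto simp del: tri.simps)
  then have Un: "leaves_below X F a = leaves_below X (Green1 F) a \<union> leaves_below X (Green2 F) a"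
    using leaves_below_inner[OF splittersD(1,3)[OF F]] F by simp
  have "e \<notin> middles" if "e \<in> leaves_below X F a" for e
  proof
    assume e: "e \<in> middles"
    have "Green1 F \<noteq> e" "Green2 F \<noteq> e" using e by (auto simp: red_middle_def)
    moreover have "e \<in> leaves_below X (Green1 F) a \<union> leaves_below X (Green2 F) a" using that Un by simp
    ultimately show False using middle_below[OF e _ v(1)] middle_below[OF e _ v(2)]
      unfolding leaves_below_def by blast
  qed
  then have "leaves_below X F a - middles = leaves_below X (Green1 F) a \<union> leaves_below X (Green2 F) a"
    using Un by blast
  moreover have "leaves_below X (Green1 F) a \<inter> leaves_below X (Green2 F) a = {}"
    by (rule leaves_below_disjoint[of _ F]) (simp_all add: kids_eq)
  ultimately show "side_count F a = card (leaves_below X (Green1 F) a) + card (leaves_below X (Green2 F) a)"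
    unfolding side_count_def by (simp add: card_Un_disjoint finite_leaves_below)
qed

lemma red4_middle:
  assumes "Red1 F \<in> X"
  shows "Red4 F \<in> middles \<longleftrightarrow> kids F \<inter> X \<subseteq> leaves X"
proof -
  have kX: "kids F \<inter> X = children Red F" using assms by (cases rule: kids_X_cases[of F]) blast+
  show ?thesis unfolding kX by (auto simp: red_middle_def)
qed

lemma red4_below:
  assumes F: "F \<in> splitters X a" and red: "Red1 F \<in> X" and a: "a \<in> verts (tri (Red4 F))"
  shows "card (leaves_below X (Red4 F) a - middles) =
    (if kids F \<inter> X \<subseteq> leaves X then 0 else card (leaves_below X (Red4 F) a))"
proof -
  have kX: "kids F \<inter> X = children Red F" using red by (cases rule: kids_X_cases[of F]) blast+
  show ?thesis
  proof (cases "kids F \<inter> X \<subseteq> leaves X")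
    case True
    then have "Red4 F \<in> leaves X" unfolding kX by simp
    then show ?thesis using True leaves_below_leaf[OF _ a] red4_middle[OF red] by simp
  next
    case False
    have "leaves_below X (Red4 F) a \<inter> middles = {}"
      using middle_below[OF _ _ a] False red4_middle[OF red] unfolding leaves_below_def by blast
    then have "leaves_below X (Red4 F) a - middles = leaves_below X (Red4 F) a" by blast
    then show ?thesis using False by simp
  qed
qed

text \<open>This explains why red middle elements are left out of the count. In an unrefined red
  pattern only the two outer children count; once any child is refined, \<open>Red4\<close> is no
  longer a red middle element, and its part contributes at least one more.\<close>

lemma side_count_2_iff_red:
  assumes F: "F \<in> splitters X a" and red: "Red1 F \<in> X"
  shows "2 \<le> side_count F a" "side_count F a = 2 \<longleftrightarrow> kids F \<inter> X \<subseteq> leaves X"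
proof -
  have kX: "kids F \<inter> X = children Red F" using red by (cases rule: kids_X_cases[of F]) blast+
  obtain k1 k2 l where k: "{k \<in> children Red F. a \<in> verts (tri k)} = {k1, k2, Red4 F}"
    and sc: "side_count F a = card (leaves_below X (Red4 F) a - middles)
      + card (leaves_below X k1 a) + card (leaves_below X k2 a)"
    by (rule red_side_count[OF F red])
  have ks: "k \<in> children Red F" "k \<in> X" "a \<in> verts (tri k)" if "k \<in> {k1, k2, Red4 F}" for k
  proof -
    have "k \<in> {k \<in> children Red F. a \<in> verts (tri k)}" using that unfolding k .
    then show "k \<in> children Red F" "k \<in> X" "a \<in> verts (tri k)" using kX by blast+
  qed
  have pos: "card (leaves_below X k a) \<in> {1, 2}" if "k \<in> {k1, k2, Red4 F}" for k
    using ks[OF that] leaves_below_card_pos by blast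
  have 4: "card (leaves_below X (Red4 F) a - middles) =
    (if kids F \<inter> X \<subseteq> leaves X then 0 else card (leaves_below X (Red4 F) a))"
    using red4_below[OF F red] ks by blast
  show "2 \<le> side_count F a" using sc pos[of k1] pos[of k2] by auto
  show "side_count F a = 2 \<longleftrightarrow> kids F \<inter> X \<subseteq> leaves X"
  proof (cases "kids F \<inter> X \<subseteq> leaves X")
    case True
    have "k \<in> leaves X" if "k \<in> {k1, k2}" for k using ks[of k] that True kX by blast
    then have "leaves_below X k1 a = {k1}" "leaves_below X k2 a = {k2}"
      using leaves_below_leaf ks by simp_all
    then show ?thesis using sc 4 True by simp
  next
    case False
    then show ?thesis using sc 4 pos[of k1] pos[of k2] pos[of "Red4 F"] by auto
  qed
qed

lemma side_count_ge_2: "F \<in> splitters X a \<Longrightarrow> 2 \<le> side_count F a"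
proof (cases rule: splitter_cases, assumption)
  assume F: "F \<in> splitters X a" and G: "Green1 F \<in> X"
  note g = green_side_count[OF F G]
  show ?thesis
    using g(1) leaves_below_card_pos[OF G g(4)] leaves_below_card_pos[OF g(6) g(5)] by auto
qed (use side_count_2_iff_red in blast)

lemma side_count_unrefined:
  assumes F: "F \<in> splitters X a" and lv: "kids F \<inter> X \<subseteq> leaves X"
  shows "side_count F a = 2"
  using F
proof (cases rule: splitter_cases)
  case red
  then show ?thesis using side_count_2_iff_red F lv by blast
next
  case green
  note g = green_side_count[OF F green(2)]
  have "Green1 F \<in> leaves X" "Green2 F \<in> leaves X" using lv green(1) by auto
  then show ?thesis using g leaves_below_leaf by simp
qed

text \<open>Needed for a node with a single splitter, as on the boundary, where a total of 4 would
  pass the test with refined children. In a red pattern the leaf \<open>e\<close> is the only child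
  with apex \<open>a\<close>, so at most three elements count; in a green one \<open>e\<close>
  contributes one and its sibling at most two.\<close>

lemma side_count_newest:
  assumes F: "F \<in> splitters X a" and e: "e \<in> leaves X" "e \<in> kids F" "newest_vertex a e"
  shows "side_count F a \<le> 3"
proof -
  have ea: "a = apex (tri e)" "\<nexists>G. e = Red3 G" using e(3) by (auto simp: newest_vertex_def)
  then have av: "a \<in> verts (tri e)" by (cases "tri e") simp
  have one: "card (leaves_below X e a) = 1" using leaves_below_leaf[OF e(1) av] by simp
  show ?thesis
    using F
  proof (cases rule: splitter_cases)
    case red
    obtain k1 k2 l where k: "{k \<in> children Red F. a \<in> verts (tri k)} = {k1, k2, Red4 F}"
      and l: "\<And>k. k \<in> children Red F \<Longrightarrow> a = apex (tri k) \<Longrightarrow> \<nexists>G. k = Red3 G \<Longrightarrow> k = l"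
      and nl: "\<And>k. k \<in> {k1, k2, Red4 F} \<Longrightarrow> k \<noteq> l \<Longrightarrow> a \<noteq> apex (tri k)"
      and sc: "side_count F a = card (leaves_below X (Red4 F) a - middles)
        + card (leaves_below X k1 a) + card (leaves_below X k2 a)"
      by (rule red_side_count[OF F red(2)]) (rule that; blast)
    have el: "e = l" using l ea e(1,2) red(1) leaves_X by blast
    have "card (leaves_below X k a) = 1" if kk: "k \<in> {k1, k2, Red4 F}" for k
    proof (cases "k = l")
      case False
      have "k \<in> {k \<in> children Red F. a \<in> verts (tri k)}" using kk unfolding k .
      then have "k \<in> X" "a \<in> verts (tri k)" using red(1) by blast+
      then show ?thesis using leaves_below_card_apex nl[OF kk False] by blast
    qed (use el one in simp)
    moreover have "card (leaves_below X (Red4 F) a - middles) \<le> card (leaves_below X (Red4 F) a)"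
      by (rule card_mono) (auto simp: finite_leaves_below)
    ultimately show ?thesis using sc by simp
  next
    case green
    note g = green_side_count[OF F green(2)]
    have "e = Green1 F \<or> e = Green2 F" using e(1,2) green(1) leaves_X by auto
    then show ?thesis
      using g(1) one leaves_below_card_pos[OF green(2) g(4)] leaves_below_card_pos[OF g(6) g(5)] by auto
  qed
qed

section \<open>All sides of a node together\<close>

lemma finite_splitters: "finite (splitters X a)"
  using finite_X by (simp add: splitters_def)

text \<open>Every element at a noninitial node lies below a splitter, and below only one because
  splitters are incomparable.\<close>

lemma card_elems_at:
  assumes "a \<notin> nodes T0"
  shows "card (elems_at (leaves X) a) = (\<Sum>F\<in>splitters X a. side_count F a)"
proof -
  have "elems_at (leaves X) a = (\<Union>F\<in>splitters X a. leaves_below X F a - middles)"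
  proof (intro set_eqI iffI)
    fix e assume "e \<in> elems_at (leaves X) a"
    then have e: "e \<in> leaves X" "e \<notin> middles" "a \<in> verts (tri e)" by (auto simp: elems_at_def)
    have "a \<notin> verts (root_of e)" using assms root_T0 leaves_X[OF e(1)] by (auto simp: nodes_def)
    then obtain F k where F: "F \<in> splitters X a" "k \<in> kids F" "k \<in> ancs e"
      using vertex_splitter leaves_X e by blast
    have "F \<in> ancs k" using F(2) by (simp add: ancs_kid ancs_refl)
    then have "F \<in> ancs e" using F(3) ancs_trans by blast
    then show "e \<in> (\<Union>F\<in>splitters X a. leaves_below X F a - middles)"
      using F e by (auto simp: leaves_below_def)
  qed (auto simp: elems_at_def leaves_below_def)
  moreover have "(leaves_below X F a - middles) \<inter> (leaves_below X F' a - middles) = {}"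
    if "F \<in> splitters X a" "F' \<in> splitters X a" "F \<noteq> F'" for F F'
    using splitter_unique that ancs_linear unfolding leaves_below_def by blast
  ultimately show ?thesis
    unfolding side_count_def
    using card_UN_disjoint[OF finite_splitters, of a "\<lambda>F. leaves_below X F a - middles"] finite_leaves_below
    by simp
qed

text \<open>Outside the case \<open>Red3\<close>, the apex of a child is an edge midpoint of its
  father. An earlier creation of \<open>a\<close> would make it a corner of the father
  instead.\<close>

lemma newest_vertex_splitter:
  assumes "e \<in> leaves X" "newest_vertex a e" "a \<notin> nodes T0"
  shows "\<exists>F. F \<in> splitters X a \<and> e \<in> kids F"
proof -
  have eX: "e \<in> X" using assms leaves_X by blast
  have ea: "a = apex (tri e)" "\<nexists>G. e = Red3 G" using assms(2) by (auto simp: newest_vertex_def)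
  then have av: "a \<in> verts (tri e)" by (cases "tri e") simp
  have "a \<notin> verts (root_of e)" using assms(3) root_T0 eX by (auto simp: nodes_def)
  then obtain F k where F: "F \<in> splitters X a" "k \<in> kids F" "k \<in> ancs e" "a \<in> verts (tri k)"
    using vertex_splitter eX av by blast
  have "k = e"
  proof (rule ccontr)
    assume "k \<noteq> e"
    obtain E where E: "e \<in> kids E"
    proof (cases rule: element_exhaust_kids[of e])
      case (1 t)
      then show thesis using F(3) \<open>k \<noteq> e\<close> by simp
    qed (use that in blast)
    have EX: "E \<in> X" using E eX parent_X by blast
    have kE: "k \<in> ancs E" using F(3) \<open>k \<noteq> e\<close> ancs_kid[OF E] by simp
    have m: "a \<in> mids E" using E ea by (cases rule: kids_cases; cases "tri E"; simp add: mids_def)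
    have "a \<in> verts (tri E)"
      using anc_corner[OF _ kE F(4)] ccw_T0[OF root_T0[OF EX]] mids_closed_tri[OF ccw_X[OF EX]] m by blast
    then show False using mids_not_verts[OF ccw_X[OF EX] m] by blast
  qed
  then show ?thesis using F by blast
qed

lemma splitter_edge:
  assumes "F \<in> splitters X a"
  obtains u v where "(u, v) \<in> oriented_edges (tri F)" "a = midpoint u v"
  using splittersD(2)[OF assms] that by (cases "tri F") (auto simp: mids_def)

text \<open>Three splitters would have edges with pairwise opposite directions.\<close>

lemma splitters_card_le_2: "card (splitters X a) \<le> 2"
proof (rule ccontr)
  assume "\<not> card (splitters X a) \<le> 2"
  then have "3 \<le> card (splitters X a)" by simp
  then obtain S where "S \<subseteq> splitters X a" "card S = 3"
    using obtain_subset_with_card_n by metis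
  then obtain F1 F2 F3 where F: "F1 \<in> splitters X a" "F2 \<in> splitters X a" "F3 \<in> splitters X a"
    and ne: "F1 \<noteq> F2" "F1 \<noteq> F3" "F2 \<noteq> F3"
    by (auto simp: card_3_iff)
  obtain u1 v1 where e1: "(u1, v1) \<in> oriented_edges (tri F1)" "a = midpoint u1 v1" using splitter_edge F by blast
  obtain u2 v2 where e2: "(u2, v2) \<in> oriented_edges (tri F2)" "a = midpoint u2 v2" using splitter_edge F by blast
  obtain u3 v3 where e3: "(u3, v3) \<in> oriented_edges (tri F3)" "a = midpoint u3 v3" using splitter_edge F by blast
  note ccw = ccw_X[OF splittersD(1)[OF F(1)]] ccw_X[OF splittersD(1)[OF F(2)]] ccw_X[OF splittersD(1)[OF F(3)]]
  obtain k where k: "0 < k" "v2 - u2 = - k *\<^sub>R (v1 - u1)"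
    using opposite_edges[OF ccw(1,2) splitters_disjoint[OF F(1,2) ne(1)] e1(1) e2(1)] e1(2) e2(2) by metis
  obtain k' where k': "0 < k'" "v3 - u3 = - k' *\<^sub>R (v1 - u1)"
    using opposite_edges[OF ccw(1,3) splitters_disjoint[OF F(1,3) ne(2)] e1(1) e3(1)] e1(2) e3(2) by metis
  obtain k'' where k'': "0 < k''" "v3 - u3 = - k'' *\<^sub>R (v2 - u2)"
    using opposite_edges[OF ccw(2,3) splitters_disjoint[OF F(2,3) ne(3)] e2(1) e3(1)] e2(2) e3(2) by metis
  have "(k' + k'' * k) *\<^sub>R (v1 - u1) = 0"
    using k'(2) unfolding k''(2) k(2) by (simp add: scaleR_add_left)
  moreover have "k' + k'' * k > 0" using k(1) k'(1) k''(1) by (simp add: add_pos_pos)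
  ultimately have "v1 - u1 = 0" by (metis less_irrefl scaleR_eq_0_iff)
  then show False using oriented_edges_distinct[OF ccw(1) e1(1)] by simp
qed

text \<open>A green refinement of \<open>k\<close> would put two leaves at the apex. A red one would
  create the midpoint of \<open>w\<close> and \<open>a\<close>, which hangs in the leaf
  \<open>t\<close> containing both.\<close>

lemma apex_unrefined:
  assumes nh: "no_hanging (tri ` leaves X)"
    and k: "k \<in> X" "a = apex (tri k)" "card (leaves_below X k a) = 1"
    and w: "w \<in> verts (tri k)" "w \<noteq> a"
    and t: "t \<in> leaves X" "w \<in> verts (tri t)" "a \<in> verts (tri t)"
  shows "k \<in> leaves X"
proof -
  obtain v1 v2 where tk: "tri k = (v1, v2, a)" using k(2) by (cases "tri k") auto
  show ?thesis
  proof (cases rule: kids_X_cases[of k])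
    case leaf
    then show ?thesis using k(1) by (simp add: leaves_def)
  next
    case red
    have inX: "Red1 k \<in> X" "Red2 k \<in> X" using red(1) by auto
    have "midpoint w a \<in> verts (tri (Red1 k)) \<or> midpoint w a \<in> verts (tri (Red2 k))"
      using w by (auto simp: tk midpoint_sym)
    then have "midpoint w a \<in> nodes (tri ` leaves X)" using vertex_is_node inX by blast
    moreover have ccw: "ccw (tri t)" using ccw_X leaves_X t(1) by blast
    moreover have "w \<in> closed_tri (tri t)" "a \<in> closed_tri (tri t)"
      using verts_subset_closed_tri[OF ccw] t by blast+
    ultimately show ?thesis
      using nh t(1) midpoint_closed_tri midpoint_not_vertex[OF ccw] w(2)
      unfolding no_hanging_def by blast
  next
    case green
    then show ?thesis using corner_count[OF k(1) tk] k(3) by simp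
  qed
qed

end

section \<open>Generations of nodes\<close>

text \<open>Each initial triangle is mapped to the right isosceles triangle with vertices 0, 2 and
  \<open>1 + \<i>\<close>. The nodes created in it are then Gaussian integers divided by powers of \<open>1 - \<i>\<close>, and the
  exponent is the generation of the node.\<close>

definition odd_gauss :: "complex \<Rightarrow> bool" where
  "odd_gauss z \<longleftrightarrow> (\<exists>m n :: int. z = Complex (of_int m) (of_int n) \<and> odd (m + n))"

definition even_gauss :: "complex \<Rightarrow> bool" where
  "even_gauss z \<longleftrightarrow> (\<exists>m n :: int. z = Complex (of_int m) (of_int n) \<and> even (m + n))"

abbreviation gauss_unit :: "complex \<Rightarrow> bool" where
  "gauss_unit z \<equiv> z \<in> {1, -1, \<i>, -\<i>}"

abbreviation cc :: complex where "cc \<equiv> 1 - \<i>"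

definition chart :: "ref_triangle \<Rightarrow> complex \<Rightarrow> point" where
  "chart t z = (case t of (v1, v2, v3) \<Rightarrow>
    v1 + (Re z / 2) *\<^sub>R (v2 - v1) + Im z *\<^sub>R (v3 - midpoint v1 v2))"

definition has_gen :: "ref_triangle \<Rightarrow> point \<Rightarrow> nat \<Rightarrow> bool" where
  "has_gen t p g \<longleftrightarrow> (\<exists>z. chart t z = p \<and> odd_gauss (z * cc ^ g))"

lemma odd_gaussI: "z = Complex (of_int m) (of_int n) \<Longrightarrow> odd (m + n) \<Longrightarrow> odd_gauss z"
  by (auto simp: odd_gauss_def)

lemma even_gaussI: "z = Complex (of_int m) (of_int n) \<Longrightarrow> even (m + n) \<Longrightarrow> even_gauss z"
  by (auto simp: even_gauss_def)

lemma even_not_odd_gauss: "even_gauss z \<Longrightarrow> \<not> odd_gauss z"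
  by (auto simp: even_gauss_def odd_gauss_def)

lemma even_gauss_add:
  assumes "even_gauss z" "even_gauss w"
  shows "even_gauss (z + w)"
proof -
  obtain m n m' n' where "z = Complex (of_int m) (of_int n)" "even (m + n)"
    "w = Complex (of_int m') (of_int n')" "even (m' + n')"
    using assms by (auto simp: even_gauss_def)
  then show ?thesis by (intro even_gaussI[of _ "m + m'" "n + n'"]) (auto simp: complex_eq_iff)
qed

lemma odd_gauss_add:
  assumes "odd_gauss z" "even_gauss w"
  shows "odd_gauss (z + w)"
proof -
  obtain m n m' n' where "z = Complex (of_int m) (of_int n)" "odd (m + n)"
    "w = Complex (of_int m') (of_int n')" "even (m' + n')"
    using assms by (auto simp: even_gauss_def odd_gauss_def)
  then show ?thesis by (intro odd_gaussI[of _ "m + m'" "n + n'"]) (auto simp: complex_eq_iff)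
qed

lemma even_gauss_minus: "even_gauss z \<Longrightarrow> even_gauss (- z)"
proof -
  assume "even_gauss z"
  then obtain m n where "z = Complex (of_int m) (of_int n)" "even (m + n)" by (auto simp: even_gauss_def)
  then show ?thesis by (intro even_gaussI[of _ "- m" "- n"]) (auto simp: complex_eq_iff)
qed

lemma odd_gauss_minus: "odd_gauss z \<Longrightarrow> odd_gauss (- z)"
proof -
  assume "odd_gauss z"
  then obtain m n where "z = Complex (of_int m) (of_int n)" "odd (m + n)" by (auto simp: odd_gauss_def)
  then show ?thesis by (intro odd_gaussI[of _ "- m" "- n"]) (auto simp: complex_eq_iff)
qed

lemma odd_gauss_i: "odd_gauss z \<Longrightarrow> odd_gauss (\<i> * z)"
proof -
  assume "odd_gauss z"
  then obtain m n where "z = Complex (of_int m) (of_int n)" "odd (m + n)" by (auto simp: odd_gauss_def)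
  then show ?thesis by (intro odd_gaussI[of _ "- n" m]) (auto simp: complex_eq_iff)
qed

lemma even_gauss_cc:
  assumes "even_gauss z \<or> odd_gauss z"
  shows "even_gauss (z * cc)"
proof -
  obtain m n where "z = Complex (of_int m) (of_int n)" using assms by (auto simp: even_gauss_def odd_gauss_def)
  then show ?thesis by (intro even_gaussI[of _ "m + n" "n - m"]) (auto simp: complex_eq_iff)
qed

lemma gauss_unit_odd: "gauss_unit z \<Longrightarrow> odd_gauss z"
proof -
  have "odd_gauss 1" by (rule odd_gaussI[of _ 1 0]) (auto simp: complex_eq_iff)
  moreover have "odd_gauss \<i>" by (rule odd_gaussI[of _ 0 1]) (auto simp: complex_eq_iff)
  ultimately show "odd_gauss z" if "gauss_unit z" using that odd_gauss_minus by blast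
qed

lemma even_gauss_two_powers: "even_gauss (2 * cc ^ g)"
proof (induction g)
  case 0
  show ?case by (rule even_gaussI[of _ 2 0]) (auto simp: complex_eq_iff)
next
  case (Suc g)
  then have "even_gauss (2 * cc ^ g * cc)" using even_gauss_cc by blast
  then show ?case by (simp add: mult_ac)
qed

text \<open>\<open>cc\<close> is the Gaussian prime above 2, and even means divisible by it: one
  further factor \<open>cc\<close> makes an odd number even, and it then stays even.\<close>

lemma odd_gauss_cc_unique:
  assumes "odd_gauss (z * cc ^ g)" "odd_gauss (z * cc ^ h)"
  shows "g = h"
proof -
  have "\<not> odd_gauss (z * cc ^ (g + Suc n))" if "odd_gauss (z * cc ^ g)" for g n
  proof -
    have "even_gauss (z * cc ^ (g + Suc n))"
    proof (induction n)
      case 0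
      have "even_gauss (z * cc ^ g * cc)" using that even_gauss_cc by blast
      then show ?case by (simp add: mult_ac)
    next
      case (Suc n)
      then have "even_gauss (z * cc ^ (g + Suc n) * cc)" using even_gauss_cc by blast
      then show ?case by (simp add: mult_ac)
    qed
    then show ?thesis using even_not_odd_gauss by blast
  qed
  then have "\<not> g < h" "\<not> h < g" using assms less_iff_Suc_add[of g h] less_iff_Suc_add[of h g] by auto
  then show ?thesis by simp
qed

section \<open>Charts of the initial triangles\<close>

lemma chart_diff: "chart t z - chart t w = chart t (z - w) - chart t 0"
  by (cases t) (simp add: chart_def algebra_simps diff_divide_distrib)

lemma chart_scale: "chart t (of_real r * z) - chart t 0 = r *\<^sub>R (chart t z - chart t 0)"
  by (cases t) (simp add: chart_def algebra_simps)

lemma chart_inj: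
  assumes "ccw t" "chart t z = chart t w"
  shows "z = w"
proof -
  obtain a b c where t: "t = (a, b, c)" by (cases t)
  have bary: "bary t (chart t z) = ((2 - Re z - Im z) / 2 * area2 a b c, (Re z - Im z) / 2 * area2 a b c, Im z * area2 a b c)" for z
    by (simp add: t chart_def area_simps midpoint_nth field_simps)
  have "area2 a b c \<noteq> 0" using assms(1) by (simp add: t ccw_iff_signed_area)
  then show ?thesis
    using bary[of z] bary[of w] assms(2) by (simp add: complex_eq_iff)
qed

lemma chart_midpoint: "midpoint (chart t z) (chart t w) = chart t ((z + w) / 2)"
  by (cases t) (simp add: chart_def vec2_eq_iff midpoint_nth field_simps)

lemma chart_vertices:
  "chart (v1, v2, v3) 0 = v1" "chart (v1, v2, v3) 2 = v2" "chart (v1, v2, v3) (1 + \<i>) = v3"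
  by (simp_all add: chart_def vec2_eq_iff midpoint_nth field_simps)

lemma has_gen_unique: "ccw t \<Longrightarrow> has_gen t p g \<Longrightarrow> has_gen t p h \<Longrightarrow> g = h"
  unfolding has_gen_def using chart_inj odd_gauss_cc_unique by blast

lemma cc_square: "cc * cc = - 2 * \<i>"
  by (simp add: complex_eq_iff)

lemma even_gauss_double:
  assumes "even_gauss z \<or> odd_gauss z"
  shows "even_gauss (2 * z)"
proof -
  obtain m n where "z = Complex (of_int m) (of_int n)" using assms by (auto simp: even_gauss_def odd_gauss_def)
  then show ?thesis by (intro even_gaussI[of _ "2 * m" "2 * n"]) (auto simp: complex_eq_iff)
qed

lemma even_gauss_i: "even_gauss z \<Longrightarrow> even_gauss (\<i> * z)"
proof -
  assume "even_gauss z"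
  then obtain m n where "z = Complex (of_int m) (of_int n)" "even (m + n)" by (auto simp: even_gauss_def)
  then show ?thesis by (intro even_gaussI[of _ "- n" m]) (auto simp: complex_eq_iff)
qed

text \<open>For the image of the model triangle under w |-> z + u w, which is
  \<open>local_tri\<close>: at level \<open>g\<close> the scale \<open>u\<close> is a unit over
  \<open>cc ^ g\<close>, and \<open>z\<close> lies in the even sublattice of that scale.\<close>

definition lattice_pos :: "nat \<Rightarrow> complex \<Rightarrow> complex \<Rightarrow> bool" where
  "lattice_pos g z u \<longleftrightarrow> even_gauss (z * cc ^ g) \<and> gauss_unit (u * cc ^ g)"

lemma lattice_pos_red:
  assumes "lattice_pos g z u"
  shows "lattice_pos (Suc (Suc g)) z (u / 2)"
    and "lattice_pos (Suc (Suc g)) (z + u) (u / 2)"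
    and "lattice_pos (Suc (Suc g)) (z + (1 + \<i>) * u / 2) (u / 2)"
    and "lattice_pos (Suc (Suc g)) (z + (3 + \<i>) * u / 2) (- u / 2)"
proof -
  define Z U where "Z = z * cc ^ g" and "U = u * cc ^ g"
  have Z: "even_gauss Z" and U: "gauss_unit U" using assms by (auto simp: lattice_pos_def Z_def U_def)
  \<comment> \<open>Since \<open>cc * cc\<close> is 2 up to a unit, halving raises the level by
    two.\<close>
  have p: "cc ^ Suc (Suc g) = - 2 * \<i> * cc ^ g" using cc_square by (simp add: mult.assoc[symmetric])
  have "gauss_unit (- \<i> * U)" "gauss_unit (\<i> * U)" using U by auto
  moreover have "u / 2 * cc ^ Suc (Suc g) = - \<i> * U" "- u / 2 * cc ^ Suc (Suc g) = \<i> * U"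
    by (simp_all only: p U_def) simp_all
  ultimately have u: "gauss_unit (u / 2 * cc ^ Suc (Suc g))" "gauss_unit (- u / 2 * cc ^ Suc (Suc g))" by metis+
  have Z2: "even_gauss (2 * - (\<i> * Z))" using even_gauss_double even_gauss_minus even_gauss_i Z by blast
  have iU: "odd_gauss (- (\<i> * U))" using odd_gauss_minus odd_gauss_i gauss_unit_odd[OF U] by blast
  then have U2: "even_gauss (2 * - (\<i> * U))" using even_gauss_double by blast
  have Uc: "even_gauss (U * cc)" using even_gauss_cc gauss_unit_odd[OF U] by blast
  have e: "z * cc ^ Suc (Suc g) = 2 * - (\<i> * Z)"
    "(z + u) * cc ^ Suc (Suc g) = 2 * - (\<i> * Z) + 2 * - (\<i> * U)"
    "(z + (1 + \<i>) * u / 2) * cc ^ Suc (Suc g) = 2 * - (\<i> * Z) + U * cc"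
    "(z + (3 + \<i>) * u / 2) * cc ^ Suc (Suc g) = 2 * - (\<i> * Z) + (U * cc + 2 * - (\<i> * U))"
    by (simp_all only: p U_def Z_def) (simp_all add: field_simps)
  show "lattice_pos (Suc (Suc g)) z (u / 2)" "lattice_pos (Suc (Suc g)) (z + u) (u / 2)"
    "lattice_pos (Suc (Suc g)) (z + (1 + \<i>) * u / 2) (u / 2)"
    "lattice_pos (Suc (Suc g)) (z + (3 + \<i>) * u / 2) (- u / 2)"
    unfolding lattice_pos_def e using u Z2 U2 Uc even_gauss_add by blast+
qed

lemma lattice_pos_green:
  assumes "lattice_pos g z u"
  shows "lattice_pos (Suc g) (z + (1 + \<i>) * u) (- (1 + \<i>) * u / 2)"
    and "lattice_pos (Suc g) (z + 2 * u) ((\<i> - 1) * u / 2)"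
proof -
  define Z U where "Z = z * cc ^ g" and "U = u * cc ^ g"
  have Z: "even_gauss Z" and U: "gauss_unit U" using assms by (auto simp: lattice_pos_def Z_def U_def)
  have "gauss_unit (- U)" "gauss_unit (\<i> * U)" using U by auto
  moreover have "- (1 + \<i>) * u / 2 * cc ^ Suc g = - U" "(\<i> - 1) * u / 2 * cc ^ Suc g = \<i> * U"
    by (simp_all add: U_def field_simps)
  ultimately have u: "gauss_unit (- (1 + \<i>) * u / 2 * cc ^ Suc g)" "gauss_unit ((\<i> - 1) * u / 2 * cc ^ Suc g)"
    by metis+
  have ev: "even_gauss (Z * cc)" "even_gauss (2 * U)" "even_gauss (2 * (U * cc))"
    using even_gauss_cc even_gauss_double Z gauss_unit_odd[OF U] by blast+
  have e: "(z + (1 + \<i>) * u) * cc ^ Suc g = Z * cc + 2 * U" "(z + 2 * u) * cc ^ Suc g = Z * cc + 2 * (U * cc)"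
    by (simp_all add: U_def Z_def field_simps)
  show "lattice_pos (Suc g) (z + (1 + \<i>) * u) (- (1 + \<i>) * u / 2)"
    "lattice_pos (Suc g) (z + 2 * u) ((\<i> - 1) * u / 2)"
    unfolding lattice_pos_def e using u ev even_gauss_add by blast+
qed

definition local_tri :: "ref_triangle \<Rightarrow> complex \<Rightarrow> complex \<Rightarrow> ref_triangle" where
  "local_tri t z u = (chart t z, chart t (z + 2 * u), chart t (z + (1 + \<i>) * u))"

lemma local_tri_kids:
  assumes "tri F = local_tri t z u"
  shows "tri (Red1 F) = local_tri t z (u / 2)"
    and "tri (Red2 F) = local_tri t (z + u) (u / 2)"
    and "tri (Red3 F) = local_tri t (z + (1 + \<i>) * u / 2) (u / 2)"
    and "tri (Red4 F) = local_tri t (z + (3 + \<i>) * u / 2) (- u / 2)"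
    and "tri (Green1 F) = local_tri t (z + (1 + \<i>) * u) (- (1 + \<i>) * u / 2)"
    and "tri (Green2 F) = local_tri t (z + 2 * u) ((\<i> - 1) * u / 2)"
  using assms
  by (cases t; simp add: local_tri_def chart_def vec2_eq_iff midpoint_nth field_simps)+

lemma chart_tri:
  obtains z u where "tri e = local_tri (root_of e) z u" "lattice_pos (gen e) z u"
proof -
  have "\<exists>z u. tri e = local_tri (root_of e) z u \<and> lattice_pos (gen e) z u"
  proof (induction e rule: element_kids_induct)
    case (Initial t)
    have "even_gauss 0" by (rule even_gaussI[of _ 0 0]) (auto simp: complex_eq_iff)
    then show ?case
      by (intro exI[of _ 0] exI[of _ 1]) (cases t, simp add: local_tri_def chart_vertices lattice_pos_def)
  next
    case (kid F c)
    then obtain z u where "tri F = local_tri (root_of F) z u" "lattice_pos (gen F) z u" by blast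
    note * = local_tri_kids[OF this(1)] lattice_pos_red[OF this(2)] lattice_pos_green[OF this(2)]
    from kid.hyps show ?case
      by (cases rule: kids_cases) (simp_all only: root_of.simps gen.simps, (use * in blast)+)
  qed
  then show thesis using that by blast
qed

text \<open>The midpoint of the reference edge sits at \<open>z + u\<close>, which is even plus odd
  after scaling. The other two midpoints are those of the reference edges of the green children,
  hence one generation later.\<close>

lemma mids_gen:
  "has_gen (root_of e) (mid12 (tri e)) (gen e)"
  "has_gen (root_of e) (mid23 (tri e)) (Suc (gen e))"
  "has_gen (root_of e) (mid31 (tri e)) (Suc (gen e))"
proof -
  obtain z u where t: "tri e = local_tri (root_of e) z u" and l: "lattice_pos (gen e) z u"
    using chart_tri by blast
  define Z U where "Z = z * cc ^ gen e" and "U = u * cc ^ gen e"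
  have Z: "even_gauss Z" and U: "odd_gauss U" using l gauss_unit_odd by (auto simp: lattice_pos_def Z_def U_def)
  have "odd_gauss (U + Z)" "odd_gauss (U + (Z * cc + U * cc))" "odd_gauss (\<i> * U + (Z * cc + U * cc))"
    using odd_gauss_add even_gauss_add even_gauss_cc odd_gauss_i Z U by blast+
  moreover have "odd_gauss (U + Z * cc)"
    using odd_gauss_add even_gauss_cc Z U by blast
  moreover have "(z + u) * cc ^ gen e = U + Z"
    "(z + (3 + \<i>) * u / 2) * cc ^ Suc (gen e) = \<i> * U + (Z * cc + U * cc) + U * (1 - \<i>)"
    "(z + (1 + \<i>) * u / 2) * cc ^ Suc (gen e) = U + Z * cc"
    by (simp_all add: Z_def U_def field_simps)
  moreover have "odd_gauss (\<i> * U + (Z * cc + U * cc) + U * (1 - \<i>))"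
    using odd_gauss_add even_gauss_cc U calculation(3) by blast
  ultimately have o: "odd_gauss ((z + u) * cc ^ gen e)"
    "odd_gauss ((z + (3 + \<i>) * u / 2) * cc ^ Suc (gen e))"
    "odd_gauss ((z + (1 + \<i>) * u / 2) * cc ^ Suc (gen e))" by metis+
  have m: "mid12 (tri e) = chart (root_of e) (z + u)"
    "mid23 (tri e) = chart (root_of e) (z + (3 + \<i>) * u / 2)"
    "mid31 (tri e) = chart (root_of e) (z + (1 + \<i>) * u / 2)"
    unfolding t local_tri_def mid12.simps mid23.simps mid31.simps chart_midpoint
    by (rule arg_cong[where f = "chart (root_of e)"], simp add: field_simps)+
  show "has_gen (root_of e) (mid12 (tri e)) (gen e)"
    "has_gen (root_of e) (mid23 (tri e)) (Suc (gen e))"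
    "has_gen (root_of e) (mid31 (tri e)) (Suc (gen e))"
    unfolding has_gen_def m using o by blast+
qed

text \<open>In the chart, an edge whose midpoint has generation \<open>g\<close> has length 2
  divided by \<open>cmod cc ^ g\<close>; the midpoint alone determines the length.\<close>

lemma oriented_edge_gen:
  assumes "(a, b) \<in> oriented_edges (tri e)"
  obtains h g where "has_gen (root_of e) (midpoint a b) g"
    "b - a = chart (root_of e) h - chart (root_of e) 0" "cmod (h * cc ^ g) = 2"
proof -
  let ?t = "root_of e"
  obtain z u where t: "tri e = local_tri ?t z u" and l: "lattice_pos (gen e) z u"
    using chart_tri by blast
  define U where "U = u * cc ^ gen e"
  have U: "cmod U = 1" using l by (auto simp: lattice_pos_def U_def)
  have eqs: "2 * u * cc ^ gen e = 2 * U" "((\<i> - 1) * u) * cc ^ Suc (gen e) = 2 * (\<i> * U)"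
    "(- (1 + \<i>) * u) * cc ^ Suc (gen e) = - 2 * U"
    by (simp_all add: U_def field_simps)
  have n: "cmod (2 * u * cc ^ gen e) = 2" "cmod (((\<i> - 1) * u) * cc ^ Suc (gen e)) = 2"
    "cmod ((- (1 + \<i>) * u) * cc ^ Suc (gen e)) = 2"
    unfolding eqs using U by (simp_all add: norm_mult)
  obtain v1 v2 v3 where v: "tri e = (v1, v2, v3)" by (cases "tri e")
  have vs: "v1 = chart ?t z" "v2 = chart ?t (z + 2 * u)" "v3 = chart ?t (z + (1 + \<i>) * u)"
    using t v by (simp_all add: local_tri_def)
  have d: "v2 - v1 = chart ?t (2 * u) - chart ?t 0" "v3 - v2 = chart ?t ((\<i> - 1) * u) - chart ?t 0"
    "v1 - v3 = chart ?t (- (1 + \<i>) * u) - chart ?t 0"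
    unfolding vs chart_diff[of ?t "z + 2 * u"] chart_diff[of ?t "z + (1 + \<i>) * u"] chart_diff[of ?t z]
    by (rule arg_cong[where f = "\<lambda>w. chart ?t w - chart ?t 0"], simp add: algebra_simps)+
  have m: "midpoint v1 v2 = mid12 (tri e)" "midpoint v2 v3 = mid23 (tri e)" "midpoint v3 v1 = mid31 (tri e)"
    by (simp_all add: v)
  consider "(a, b) = (v1, v2)" | "(a, b) = (v2, v3)" | "(a, b) = (v3, v1)" using assms by (auto simp: v)
  then show thesis
  proof cases
    case 1
    then show thesis using that[OF _ _ n(1)] d(1) mids_gen(1)[of e] m by simp
  next
    case 2
    then show thesis using that[OF _ _ n(2)] d(2) mids_gen(2)[of e] m by simp
  next
    case 3
    then show thesis using that[OF _ _ n(3)] d(3) mids_gen(3)[of e] m by simp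
  qed
qed

text \<open>The generation of a point that divides an edge in the ratio \<open>\<tau> : 1 - \<tau>\<close>, provided that the
  edge is the reference edge; for the two other edges it is larger by one.\<close>

definition edge_gen :: "real \<Rightarrow> nat \<Rightarrow> bool" where
  "edge_gen \<tau> g \<longleftrightarrow> odd_gauss (of_real (2 * \<tau>) * cc ^ g)"

lemma edge_gen_unique: "edge_gen \<tau> g \<Longrightarrow> edge_gen \<tau> h \<Longrightarrow> g = h"
  unfolding edge_gen_def by (rule odd_gauss_cc_unique)

lemma edge_gen_reverse: "edge_gen (1 - \<tau>) g \<longleftrightarrow> edge_gen \<tau> g"
proof -
  have "edge_gen (1 - \<tau>) g" if "edge_gen \<tau> g" for \<tau>
  proof -
    have "odd_gauss (- (of_real (2 * \<tau>) * cc ^ g) + 2 * cc ^ g)"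
      using that odd_gauss_add odd_gauss_minus even_gauss_two_powers unfolding edge_gen_def by blast
    then show ?thesis by (simp add: edge_gen_def algebra_simps)
  qed
  from this[of \<tau>] this[of "1 - \<tau>"] show ?thesis by auto
qed

lemma chart_affine:
  "(1 - r) *\<^sub>R chart t z + r *\<^sub>R chart t w = chart t (of_real (1 - r) * z + of_real r * w)"
  by (cases t) (simp add: chart_def vec2_eq_iff midpoint_nth field_simps)

lemma diagonal_not_odd: "\<not> odd_gauss (Complex x x)"
  by (auto simp: odd_gauss_def)

lemma norm_cc_square: "cmod cc * cmod cc = 2"
  by (simp add: norm_mult[symmetric] cc_square)

text \<open>Parametrised by \<tau>, the reference edge is the real segment from 0 to 2. On the other
  two edges a Gaussian integer has even coordinate sum, so generation 0 cannot occur, and splitting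
  off one factor \<open>cc\<close> reduces to the reference edge up to a unit and an even summand.
  Their chart length \<open>cmod cc\<close> makes the length formula uniform.\<close>

lemma has_gen_on_edge:
  assumes "ccw t" "(u, v) \<in> oriented_edges t" "p = (1 - \<tau>) *\<^sub>R u + \<tau> *\<^sub>R v" "has_gen t p g"
  obtains \<gamma> D where "edge_gen \<tau> \<gamma>" "v - u = chart t D - chart t 0" "cmod D * cmod cc ^ g = 2 * cmod cc ^ \<gamma>"
    "g = (if closed_segment u v = ref_edge t then \<gamma> else Suc \<gamma>)"
proof -
  obtain v1 v2 v3 where t: "t = (v1, v2, v3)" by (cases t)
  have dist: "v1 \<noteq> v2" "v2 \<noteq> v3" "v1 \<noteq> v3" using ccw_distinct assms(1) t by auto
  note vs = chart_vertices[of v1 v2 v3, folded t]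
  obtain z where z: "chart t z = p" "odd_gauss (z * cc ^ g)" using assms(4) by (auto simp: has_gen_def)
  have z_eq: "z = of_real (1 - \<tau>) * w + of_real \<tau> * w'" if "u = chart t w" "v = chart t w'" for w w'
    using chart_inj[OF assms(1)] z(1) assms(3) chart_affine[of \<tau> t w w'] that by metis
  note goal = that
  have nonref: thesis
    if ne: "closed_segment u v \<noteq> ref_edge t" and D: "v - u = chart t D - chart t 0" "cmod D = cmod cc"
      and diag: "g = 0 \<Longrightarrow> False" and ed: "\<And>g'. g = Suc g' \<Longrightarrow> edge_gen \<tau> g'" for D
  proof -
    obtain g' where g': "g = Suc g'" using diag by (cases g) auto
    have "cmod D * cmod cc ^ g = 2 * cmod cc ^ g'"
      unfolding g' D(2) power_Suc mult.assoc[symmetric] norm_cc_square ..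
    then show thesis using goal[OF ed[OF g'] D(1)] ne g' by simp
  qed
  consider (ref) "u = v1" "v = v2" | (23) "u = v2" "v = v3" | (31) "u = v3" "v = v1"
    using assms(2) by (auto simp: t)
  then show thesis
  proof cases
    case ref
    have "z = 2 * of_real \<tau>" using z_eq[of 0 2] ref vs by simp
    then have "edge_gen \<tau> g" using z(2) by (simp add: edge_gen_def)
    moreover have "v - u = chart t 2 - chart t 0" using ref vs by simp
    ultimately show thesis using that[of g 2] ref by (simp add: t)
  next
    case 23
    have zz: "z = of_real (1 - \<tau>) * 2 + of_real \<tau> * (1 + \<i>)" by (rule z_eq) (use 23 vs in auto)
    show thesis
    proof (rule nonref)
      show "closed_segment u v \<noteq> ref_edge t" using 23 dist by (auto simp: t closed_segment_eq doubleton_eq_iff)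
      have "v - u = chart t (1 + \<i>) - chart t 2" using 23 vs by simp
      then show "v - u = chart t (\<i> - 1) - chart t 0" unfolding chart_diff[of t "1 + \<i>"] by simp
      show "cmod (\<i> - 1) = cmod cc" by (rule norm_minus_commute)
      show False if "g = 0"
      proof -
        have "odd_gauss z" using z(2) that by simp
        then obtain m n where mn: "z = Complex (of_int m) (of_int n)" "odd (m + n)" by (auto simp: odd_gauss_def)
        have "of_int m = 2 - \<tau>" "of_int n = \<tau>" using zz mn(1) by (auto simp: complex_eq_iff)
        then have "(of_int (m + n) :: real) = of_int 2" by simp
        then have "m + n = 2" using of_int_eq_iff by blast
        then show False using mn(2) by simp
      qed
      show "edge_gen \<tau> g'" if g': "g = Suc g'" for g'
      proof -
        have "z * cc ^ g = 2 * cc ^ g' * cc + \<i> * (of_real (2 * \<tau>) * cc ^ g')"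
          unfolding zz g' by (simp add: algebra_simps)
        then have "odd_gauss (2 * cc ^ g' * cc + \<i> * (of_real (2 * \<tau>) * cc ^ g') + - (2 * cc ^ g' * cc))"
          using z(2) odd_gauss_add even_gauss_minus even_gauss_cc even_gauss_two_powers by metis
        then have "odd_gauss (\<i> * (of_real (2 * \<tau>) * cc ^ g'))" by simp
        then have "odd_gauss (- (\<i> * (\<i> * (of_real (2 * \<tau>) * cc ^ g'))))"
          using odd_gauss_i odd_gauss_minus by blast
        then show ?thesis by (simp add: edge_gen_def mult.assoc[symmetric])
      qed
    qed
  next
    case 31
    have zz: "z = of_real (1 - \<tau>) * (1 + \<i>)" using z_eq[of "1 + \<i>" 0] 31 vs by simp
    show thesis
    proof (rule nonref)
      show "closed_segment u v \<noteq> ref_edge t" using 31 dist by (auto simp: t closed_segment_eq doubleton_eq_iff)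
      have "v - u = chart t 0 - chart t (1 + \<i>)" using 31 vs by simp
      then show "v - u = chart t (- (1 + \<i>)) - chart t 0" unfolding chart_diff[of t 0 "1 + \<i>"] by simp
      show "cmod (- (1 + \<i>)) = cmod cc" by (simp add: cmod_def)
      show False if "g = 0"
      proof -
        have "z = Complex (1 - \<tau>) (1 - \<tau>)" unfolding zz by (simp add: complex_eq_iff)
        then show False using z(2) that diagonal_not_odd by simp
      qed
      show "edge_gen \<tau> g'" if g': "g = Suc g'" for g'
      proof -
        have "z * cc ^ g = of_real (2 * (1 - \<tau>)) * cc ^ g'" unfolding zz g' by (simp add: algebra_simps)
        then have "edge_gen (1 - \<tau>) g'" using z(2) by (simp add: edge_gen_def)
        then show ?thesis by (simp add: edge_gen_reverse)
      qed
    qed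
  qed
qed

text \<open>Both end points lie on the inner side of the line through \<open>u\<close> and
  \<open>v\<close> and their midpoint lies on it, so the edge is parallel to the initial edge. Its
  relative length depends on \<tau> only, which permits a comparison between two initial triangles
  with different charts.\<close>

lemma boundary_edge:
  assumes "ccw (root_of e)" "(a, b) \<in> oriented_edges (tri e)" "(u, v) \<in> oriented_edges (root_of e)"
    and p: "midpoint a b = (1 - \<tau>) *\<^sub>R u + \<tau> *\<^sub>R v"
  obtains \<rho> \<gamma> where "edge_gen \<tau> \<gamma>" "b - a = \<rho> *\<^sub>R (v - u)" "\<bar>\<rho>\<bar> * cmod cc ^ \<gamma> = 1"
proof -
  let ?t = "root_of e"
  obtain h g where g: "has_gen ?t (midpoint a b) g" and h: "b - a = chart ?t h - chart ?t 0" "cmod (h * cc ^ g) = 2"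
    using oriented_edge_gen[OF assms(2)] by blast
  obtain \<gamma> D where D: "edge_gen \<tau> \<gamma>" "v - u = chart ?t D - chart ?t 0" "cmod D * cmod cc ^ g = 2 * cmod cc ^ \<gamma>"
    using has_gen_on_edge[OF assms(1,3) p g] by metis
  obtain w where w: "closed_tri ?t = closed_tri (u, v, w)" using oriented_edges_rotate[OF assms(3,1)] by metis
  have "a \<in> closed_tri ?t" "b \<in> closed_tri ?t"
    using oriented_edges_verts[OF assms(2)] verts_subset_closed_tri[OF ccw_root[OF assms(1)]]
      anc_closed_tri[OF Initial_root_ancs[of e]] by auto
  then have nn: "0 \<le> area2 u v a" "0 \<le> area2 u v b" unfolding w by (simp_all add: closed_tri_def)
  have "area2 u v (midpoint a b) = 0" unfolding p by (simp add: area_simps algebra_simps)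
  moreover have "area2 u v (midpoint a b) = (area2 u v a + area2 u v b) / 2"
    by (simp add: area_simps midpoint_nth field_simps)
  ultimately have "area2 u v a = 0" "area2 u v b = 0" using nn by auto
  then have "cross2 (v - u) (b - a) = 0" by (simp add: area_simps algebra_simps)
  note par = parallel_scale[OF this]
  define n where "n = (v - u) $ 1 * (v - u) $ 1 + (v - u) $ 2 * (v - u) $ 2"
  have "v \<noteq> u" using oriented_edges_distinct assms(1,3) by blast
  then have "n \<noteq> 0" unfolding n_def by (metis sum_squares_eq_zero_iff vec2_eq_iff eq_iff_diff_eq_0 zero_index)
  define \<rho> where "\<rho> = ((v - u) $ 1 * (b - a) $ 1 + (v - u) $ 2 * (b - a) $ 2) / n"
  have "n *\<^sub>R (b - a) = n *\<^sub>R (\<rho> *\<^sub>R (v - u))"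
    using par \<open>n \<noteq> 0\<close> unfolding n_def[symmetric] by (simp add: \<rho>_def)
  then have \<rho>: "b - a = \<rho> *\<^sub>R (v - u)" using \<open>n \<noteq> 0\<close> by (metis scaleR_cancel_left)
  then have "chart ?t h - chart ?t 0 = chart ?t (of_real \<rho> * D) - chart ?t 0"
    unfolding chart_scale h(1) D(2) .
  then have "chart ?t h = chart ?t (of_real \<rho> * D)" by simp
  then have "h = of_real \<rho> * D" using chart_inj assms(1) by blast
  then have "\<bar>\<rho>\<bar> * (cmod D * cmod cc ^ g) = 2" using h(2) by (simp add: norm_mult norm_power)
  then have "\<bar>\<rho>\<bar> * cmod cc ^ \<gamma> = 1" unfolding D(3) by simp
  then show thesis using that D(1) \<rho> by blast
qed

section \<open>Heights across initial edges\<close>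

context initial_triangulation
begin

text \<open>The two generations can differ only if the common edge is the reference edge of exactly
  one of the two triangles; that one has the smaller generation and is isolated.\<close>

lemma neighbour_gen:
  assumes "s \<in> T0" "t \<in> T0" "s \<noteq> t" "p \<in> closed_tri s" "p \<in> closed_tri t" "p \<notin> verts t"
    and "has_gen t p g" "has_gen s p g'"
  shows "edges s \<inter> edges t \<noteq> {} \<and>
    (g' = g \<or> g' = Suc g \<and> isolated T0 t \<or> g = Suc g' \<and> isolated T0 s)"
proof -
  obtain E where E: "E \<in> edges s" "E \<in> edges t" "p \<in> E" using common_edge assms by blast
  obtain u v where uv: "(u, v) \<in> oriented_edges t" "E = closed_segment u v" using E(2) edge_oriented by auto
  obtain u' v' where uv': "(u', v') \<in> oriented_edges s" "E = closed_segment u' v'" using E(1) edge_oriented by auto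
  obtain \<tau> where \<tau>: "p = (1 - \<tau>) *\<^sub>R u + \<tau> *\<^sub>R v" using E(3) uv(2) by (auto simp: in_segment)
  obtain \<gamma> where \<gamma>: "edge_gen \<tau> \<gamma>" "g = (if E = ref_edge t then \<gamma> else Suc \<gamma>)"
    using has_gen_on_edge[OF ccw_T0[OF assms(2)] uv(1) \<tau> assms(7)] uv(2) by metis
  have "{u, v} = {u', v'}" using uv(2) uv'(2) closed_segment_eq by metis
  then consider "u' = u" "v' = v" | "u' = v" "v' = u" by (auto simp: doubleton_eq_iff)
  then obtain \<gamma>' where \<gamma>': "edge_gen \<tau> \<gamma>'" "g' = (if E = ref_edge s then \<gamma>' else Suc \<gamma>')"
  proof cases
    case 1
    then show thesis using has_gen_on_edge[OF ccw_T0[OF assms(1)] uv'(1), of p \<tau> g'] \<tau> assms(8) uv'(2) that by metis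
  next
    case 2
    have "p = (1 - (1 - \<tau>)) *\<^sub>R u' + (1 - \<tau>) *\<^sub>R v'" using \<tau> 2 by simp
    then show thesis
      using has_gen_on_edge[OF ccw_T0[OF assms(1)] uv'(1) _ assms(8)] uv'(2) that edge_gen_reverse by metis
  qed
  have "\<gamma>' = \<gamma>" using edge_gen_unique \<gamma>(1) \<gamma>'(1) by blast
  then show ?thesis
    using \<gamma>(2) \<gamma>'(2) E assms(1-3) unfolding isolated_def by (auto split: if_splits)
qed

text \<open>The sum of the generations of a node in the two initial triangles that contain it; a node in a
  single initial triangle is counted twice.\<close>

definition height :: "point \<Rightarrow> nat" where
  "height p = Max {g. \<exists>t\<in>T0. p \<in> closed_tri t \<and> has_gen t p g} +
    Min {g. \<exists>t\<in>T0. p \<in> closed_tri t \<and> has_gen t p g}"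

text \<open>The height of \<open>p\<close> is at most 2g, or 2g + 1 if \<open>t\<close> is isolated.
  That of \<open>q\<close> is at least 2h, or 2h - 1 if a triangle sharing an edge with
  \<open>t\<close> is isolated. As \<open>g < h\<close>, only both exceptions together could produce
  a tie, and they contradict \<open>weak_BDD\<close>.\<close>

lemma height_mono:
  assumes bdd: "weak_BDD T0" and t: "t \<in> T0"
    and p: "p \<in> closed_tri t" "p \<notin> verts t" "has_gen t p g"
    and q: "q \<in> closed_tri t" "q \<notin> verts t" "has_gen t q h"
    and less: "g < h"
  shows "height p < height q"
proof -
  define G where "G x = {g. \<exists>t\<in>T0. x \<in> closed_tri t \<and> has_gen t x g}" for x
  have fin: "finite (G x)" for x
  proof -
    have "finite {g. has_gen s x g}" if "s \<in> T0" for s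
    proof (cases "\<exists>g. has_gen s x g")
      case True
      then obtain g where "has_gen s x g" by blast
      then have "{g. has_gen s x g} \<subseteq> {g}" using has_gen_unique[OF ccw_T0[OF that]] by blast
      then show ?thesis using finite_subset by blast
    qed simp
    then have "finite (\<Union>s\<in>T0. {g. has_gen s x g})" using finite_T0 by blast
    moreover have "G x \<subseteq> (\<Union>s\<in>T0. {g. has_gen s x g})" by (auto simp: G_def)
    ultimately show ?thesis using finite_subset by blast
  qed
  have gG: "g \<in> G p" "h \<in> G q" using t p q by (auto simp: G_def)
  have "Max (G p) \<in> G p" "Min (G q) \<in> G q" using Max_in Min_in fin gG by blast+
  then obtain s s' where s: "s \<in> T0" "p \<in> closed_tri s" "has_gen s p (Max (G p))"
    and s': "s' \<in> T0" "q \<in> closed_tri s'" "has_gen s' q (Min (G q))"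
    unfolding G_def by blast
  have mp: "Min (G p) \<le> g" "h \<le> Max (G q)" using gG fin by auto
  have P: "Max (G p) \<le> g \<or> Max (G p) = Suc g \<and> isolated T0 t"
  proof (cases "s = t")
    case True
    then show ?thesis using has_gen_unique[OF ccw_T0[OF t] p(3)] s(3) by auto
  next
    case False
    then show ?thesis using neighbour_gen[OF s(1) t False s(2) p(1,2,3) s(3)] by auto
  qed
  have Q: "h \<le> Min (G q) \<or> h = Suc (Min (G q)) \<and> isolated T0 s' \<and> s' \<noteq> t \<and> edges s' \<inter> edges t \<noteq> {}"
  proof (cases "s' = t")
    case True
    then show ?thesis using has_gen_unique[OF ccw_T0[OF t] q(3)] s'(3) by auto
  next
    case False
    then show ?thesis using neighbour_gen[OF s'(1) t False s'(2) q(1,2,3) s'(3)] by auto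
  qed
  have "\<not> (isolated T0 t \<and> isolated T0 s' \<and> s' \<noteq> t \<and> edges s' \<inter> edges t \<noteq> {})"
    using bdd unfolding weak_BDD_def by blast
  then have "Max (G p) + Min (G p) < Max (G q) + Min (G q)" using P Q mp less by linarith
  then show ?thesis by (simp add: height_def G_def)
qed

end

context forest
begin

text \<open>After \<open>opposite_edges\<close> only equality of lengths is left. Within one initial
  triangle the generation of \<open>p\<close> fixes both lengths in the same chart; otherwise
  \<open>p\<close> lies on a common initial edge, and its parameter \<tau> fixes both lengths
  relative to that edge.\<close>

lemma opposite_splitter_edges:
  assumes F: "F \<in> splitters X p" "F' \<in> splitters X p" "F \<noteq> F'"
    and ab: "(a, b) \<in> oriented_edges (tri F)" "p = midpoint a b"
    and ab': "(a', b') \<in> oriented_edges (tri F')" "p = midpoint a' b'"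
  shows "a' = b \<and> b' = a"
proof -
  note FX = splittersD[OF F(1)] and FX' = splittersD[OF F(2)]
  have ccw: "ccw (tri F)" "ccw (tri F')" using ccw_X FX(1) FX'(1) by blast+
  have t: "root_of F \<in> T0" "root_of F' \<in> T0" using root_T0 FX(1) FX'(1) by blast+
  note ccwr = ccw_T0[OF t(1)] ccw_T0[OF t(2)]
  obtain k where k: "0 < k" "b' - a' = - k *\<^sub>R (b - a)"
    using opposite_edges[OF ccw splitters_disjoint[OF F] ab(1) ab'(1)] ab(2) ab'(2) by metis
  have ba: "b - a \<noteq> 0" using oriented_edges_distinct[OF ccw(1) ab(1)] by simp
  have pt: "p \<in> closed_tri (root_of F)" "p \<in> closed_tri (root_of F')"
    using anc_closed_tri[OF Initial_root_ancs[of F]] anc_closed_tri[OF Initial_root_ancs[of F']] FX(5) FX'(5) by auto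
  have "k = 1"
  proof (cases "root_of F = root_of F'")
    case True
    let ?t = "root_of F"
    obtain h g where h: "has_gen ?t p g" "b - a = chart ?t h - chart ?t 0" "cmod (h * cc ^ g) = 2"
      using oriented_edge_gen[OF ab(1)] ab(2) by metis
    obtain h' g' where h': "has_gen ?t p g'" "b' - a' = chart ?t h' - chart ?t 0" "cmod (h' * cc ^ g') = 2"
      using oriented_edge_gen[OF ab'(1)] ab'(2) True by metis
    have "g' = g" using has_gen_unique[OF ccwr(1)] h(1) h'(1) by blast
    have "chart ?t h' - chart ?t 0 = chart ?t (of_real (- k) * h) - chart ?t 0"
      unfolding chart_scale h(2)[symmetric] h'(2)[symmetric] by (rule k(2))
    then have "chart ?t h' = chart ?t (of_real (- k) * h)" by simp
    then have "h' = of_real (- k) * h" using chart_inj[OF ccwr(1)] by blast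
    then have "k * cmod (h * cc ^ g) = cmod (h' * cc ^ g')" using k(1) \<open>g' = g\<close> by (simp add: norm_mult)
    then show ?thesis using h(3) h'(3) by simp
  next
    case False
    let ?t = "root_of F" and ?s = "root_of F'"
    have "p \<notin> verts ?t" using splitter_not_node0[OF F(1)] t by (auto simp: nodes_def)
    then obtain E where E: "E \<in> edges ?s" "E \<in> edges ?t" "p \<in> E"
      using common_edge[OF t(2,1) False[symmetric] pt(2,1)] by blast
    obtain u v where uv: "(u, v) \<in> oriented_edges ?t" "E = closed_segment u v" using E(2) edge_oriented by auto
    obtain u' v' where uv': "(u', v') \<in> oriented_edges ?s" "E = closed_segment u' v'" using E(1) edge_oriented by auto
    obtain \<tau> where \<tau>: "p = (1 - \<tau>) *\<^sub>R u + \<tau> *\<^sub>R v" using E(3) uv(2) by (auto simp: in_segment)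
    obtain \<rho> \<gamma> where \<rho>: "edge_gen \<tau> \<gamma>" "b - a = \<rho> *\<^sub>R (v - u)" "\<bar>\<rho>\<bar> * cmod cc ^ \<gamma> = 1"
      using boundary_edge[OF ccwr(1) ab(1) uv(1)] \<tau> ab(2) by metis
    have "{u, v} = {u', v'}" using uv(2) uv'(2) closed_segment_eq by metis
    then consider "u' = u" "v' = v" | "u' = v" "v' = u" by (auto simp: doubleton_eq_iff)
    then obtain \<rho>' \<gamma>' where \<rho>': "edge_gen \<tau> \<gamma>'" "b' - a' = \<rho>' *\<^sub>R (v - u)" "\<bar>\<rho>'\<bar> * cmod cc ^ \<gamma>' = 1"
    proof cases
      case 1
      then show thesis using boundary_edge[OF ccwr(2) ab'(1) uv'(1), of \<tau>] \<tau> ab'(2) that by metis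
    next
      case 2
      have "p = (1 - (1 - \<tau>)) *\<^sub>R u' + (1 - \<tau>) *\<^sub>R v'" using \<tau> 2 by simp
      then obtain \<rho>' \<gamma>' where "edge_gen (1 - \<tau>) \<gamma>'" "b' - a' = \<rho>' *\<^sub>R (v' - u')" "\<bar>\<rho>'\<bar> * cmod cc ^ \<gamma>' = 1"
        using boundary_edge[OF ccwr(2) ab'(1) uv'(1)] ab'(2) by metis
      then show thesis using that[of \<gamma>' "- \<rho>'"] 2 by (simp add: edge_gen_reverse algebra_simps)
    qed
    have "\<gamma>' = \<gamma>" using edge_gen_unique \<rho>(1) \<rho>'(1) by blast
    then have abs: "\<bar>\<rho>'\<bar> = \<bar>\<rho>\<bar>" using \<rho>(3) \<rho>'(3)
      by (metis mult_cancel_right mult_zero_right zero_neq_one)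
    have "\<rho>' *\<^sub>R (v - u) = (- k * \<rho>) *\<^sub>R (v - u)" using k(2) \<rho>(2) \<rho>'(2) by simp
    moreover have "v - u \<noteq> 0" using ba \<rho>(2) by auto
    ultimately have "\<rho>' = - k * \<rho>" using scaleR_cancel_right by blast
    then have "k * \<bar>\<rho>\<bar> = \<bar>\<rho>\<bar>" using abs k(1) by (simp add: abs_mult)
    moreover have "\<rho> \<noteq> 0" using ba \<rho>(2) by auto
    ultimately show ?thesis by simp
  qed
  then have d: "b' - a' = a - b" using k(2) by simp
  have "a' + b' = a + b" using ab(2) ab'(2) by (simp add: midpoint_def)
  then have "2 *\<^sub>R b' = 2 *\<^sub>R a" "2 *\<^sub>R a' = 2 *\<^sub>R b" using d unfolding vec2_eq_iff by auto
  then show ?thesis by simp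
qed

end

section \<open>Refining and collapsing forests\<close>

lemma initial_forest: "initial_triangulation T0 \<Longrightarrow> forest T0 (Initial ` T0) \<and> leaves (Initial ` T0) = Initial ` T0"
  unfolding forest_def forest_axioms_def leaves_def
  using Initial_not_kid by (auto simp: initial_triangulation.finite_T0)

context forest
begin

lemma refine_simple:
  assumes q: "\<And>e. q e \<in> {Unrefined, Red, Green}"
  shows "\<exists>X'. forest T0 X' \<and> leaves X' = (\<Union>e\<in>leaves X. children (q e) e)"
proof -
  define K where "K e = (if q e = Unrefined then {} else children (q e) e)" for e
  define X' where "X' = X \<union> (\<Union>e\<in>leaves X. K e)"
  have K_kids: "K e \<subseteq> kids e" for e using q[of e] by (auto simp: K_def kids_def)
  have K_nX: "K e \<inter> X = {}" if "e \<in> leaves X" for e using that K_kids by (auto simp: leaves_def)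
  have K_parent: "f = e" if "c \<in> kids e" "c \<in> K f" for c e f
    using kids_unique K_kids that by blast
  have kids': "kids e \<inter> X' = (if e \<in> leaves X then K e else kids e \<inter> X)" for e
  proof (cases "e \<in> leaves X")
    case True
    then have "kids e \<inter> X = {}" by (simp add: leaves_def)
    then show ?thesis using True K_kids[of e] K_parent[of _ e] unfolding X'_def by auto
  next
    case False
    then show ?thesis using K_parent[of _ e] unfolding X'_def by auto
  qed
  have "finite (K e)" for e using q[of e] by (auto simp: K_def)
  then have fin: "finite X'" using finite_X finite_subset[of "leaves X" X] by (auto simp: X'_def leaves_def)
  have "forest T0 X'"
  proof (intro forest.intro forest_axioms.intro)
    show "initial_triangulation T0" by (rule initial_triangulation_axioms)
    show "finite X'" by (rule fin)
    show "Initial t \<in> X' \<longleftrightarrow> t \<in> T0" for t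
      using Initial_X Initial_not_kid K_kids unfolding X'_def by blast
    show "F \<in> X'" if "c \<in> kids F" "c \<in> X'" for c F
    proof -
      from that(2) consider "c \<in> X" | f where "f \<in> leaves X" "c \<in> K f" by (auto simp: X'_def)
      then have "F \<in> X"
        by cases (use parent_X K_parent leaves_X that(1) in blast)+
      then show ?thesis by (simp add: X'_def)
    qed
    show "kids F \<inter> X' = {} \<or> kids F \<inter> X' = children Red F \<or> kids F \<inter> X' = children Green F" for F
    proof -
      have "K F = {} \<or> K F = children Red F \<or> K F = children Green F"
        using q[of F] unfolding K_def by (cases "q F") simp_all
      then show ?thesis using kids_X[of F] unfolding kids' by presburger
    qed
  qed
  moreover have "leaves X' = (\<Union>e\<in>leaves X. children (q e) e)"
  proof (intro set_eqI iffI)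
    fix e assume "e \<in> leaves X'"
    then have e: "e \<in> X'" "kids e \<inter> X' = {}" by (auto simp: leaves_def)
    show "e \<in> (\<Union>e\<in>leaves X. children (q e) e)"
    proof (cases "e \<in> leaves X")
      case True
      then have "K e = {}" using e(2) kids' by simp
      then have "q e = Unrefined" using q[of e] by (auto simp: K_def split: if_splits)
      then have "e \<in> children (q e) e" by simp
      then show ?thesis using True by blast
    next
      case False
      then have "kids e \<inter> X = {}" using e(2) kids' by simp
      then have "e \<notin> X" using False by (simp add: leaves_def)
      then obtain f where "f \<in> leaves X" "e \<in> K f" using e(1) by (auto simp: X'_def)
      then show ?thesis by (auto simp: K_def split: if_splits)
    qed
  next
    fix e assume "e \<in> (\<Union>e\<in>leaves X. children (q e) e)"
    then obtain f where f: "f \<in> leaves X" "e \<in> children (q f) f" by blast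
    show "e \<in> leaves X'"
    proof (cases "q f = Unrefined")
      case True
      then have "e = f" "K f = {}" using f(2) by (auto simp: K_def)
      then have "kids e \<inter> X' = {}" using f(1) unfolding kids' by simp
      moreover have "e \<in> X'" using \<open>e = f\<close> leaves_X[OF f(1)] by (simp add: X'_def)
      ultimately show ?thesis by (simp add: leaves_def)
    next
      case False
      then have eK: "e \<in> K f" using f(2) by (simp add: K_def)
      have "e \<notin> X" using K_nX[OF f(1)] eK by blast
      then have "e \<notin> leaves X" "kids e \<inter> X = {}" using leaves_X parent_X by blast+
      then have "kids e \<inter> X' = {}" using kids' by simp
      then show ?thesis using f(1) eK by (auto simp: leaves_def X'_def)
    qed
  qed
  ultimately show ?thesis by blast
qed

lemma refine: "\<exists>X'. forest T0 X' \<and> leaves X' = (\<Union>e\<in>leaves X. children (p e) e)"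
proof -
  define q where "q e = (if p e \<in> {Blue_r, Blue_l} then Green else p e)" for e
  have "q e \<in> {Unrefined, Red, Green}" for e by (cases "p e") (auto simp: q_def)
  then obtain Y where Y: "forest T0 Y" "leaves Y = (\<Union>e\<in>leaves X. children (q e) e)"
    using refine_simple by blast
  interpret Y: forest T0 Y by (rule Y(1))
  \<comment> \<open>The second round, in which each blue pattern bisects one of the green children
    created by \<open>q\<close>.\<close>
  define q' where "q' k = (if \<exists>F \<in> leaves X. k = Green1 F \<and> p F = Blue_l \<or> k = Green2 F \<and> p F = Blue_r
    then Green else Unrefined)" for k
  have "q' k \<in> {Unrefined, Red, Green}" for k by (simp add: q'_def)
  then obtain Z where Z: "forest T0 Z" "leaves Z = (\<Union>e\<in>leaves Y. children (q' e) e)"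
    using Y.refine_simple by blast
  have "(\<Union>k\<in>children (q e) e. children (q' k) k) = children (p e) e" if e: "e \<in> leaves X" for e
  proof -
    have "q' e = Unrefined"
      using inner_X[of e] e leaves_X by (auto simp: q'_def kids_eq)
    moreover have "q' (Red1 e) = Unrefined" "q' (Red2 e) = Unrefined" "q' (Red3 e) = Unrefined" "q' (Red4 e) = Unrefined"
      "q' (Green1 e) = (if p e = Blue_l then Green else Unrefined)"
      "q' (Green2 e) = (if p e = Blue_r then Green else Unrefined)"
      using e by (auto simp: q'_def)
    ultimately show ?thesis by (cases "p e") (auto simp: q_def)
  qed
  then have "leaves Z = (\<Union>e\<in>leaves X. children (p e) e)" unfolding Z(2) Y(2) by auto
  then show ?thesis using Z(1) by blast
qed

lemma collapse:
  assumes S: "\<And>F. F \<in> S \<Longrightarrow> kids F \<inter> X \<noteq> {} \<and> kids F \<inter> X \<subseteq> leaves X"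
  shows "\<exists>X'. forest T0 X' \<and> leaves X' = (leaves X - (\<Union>F\<in>S. kids F)) \<union> S"
proof -
  define X' where "X' = X - (\<Union>F\<in>S. kids F)"
  have SX: "F \<in> X'" if F: "F \<in> S" for F
  proof -
    obtain c where c: "c \<in> kids F" "c \<in> X" using S[OF F] by blast
    have "F \<in> X" "F \<notin> leaves X" using c parent_X inner_X by blast+
    then show ?thesis using S by (auto simp: X'_def)
  qed
  have kids': "kids F \<inter> X' = (if F \<in> S then {} else kids F \<inter> X)" for F
    using kids_unique by (auto simp: X'_def)
  have "forest T0 X'"
  proof (intro forest.intro forest_axioms.intro)
    show "initial_triangulation T0" by (rule initial_triangulation_axioms)
    show "finite X'" using finite_X by (simp add: X'_def)
    show "Initial t \<in> X' \<longleftrightarrow> t \<in> T0" for t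
      using Initial_X Initial_not_kid by (auto simp: X'_def)
    show "F \<in> X'" if "c \<in> kids F" "c \<in> X'" for c F
    proof -
      have "c \<in> X" using that by (simp add: X'_def)
      then have "F \<in> X" "F \<notin> leaves X" using that parent_X inner_X by blast+
      then show ?thesis using S by (auto simp: X'_def)
    qed
    show "kids F \<inter> X' = {} \<or> kids F \<inter> X' = children Red F \<or> kids F \<inter> X' = children Green F" for F
      using kids_X[of F] unfolding kids' by simp
  qed
  moreover have "leaves X' = (leaves X - (\<Union>F\<in>S. kids F)) \<union> S"
    unfolding leaves_def kids' using SX by (auto simp: X'_def)
  ultimately show ?thesis by blast
qed

section \<open>Admissible nodes\<close>

lemma half_edge_leaf:
  assumes F: "F \<in> splitters X a" and lv: "kids F \<inter> X \<subseteq> leaves X"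
    and uv: "(u, v) \<in> oriented_edges (tri F)" "a = midpoint u v" and w: "w \<in> {u, v}"
  shows "\<exists>t\<in>leaves X. w \<in> verts (tri t) \<and> a \<in> verts (tri t)"
proof -
  obtain v1 v2 v3 where t: "tri F = (v1, v2, v3)" by (cases "tri F")
  have "ccw (v1, v2, v3)" using ccw_X[OF splittersD(1)[OF F]] t by metis
  from six_points_distinct[OF this] have dist: "distinct [v1, v2, v3, midpoint v1 v2, midpoint v2 v3, midpoint v3 v1]" .
  have uv': "(u, v) = (v1, v2) \<or> (u, v) = (v2, v3) \<or> (u, v) = (v3, v1)" using uv(1) by (simp add: t)
  from F show ?thesis
  proof (cases rule: splitter_cases)
    case red
    have "Red1 F \<in> leaves X" "Red2 F \<in> leaves X" "Red3 F \<in> leaves X" using lv red(1) by auto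
    moreover have "w \<in> verts (tri (Red1 F)) \<and> a \<in> verts (tri (Red1 F)) \<or> w \<in> verts (tri (Red2 F)) \<and> a \<in> verts (tri (Red2 F))
      \<or> w \<in> verts (tri (Red3 F)) \<and> a \<in> verts (tri (Red3 F))"
      using uv' uv(2) w by (elim disjE) (auto simp: t)
    ultimately show ?thesis by blast
  next
    case green
    have "Green1 F \<in> leaves X" "Green2 F \<in> leaves X" using lv green(1) by auto
    moreover have "(u, v) = (v1, v2)" using uv' uv(2) green(3) dist by (auto simp: t)
    then have "w \<in> verts (tri (Green1 F)) \<and> a \<in> verts (tri (Green1 F)) \<or> w \<in> verts (tri (Green2 F)) \<and> a \<in> verts (tri (Green2 F))"
      using uv(2) w by (auto simp: t)
    ultimately show ?thesis by blast
  qed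
qed

text \<open>The numerical test is turned into structure: each side contributes exactly two elements.
  For red this means unrefined. For green each child still has one leaf at its apex, and
  \<open>apex_unrefined\<close> applies once an edge of that child ending at \<open>a\<close> is
  known to lie in a leaf.\<close>

lemma pre_adm_pattern:
  assumes nh: "no_hanging (tri ` leaves X)" and a: "a \<in> pre_adm (nodes T0) (leaves X) mark"
    and F: "F \<in> splitters X a"
  shows "kids F \<inter> X \<subseteq> leaves X"
proof -
  have a0: "a \<notin> nodes T0" and cd: "card (elems_at (leaves X) a) \<in> {2, 4}"
    and "\<exists>e\<in>leaves X. newest_vertex a e"
    using a by (auto simp: pre_adm_def new_nodes_def)
  then obtain e where e: "e \<in> leaves X" "newest_vertex a e" by blast
  obtain F1 where F1: "F1 \<in> splitters X a" "e \<in> kids F1" using newest_vertex_splitter e a0 by blast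
  \<comment> \<open>With several splitters the lower bound 2 for each exhausts the total of 4; with
    a single one, \<open>side_count_newest\<close> excludes 4.\<close>
  have two: "side_count G a = 2" if G: "G \<in> splitters X a" for G
  proof (cases "G = F1")
    case False
    have "sum (\<lambda>F. side_count F a) {G, F1} \<le> (\<Sum>F\<in>splitters X a. side_count F a)"
      using finite_splitters G F1 by (intro sum_mono2) auto
    then have "side_count G a + side_count F1 a \<le> 4" using False card_elems_at[OF a0] cd by auto
    then show ?thesis using side_count_ge_2[OF G] side_count_ge_2[OF F1(1)] by simp
  next
    case True
    show ?thesis
    proof (cases "splitters X a = {F1}")
      case 1: True
      then have "side_count F1 a \<in> {2, 4}" using card_elems_at[OF a0] cd by simp
      then show ?thesis using side_count_newest[OF F1(1) e(1) F1(2) e(2)] True by auto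
    next
      case 2: False
      then obtain F2 where F2: "F2 \<in> splitters X a" "F2 \<noteq> F1" using F1(1) by blast
      have "sum (\<lambda>F. side_count F a) {F1, F2} \<le> (\<Sum>F\<in>splitters X a. side_count F a)"
        using finite_splitters F1(1) F2 by (intro sum_mono2) auto
      then have "side_count F1 a + side_count F2 a \<le> 4" using F2(2) card_elems_at[OF a0] cd by auto
      then show ?thesis using side_count_ge_2[OF F2(1)] side_count_ge_2[OF F1(1)] True by simp
    qed
  qed
  have red_ok: "kids G \<inter> X \<subseteq> leaves X" if "G \<in> splitters X a" "Red1 G \<in> X" for G
    using side_count_2_iff_red two that by blast
  have ones: "card (leaves_below X (Green1 G) a) = 1" "card (leaves_below X (Green2 G) a) = 1"
    if G: "G \<in> splitters X a" "Green1 G \<in> X" for G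
    using two[OF G(1)] green_side_count[OF G] leaves_below_card_pos[OF G(2) green_side_count(4)[OF G]]
      leaves_below_card_pos[OF green_side_count(6,5)[OF G]] by auto
  have lv1: "kids F1 \<inter> X \<subseteq> leaves X"
    using F1(1)
  proof (cases rule: splitter_cases)
    case red
    then show ?thesis using red_ok[OF F1(1)] by blast
  next
    case green
    note g = green_side_count[OF F1(1) green(2)]
    obtain v1 v2 v3 where t: "tri F1 = (v1, v2, v3)" by (cases "tri F1")
    have "ccw (v1, v2, v3)" using ccw_X[OF splittersD(1)[OF F1(1)]] t by metis
    from six_points_distinct[OF this] have dist: "v3 \<noteq> midpoint v1 v2" by simp
    have v3: "v3 \<in> verts (tri (Green1 F1))" "v3 \<in> verts (tri (Green2 F1))" "v3 \<noteq> a"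
      using dist green(3) by (simp_all add: t)
    \<comment> \<open>One green child is the leaf \<open>e\<close>; it contains the edge from
      \<open>v3\<close> to \<open>a\<close> that both children share.\<close>
    have "e = Green1 F1 \<or> e = Green2 F1" using F1(2) e(1) leaves_X green(1) by auto
    then have "Green1 F1 \<in> leaves X \<and> Green2 F1 \<in> leaves X"
      using e(1) apex_unrefined[OF nh green(2) g(2) ones(1)[OF F1(1) green(2)] v3(1,3) _ v3(2) g(5)]
        apex_unrefined[OF nh g(6) g(3) ones(2)[OF F1(1) green(2)] v3(2,3) _ v3(1) g(4)] by blast
    then show ?thesis unfolding green(1) by simp
  qed
  show ?thesis
    using F
  proof (cases rule: splitter_cases)
    case red
    then show ?thesis using red_ok[OF F] by blast
  next
    case green
    show ?thesis
    proof (cases "F = F1")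
      case False
      note g = green_side_count[OF F green(2)]
      obtain u1 u2 u3 where t: "tri F = (u1, u2, u3)" by (cases "tri F")
      have "ccw (u1, u2, u3)" using ccw_X[OF splittersD(1)[OF F]] t by metis
      from six_points_distinct[OF this] have dist: "u1 \<noteq> midpoint u1 u2" "u2 \<noteq> midpoint u1 u2" by simp_all
      have u: "u1 \<in> verts (tri (Green1 F))" "u2 \<in> verts (tri (Green2 F))" "u1 \<noteq> a" "u2 \<noteq> a"
        using dist green(3) by (simp_all add: t)
      obtain b c where bc: "(b, c) \<in> oriented_edges (tri F1)" "a = midpoint b c" using splitter_edge F1(1) by blast
      have uu: "(u1, u2) \<in> oriented_edges (tri F)" "a = midpoint u1 u2" using t green(3) by auto
      \<comment> \<open>Both sides refine the same edge, and its two halves lie in leaves on the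
        side of \<open>F1\<close>; hence they cannot be refined on the side of \<open>F\<close>
        either.\<close>
      have "u1 = c \<and> u2 = b" using opposite_splitter_edges[OF F1(1) F] False bc uu by blast
      then obtain t1 t2 where t1: "t1 \<in> leaves X" "u1 \<in> verts (tri t1)" "a \<in> verts (tri t1)"
        and t2: "t2 \<in> leaves X" "u2 \<in> verts (tri t2)" "a \<in> verts (tri t2)"
        using half_edge_leaf[OF F1(1) lv1 bc, of b] half_edge_leaf[OF F1(1) lv1 bc, of c] by auto
      have "Green1 F \<in> leaves X" "Green2 F \<in> leaves X"
        using apex_unrefined[OF nh green(2) g(2) ones(1)[OF F green(2)] u(1,3) t1]
          apex_unrefined[OF nh g(6) g(3) ones(2)[OF F green(2)] u(2,4) t2] by blast+
      then show ?thesis unfolding green(1) by simp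
    qed (use lv1 in simp)
  qed
qed

end

text \<open>The loop adds nodes from a finite set, so it ends at a fixed point. All that it adds are
  apexes of red middle elements, so any other node is decided by the initial set.\<close>

lemma blocked_properties:
  fixes N0 T mark
  defines "B0 \<equiv> nodes (tri ` T) - pre_adm N0 T mark"
  assumes "finite T"
  shows "B0 \<subseteq> blocked N0 T mark" "block_step T (blocked N0 T mark) = blocked N0 T mark"
    and "\<And>p. p \<notin> B0 \<Longrightarrow> (\<And>e. e \<in> red_middle T \<Longrightarrow> apex (tri e) \<noteq> p) \<Longrightarrow> p \<notin> blocked N0 T mark"
proof -
  let ?N = "nodes (tri ` T)"
  let ?P = "\<lambda>B. B0 \<subseteq> B \<and> B \<subseteq> ?N \<and> (\<forall>p. p \<notin> B0 \<longrightarrow> (\<forall>e\<in>red_middle T. apex (tri e) \<noteq> p) \<longrightarrow> p \<notin> B)"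
  have "verts t = {a, b, c}" if "t = (a, b, c)" for t a b c using that by simp
  then have "finite (verts t)" for t by (cases t) simp
  then have fin: "finite ?N" using assms by (simp add: nodes_def)
  have ap: "apex (tri e) \<in> ?N" if "e \<in> red_middle T" for e
  proof -
    have "apex (tri e) \<in> verts (tri e)" by (cases "tri e") simp
    then show ?thesis using that by (auto simp: nodes_def red_middle_def)
  qed
  have step: "?P (block_step T B)" if "?P B" for B
    using that ap unfolding block_step_def by blast
  have sub: "B \<subseteq> block_step T B" for B by (auto simp: block_step_def)
  have "?P (blocked N0 T mark) \<and> block_step T (blocked N0 T mark) = blocked N0 T mark"
    unfolding blocked_def
  proof (rule while_rule[where P = ?P and r = "Wellfounded.measure (\<lambda>B. card (?N - B))"])
    show "?P (nodes (tri ` T) - pre_adm N0 T mark)" by (auto simp: B0_def)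
    show "?P (block_step T B)" if "?P B" for B by (rule step[OF that])
    show "?P B \<and> block_step T B = B" if "?P B" "\<not> block_step T B \<noteq> B" for B using that by blast
    show "wf (Wellfounded.measure (\<lambda>B. card (?N - B)))" by simp
    show "(block_step T B, B) \<in> Wellfounded.measure (\<lambda>B. card (?N - B))" if B: "?P B" "block_step T B \<noteq> B" for B
    proof -
      have "?N - block_step T B \<subset> ?N - B" using sub[of B] B(2) step[OF B(1)] by blast
      then show ?thesis using fin by (simp add: psubset_card_mono)
    qed
  qed
  then show "B0 \<subseteq> blocked N0 T mark" "block_step T (blocked N0 T mark) = blocked N0 T mark"
    "\<And>p. p \<notin> B0 \<Longrightarrow> (\<And>e. e \<in> red_middle T \<Longrightarrow> apex (tri e) \<noteq> p) \<Longrightarrow> p \<notin> blocked N0 T mark"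
    by blast+
qed

section \<open>One coarsening step\<close>

fun kept :: "pattern \<Rightarrow> element \<Rightarrow> point set" where
  "kept Unrefined F = {}"
| "kept Red F = mids F"
| "kept Green F = {mid12 (tri F)}"
| "kept Blue_r F = {mid12 (tri F), mid23 (tri F)}"
| "kept Blue_l F = {mid12 (tri F), mid31 (tri F)}"

lemma children_verts: "t \<in> children p F \<Longrightarrow> verts (tri t) \<subseteq> verts (tri F) \<union> kept p F"
  by (cases p; cases "tri F") (auto simp: mids_def midpoint_sym)

lemma children_anc: "t \<in> children p F \<Longrightarrow> F \<in> ancs t \<and> root_of t = root_of F"
  using ancs_refl by (cases p) auto

text \<open>A blue pattern is checked as two green ones. The only danger is its second midpoint
  touching the green child left whole, which \<open>green_mids_not_in\<close> rules out.\<close>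

lemma kept_corner:
  assumes ccw: "ccw (tri F)" and t: "t \<in> children p F" and x: "x \<in> verts (tri F) \<union> kept p F" "x \<in> closed_tri (tri t)"
  shows "x \<in> verts (tri t)"
proof -
  have green: "y \<in> verts (tri c)" if "ccw (tri G)" "c \<in> children Green G" "y \<in> verts (tri G) \<or> y = mid12 (tri G)" "y \<in> closed_tri (tri c)" for c G y
    using kid_corner green_mid_corner that children_subset_kids(2) by blast
  have k: "Green1 F \<in> kids F" "Green2 F \<in> kids F" by (simp_all add: kids_eq)
  have blue: "x \<in> verts (tri t)"
    if G: "G \<in> children Green F" "t \<in> children Green G" and xG: "x \<in> verts (tri F) \<or> x = mid12 (tri F) \<or> x = mid12 (tri G)" for G
  proof -
    have GF: "G \<in> kids F" "t \<in> kids G" using G children_subset_kids(2) by blast+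
    have "x \<in> closed_tri (tri G)" using x(2) kid_closed_tri[OF GF(2)] by blast
    then have "x \<in> verts (tri G) \<or> x = mid12 (tri G)" using xG green[OF ccw G(1)] by blast
    then show ?thesis using green[OF ccw_kid[OF ccw GF(1)] G(2)] x(2) by blast
  qed
  have m: "mid12 (tri (Green1 F)) = mid31 (tri F)" "mid12 (tri (Green2 F)) = mid23 (tri F)"
    by (cases "tri F"; simp)+
  show ?thesis
  proof (cases p)
    case Unrefined
    then show ?thesis using t x by simp
  next
    case Red
    then have "t \<in> children Red F" "x \<in> verts (tri F) \<or> x \<in> mids F" using t x(1) by auto
    then show ?thesis using x(2) red_mids_corner[OF ccw] kid_corner[OF ccw] children_subset_kids(1) by blast
  next
    case Green
    then show ?thesis using t x green[OF ccw] by auto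
  next
    case Blue_r
    then consider "t = Green1 F" | "t \<in> children Green (Green2 F)" using t by auto
    then show ?thesis
    proof cases
      case 1
      have "x \<noteq> mid23 (tri F)" using x(2) green_mids_not_in(2)[OF ccw] 1 by metis
      then have "x \<in> verts (tri F) \<or> x = mid12 (tri F)" using x(1) Blue_r by auto
      moreover have "t \<in> children Green F" using 1 by simp
      ultimately show ?thesis using green[OF ccw] x(2) by blast
    next
      case 2
      then show ?thesis using blue[of "Green2 F"] x(1) Blue_r m by auto
    qed
  next
    case Blue_l
    then consider "t = Green2 F" | "t \<in> children Green (Green1 F)" using t by auto
    then show ?thesis
    proof cases
      case 1
      have "x \<noteq> mid31 (tri F)" using x(2) green_mids_not_in(1)[OF ccw] 1 by metis
      then have "x \<in> verts (tri F) \<or> x = mid12 (tri F)" using x(1) Blue_l by auto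
      moreover have "t \<in> children Green F" using 1 by simp
      ultimately show ?thesis using green[OF ccw] x(2) by blast
    next
      case 2
      then show ?thesis using blue[of "Green1 F"] x(1) Blue_l m by auto
    qed
  qed
qed

locale coarsening = forest +
  fixes mark :: "point set"
  assumes nh: "no_hanging (tri ` leaves X)"
begin

definition "blk = blocked (nodes T0) (leaves X) mark"
definition "adm = admissible (nodes T0) (leaves X) mark"
definition "hang = hanging (nodes T0) (leaves X) mark"
definition "reds = {F. Red4 F \<in> middles}"
definition "greens = {F. children Green F \<subseteq> leaves X}"

text \<open>The case distinctions of coarsening read as a choice of pattern for the father, so that
  a step becomes \<open>collapse\<close> followed by \<open>refine\<close>.\<close>

definition pat :: "element \<Rightarrow> pattern" where
  "pat F = (let m12 = mid12 (tri F); m23 = mid23 (tri F); m31 = mid31 (tri F) in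
    if F \<in> reds then
      if m12 \<in> adm \<and> m23 \<in> adm \<and> m31 \<in> adm then Unrefined
      else if m12 \<in> hang \<and> m23 \<in> adm \<and> m31 \<in> adm then Green
      else if m12 \<in> hang \<and> m31 \<in> hang \<and> m23 \<in> adm then Blue_l
      else if m12 \<in> hang \<and> m23 \<in> hang \<and> m31 \<in> adm then Blue_r
      else Red
    else if F \<in> greens then if m12 \<in> adm then Unrefined else Green
    else Unrefined)"

lemma finite_leaves: "finite (leaves X)"
  using finite_X finite_subset[of "leaves X" X] by (auto simp: leaves_def)

lemmas blk_properties =
  blocked_properties[where ?N0.0 = "nodes T0" and mark = mark, OF finite_leaves, folded blk_def]

lemma adm_iff: "a \<in> adm \<longleftrightarrow> a \<in> pre_adm (nodes T0) (leaves X) mark \<and> a \<notin> blk"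
  by (auto simp: adm_def admissible_def hanging_def blk_def pre_adm_def)

lemma hang_iff: "a \<in> hang \<longleftrightarrow> a \<in> blk \<and> a \<in> new_nodes (nodes T0) (leaves X)"
  by (auto simp: hang_def hanging_def blk_def)

lemma adm_or_hang: "a \<in> new_nodes (nodes T0) (leaves X) \<Longrightarrow> a \<in> adm \<or> a \<in> hang"
  using blk_properties(1) by (auto simp: adm_iff hang_iff new_nodes_def)

lemma adm_not_hang: "a \<in> adm \<Longrightarrow> a \<notin> hang"
  by (auto simp: adm_iff hang_iff)

lemma adm_not_node0: "a \<in> adm \<Longrightarrow> a \<notin> nodes T0"
  by (auto simp: adm_iff pre_adm_def new_nodes_def)

lemma new_nodeI:
  assumes "e \<in> leaves X" "a = apex (tri e)" "\<nexists>G. e = Red3 G" "F \<in> splitters X a"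
  shows "a \<in> new_nodes (nodes T0) (leaves X)"
proof -
  have "a \<in> verts (tri e)" using assms(2) by (cases "tri e") simp
  then have "a \<in> nodes (tri ` leaves X)" using assms(1) by (auto simp: nodes_def)
  then show ?thesis
    using assms splitter_not_node0 by (auto simp: new_nodes_def newest_vertex_def)
qed

lemma redsD:
  assumes "F \<in> reds"
  shows "kids F \<inter> X = children Red F" "children Red F \<subseteq> leaves X" "Red1 F \<in> X" "F \<in> X" "F \<notin> greens"
    and "mids F \<subseteq> adm \<union> hang" "mid12 (tri F) \<in> adm \<Longrightarrow> mids F \<subseteq> adm"
proof -
  show lv: "children Red F \<subseteq> leaves X" using assms by (auto simp: reds_def red_middle_def)
  then show R1: "Red1 F \<in> X" using leaves_X by auto
  then show kX: "kids F \<inter> X = children Red F" by (cases rule: kids_X_cases[of F]) blast+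
  show FX: "F \<in> X" using R1 parent_X[of "Red1 F" F] by (simp add: kids_eq)
  have "Green1 F \<notin> kids F \<inter> X" unfolding kX by simp
  then show "F \<notin> greens" using leaves_X by (auto simp: greens_def kids_eq)
  have sp: "F \<in> splitters X a" if "a \<in> mids F" for a
    using that R1 FX by (simp add: splitters_def split_mids_def)
  have "mid12 (tri F) \<in> new_nodes (nodes T0) (leaves X)"
    by (rule new_nodeI[of "Red4 F" _ F]) (use lv sp[of "mid12 (tri F)"] in \<open>auto simp: mids_def\<close>)
  moreover have "mid23 (tri F) \<in> new_nodes (nodes T0) (leaves X)"
    by (rule new_nodeI[of "Red2 F" _ F]; (cases "tri F")?)
      (use lv sp[of "mid23 (tri F)"] in \<open>auto simp: mids_def\<close>)
  moreover have "mid31 (tri F) \<in> new_nodes (nodes T0) (leaves X)"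
    by (rule new_nodeI[of "Red1 F" _ F]; (cases "tri F")?)
      (use lv sp[of "mid31 (tri F)"] in \<open>auto simp: mids_def\<close>)
  ultimately show ah: "mids F \<subseteq> adm \<union> hang" using adm_or_hang by (auto simp: mids_def)
  show "mids F \<subseteq> adm" if m: "mid12 (tri F) \<in> adm"
  proof (rule ccontr)
    assume "\<not> mids F \<subseteq> adm"
    then obtain b where b: "b \<in> mids F" "b \<in> blk" using ah hang_iff by blast
    have "b \<in> verts (tri (Red4 F))" using b(1) by (auto simp: mids_def)
    \<comment> \<open>The vertices of the red middle element are the three midpoints and its apex is
      \<open>mid12\<close>, so blocking any of them blocks \<open>mid12\<close>.\<close>
    then have "apex (tri (Red4 F)) \<in> block_step (leaves X) blk"
      using b(2) assms unfolding block_step_def reds_def by blast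
    then have "mid12 (tri F) \<in> blk" using blk_properties(2) by simp
    then show False using m adm_iff by blast
  qed
qed

lemma greensD:
  assumes "F \<in> greens"
  shows "kids F \<inter> X = children Green F" "children Green F \<subseteq> leaves X" "F \<in> X" "F \<notin> reds"
    and "mid12 (tri F) \<in> adm \<union> hang"
proof -
  show lv: "children Green F \<subseteq> leaves X" using assms by (simp add: greens_def)
  then have G1: "Green1 F \<in> X" using leaves_X by auto
  then show kX: "kids F \<inter> X = children Green F" by (cases rule: kids_X_cases[of F]) blast+
  show FX: "F \<in> X" using G1 parent_X[of "Green1 F" F] by (simp add: kids_eq)
  show "F \<notin> reds" using redsD(5) assms by blast
  have R1: "Red1 F \<notin> X" using kX by (auto simp: kids_eq)
  have "F \<in> splitters X (mid12 (tri F))"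
    using G1 R1 FX by (simp add: splitters_def split_mids_def)
  then have "mid12 (tri F) \<in> new_nodes (nodes T0) (leaves X)"
    by (intro new_nodeI[of "Green1 F" _ F]; (cases "tri F")?) (use lv in auto)
  then show "mid12 (tri F) \<in> adm \<union> hang" using adm_or_hang by blast
qed

lemma pat_red:
  assumes "F \<in> reds"
  shows "coarsen_red adm hang F = children (pat F) F" "kept (pat F) F \<inter> adm = {}" "mids F \<subseteq> kept (pat F) F \<union> adm"
proof -
  note r = redsD(6,7)[OF assms]
  show "coarsen_red adm hang F = children (pat F) F"
    using assms by (simp add: coarsen_red_def pat_def Let_def)
  show "kept (pat F) F \<inter> adm = {}" "mids F \<subseteq> kept (pat F) F \<union> adm"
  proof -
    have "x \<in> hang \<longleftrightarrow> x \<notin> adm" if "x \<in> mids F" for x using r(1) adm_not_hang that by blast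
    then have h: "mid12 (tri F) \<in> hang \<longleftrightarrow> mid12 (tri F) \<notin> adm" "mid23 (tri F) \<in> hang \<longleftrightarrow> mid23 (tri F) \<notin> adm"
      "mid31 (tri F) \<in> hang \<longleftrightarrow> mid31 (tri F) \<notin> adm" by (simp_all add: mids_def)
    have r': "mid12 (tri F) \<in> adm \<Longrightarrow> mid23 (tri F) \<in> adm" "mid12 (tri F) \<in> adm \<Longrightarrow> mid31 (tri F) \<in> adm"
      using r(2) by (simp_all add: mids_def)
    have "kept (pat F) F \<inter> adm = {} \<and> mids F \<subseteq> kept (pat F) F \<union> adm"
      unfolding pat_def Let_def h using assms r'
      by (cases "mid12 (tri F) \<in> adm"; cases "mid23 (tri F) \<in> adm"; cases "mid31 (tri F) \<in> adm") (simp_all add: mids_def)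
    then show "kept (pat F) F \<inter> adm = {}" "mids F \<subseteq> kept (pat F) F \<union> adm" by blast+
  qed
qed

lemma pat_green:
  assumes "F \<in> greens"
  shows "coarsen_green adm F = children (pat F) F" "kept (pat F) F \<inter> adm = {}"
    "kept (pat F) F \<subseteq> {mid12 (tri F)}" "mid12 (tri F) \<in> kept (pat F) F \<union> adm"
  using assms greensD(4,5)[OF assms] adm_not_hang by (auto simp: coarsen_green_def pat_def Let_def)

abbreviation "merged \<equiv> reds \<union> greens"

abbreviation "new_elements \<equiv> coarsen (nodes T0) (leaves X) mark"

lemma mergedD:
  assumes "F \<in> merged"
  shows "kids F \<inter> X \<noteq> {}" "kids F \<inter> X \<subseteq> leaves X" "F \<in> X" "F \<notin> leaves X" "kids F \<inter> leaves X = kids F \<inter> X"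
proof -
  show 1: "kids F \<inter> X \<noteq> {}" "kids F \<inter> X \<subseteq> leaves X" "F \<in> X"
    using assms redsD(1,2,4)[of F] greensD(1,2,3)[of F] by (elim UnE; simp)+
  show "F \<notin> leaves X" using 1 by (auto simp: leaves_def)
  show "kids F \<inter> leaves X = kids F \<inter> X" using 1 leaves_X by blast
qed

lemma coarsen_eq: "new_elements = (leaves X - (\<Union>F\<in>merged. kids F)) \<union> (\<Union>F\<in>merged. children (pat F) F)"
proof -
  have "leaves X \<inter> children Red F = leaves X \<inter> kids F" if "F \<in> reds" for F
    using redsD(1,2)[OF that] leaves_X by blast
  moreover have "leaves X \<inter> children Green F = leaves X \<inter> kids F" if "F \<in> greens" for F
    using greensD(1,2)[OF that] leaves_X by blast
  ultimately have "leaves X - (\<Union>F\<in>reds. children Red F) - (\<Union>F\<in>greens. children Green F)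
      = leaves X - (\<Union>F\<in>merged. kids F)" by blast
  moreover have "(\<Union>F\<in>reds. coarsen_red adm hang F) = (\<Union>F\<in>reds. children (pat F) F)"
    using pat_red(1) by simp
  moreover have "(\<Union>F\<in>greens. coarsen_green adm F) = (\<Union>F\<in>greens. children (pat F) F)"
    using pat_green(1) by simp
  ultimately show ?thesis
    unfolding coarsen_def Let_def adm_def[symmetric] hang_def[symmetric] reds_def[symmetric] greens_def[symmetric]
    by (simp add: UN_Un Un_assoc)
qed

lemma coarsen_forest: "\<exists>X'. forest T0 X' \<and> leaves X' = new_elements"
proof -
  obtain Y where Y: "forest T0 Y" "leaves Y = (leaves X - (\<Union>F\<in>merged. kids F)) \<union> merged"
    using collapse[of merged] mergedD by blast
  interpret Y: forest T0 Y by (rule Y(1))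
  define p where "p e = (if e \<in> merged then pat e else Unrefined)" for e
  obtain Z where Z: "forest T0 Z" "leaves Z = (\<Union>e\<in>leaves Y. children (p e) e)"
    using Y.refine[of p] by blast
  have 1: "children (p e) e = {e}" if "e \<in> leaves X" for e
    using mergedD(4) that by (auto simp: p_def)
  have 2: "children (p e) e = children (pat e) e" if "e \<in> merged" for e
    using that by (simp add: p_def)
  have "leaves Z = (\<Union>e\<in>leaves X - (\<Union>F\<in>merged. kids F). {e}) \<union> (\<Union>e\<in>merged. children (pat e) e)"
    unfolding Z(2) Y(2) UN_Un using 1 2 by simp
  then have "leaves Z = new_elements" unfolding coarsen_eq by simp
  then show ?thesis using Z(1) by blast
qed

lemma new_elements_cases:
  assumes "t \<in> new_elements"
  obtains (old) "t \<in> leaves X" "\<And>F. F \<in> merged \<Longrightarrow> t \<notin> kids F"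
  | (new) F where "F \<in> merged" "t \<in> children (pat F) F"
  using assms unfolding coarsen_eq by blast

lemma merged_kept:
  assumes "F \<in> merged"
  shows "kept (pat F) F \<inter> adm = {}" "kept (pat F) F \<subseteq> nodes (tri ` leaves X)"
    and "\<And>c. c \<in> kids F \<inter> X \<Longrightarrow> verts (tri c) \<subseteq> verts (tri F) \<union> kept (pat F) F \<union> adm"
    and "\<exists>p \<in> {Red, Green}. kids F \<inter> X = children p F"
proof -
  have "kept (pat F) F \<inter> adm = {} \<and> kept (pat F) F \<subseteq> nodes (tri ` leaves X) \<and>
    (\<forall>c \<in> kids F \<inter> X. verts (tri c) \<subseteq> verts (tri F) \<union> kept (pat F) F \<union> adm) \<and>
    (\<exists>p \<in> {Red, Green}. kids F \<inter> X = children p F)"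
  proof (cases "F \<in> reds")
    case True
    note r = redsD[OF True] pat_red[OF True]
    have "kept p F \<subseteq> mids F" for p by (cases p) (auto simp: mids_def)
    moreover have "mids F \<subseteq> verts (tri (Red4 F))" by (auto simp: mids_def)
    moreover have "Red4 F \<in> X" using r(2) leaves_X by auto
    ultimately have "kept (pat F) F \<subseteq> nodes (tri ` leaves X)" using vertex_is_node by blast
    then show ?thesis using r(1) pat_red[OF True] kid_verts(1) by blast
  next
    case False
    then have F: "F \<in> greens" using assms by blast
    note g = greensD[OF F] pat_green[OF F]
    have "mid12 (tri F) \<in> verts (tri (Green1 F))" by (rule green_mid_corner) simp
    moreover have "Green1 F \<in> X" using g(2) leaves_X by auto
    ultimately have "kept (pat F) F \<subseteq> nodes (tri ` leaves X)" using vertex_is_node pat_green(3)[OF F] by blast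
    then show ?thesis using g(1) pat_green[OF F] kid_verts(2) by blast
  qed
  then show "kept (pat F) F \<inter> adm = {}" "kept (pat F) F \<subseteq> nodes (tri ` leaves X)"
    "\<And>c. c \<in> kids F \<inter> X \<Longrightarrow> verts (tri c) \<subseteq> verts (tri F) \<union> kept (pat F) F \<union> adm"
    "\<exists>p \<in> {Red, Green}. kids F \<inter> X = children p F" by blast+
qed

text \<open>By \<open>pre_adm_pattern\<close> the children of each splitter of \<open>a\<close> are
  all leaves, hence an unrefined red pattern or a green pair. So every element at an admissible node
  is merged, on all sides at once.\<close>

lemma adm_vertex:
  assumes "a \<in> adm" "e \<in> X" "a \<in> verts (tri e)"
  shows "\<exists>F \<in> merged. e \<in> kids F \<and> e \<in> leaves X"
proof -
  have "a \<notin> verts (root_of e)" using adm_not_node0[OF assms(1)] root_T0[OF assms(2)] by (auto simp: nodes_def)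
  then obtain F k where F: "F \<in> splitters X a" "k \<in> kids F" "k \<in> ancs e"
    using vertex_splitter assms(2,3) by blast
  have lv: "kids F \<inter> X \<subseteq> leaves X"
    using pre_adm_pattern[OF nh _ F(1)] assms(1) adm_iff by blast
  have "k \<in> leaves X" using F(2,3) anc_X assms(2) lv by blast
  then have "k = e" using leaf_anc F(3) assms(2) by blast
  moreover have "F \<in> merged"
    using F(1)
  proof (cases rule: splitter_cases)
    case red
    then show ?thesis using red4_middle lv by (simp add: reds_def)
  next
    case green
    then show ?thesis using lv by (simp add: greens_def)
  qed
  ultimately show ?thesis using F(2) \<open>k \<in> leaves X\<close> by blast
qed

lemma new_elements_nodes: "nodes (tri ` new_elements) \<subseteq> nodes (tri ` leaves X) - adm"
proof
  fix a assume "a \<in> nodes (tri ` new_elements)"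
  then obtain t where t: "t \<in> new_elements" "a \<in> verts (tri t)" by (auto simp: nodes_def)
  from t(1) show "a \<in> nodes (tri ` leaves X) - adm"
  proof (cases rule: new_elements_cases)
    case old
    then show ?thesis using t(2) adm_vertex leaves_X vertex_is_node by blast
  next
    case (new F)
    have av: "a \<in> verts (tri F) \<union> kept (pat F) F" using children_verts new(2) t(2) by blast
    note m = mergedD[OF new(1)]
    show ?thesis
    proof (cases "a \<in> verts (tri F)")
      case True
      then show ?thesis using adm_vertex[OF _ m(3) True] m(4) vertex_is_node[OF m(3) True] by blast
    next
      case False
      then show ?thesis using av merged_kept(1,2)[OF new(1)] by blast
    qed
  qed
qed

text \<open>A node \<open>n\<close> in a new part of \<open>F\<close> lies in an old child of
  \<open>F\<close> and, as nothing hung before, is a vertex of it. It is not admissible, so it is a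
  vertex of \<open>F\<close> or a kept midpoint, and \<open>kept_corner\<close> applies.\<close>

lemma new_elements_no_hanging: "no_hanging (tri ` new_elements)"
  unfolding no_hanging_def
proof (intro ballI impI)
  fix s n assume "s \<in> tri ` new_elements" and n: "n \<in> nodes (tri ` new_elements)" "n \<in> closed_tri s"
  then obtain t where t: "t \<in> new_elements" "s = tri t" by blast
  have nT: "n \<in> nodes (tri ` leaves X)" "n \<notin> adm" using new_elements_nodes n(1) by blast+
  from t(1) show "n \<in> verts s"
  proof (cases rule: new_elements_cases)
    case old
    then show ?thesis using nh nT(1) n(2) t(2) by (auto simp: no_hanging_def)
  next
    case (new F)
    note m = mergedD[OF new(1)] and k = merged_kept[OF new(1)]
    have "n \<in> closed_tri (tri F)" using n(2) anc_closed_tri children_anc[OF new(2)] t(2) by blast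
    then obtain c where c: "c \<in> kids F \<inter> X" "n \<in> closed_tri (tri c)"
      using children_cover k(4) by metis
    have "c \<in> leaves X" using c(1) m(2) by blast
    then have "n \<in> verts (tri c)" using nh c(2) nT(1) by (auto simp: no_hanging_def)
    then have "n \<in> verts (tri F) \<union> kept (pat F) F" using k(3)[OF c(1)] nT(2) by blast
    then show ?thesis using kept_corner[OF ccw_X[OF m(3)] new(2)] n(2) t(2) by blast
  qed
qed

end

section \<open>Progress\<close>

context forest
begin

text \<open>A refined midpoint of maximal height is removed: refined children or a place at the apex
  of a red middle element would each yield a midpoint of larger generation in the same initial
  triangle, hence of larger height.\<close>

lemma progress:
  assumes nh: "no_hanging (tri ` leaves X)" and bdd: "weak_BDD T0" and ne: "X \<noteq> Initial ` T0"
  shows "admissible (nodes T0) (leaves X) (nodes (tri ` leaves X)) \<inter> nodes (tri ` leaves X) \<noteq> {}"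
proof -
  interpret coarsening T0 X "nodes (tri ` leaves X)" by unfold_locales (rule nh)
  define P where "P = (\<Union>F\<in>X. split_mids X F)"
  have "finite (split_mids X F)" for F by (simp add: split_mids_def mids_def)
  then have fin: "finite P" using finite_X by (simp add: P_def)
  have P_iff: "p \<in> P \<longleftrightarrow> splitters X p \<noteq> {}" for p by (auto simp: P_def splitters_def)
  \<comment> \<open>Both patterns bisect the reference edge, so every inner element of the forest
    supplies a candidate.\<close>
  have inner: "\<exists>p. p = mid12 (tri F) \<and> F \<in> splitters X p" if "F \<in> X" "F \<notin> leaves X" for F
    using that by (cases rule: kids_X_cases[of F]) (auto simp: splitters_def split_mids_def leaves_def mids_def)
  obtain e where e: "e \<in> X" "e \<notin> Initial ` T0" using ne Initial_X by blast
  obtain F c where "c \<in> kids F" "c \<in> X"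
    using e Initial_X by (cases rule: element_exhaust_kids[of e]) auto
  then have "P \<noteq> {}" using inner[of F] parent_X inner_X P_iff by blast
  then obtain p where p: "p \<in> P" "\<And>q. q \<in> P \<Longrightarrow> height q \<le> height p"
  proof -
    have "Max (height ` P) \<in> height ` P" using fin \<open>P \<noteq> {}\<close> by (intro Max_in) auto
    then obtain p where p: "p \<in> P" "height p = Max (height ` P)" by auto
    moreover have "height q \<le> Max (height ` P)" if "q \<in> P" for q using fin that by simp
    ultimately show thesis using that[of p] by simp
  qed
  have higher: False
    if "F \<in> splitters X p" "G \<in> splitters X q" "root_of G = root_of F"
      "has_gen (root_of F) p g" "has_gen (root_of F) q h" "g < h" for F G q g h
  proof -
    have in_root: "x \<in> closed_tri (root_of F) \<and> x \<notin> verts (root_of F)" if "F \<in> splitters X x" for F x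
    proof -
      have "x \<in> closed_tri (root_of F)"
        using anc_closed_tri[OF Initial_root_ancs[of F]] splittersD(5)[OF that] by auto
      moreover have "x \<notin> verts (root_of F)"
        using splitter_not_node0[OF that] root_T0[OF splittersD(1)[OF that]] by (auto simp: nodes_def)
      ultimately show ?thesis by blast
    qed
    have "height p < height q"
      using height_mono[OF bdd root_T0[OF splittersD(1)[OF that(1)]] _ _ that(4) _ _ that(5,6)]
        in_root[OF that(1)] in_root[OF that(2)] that(3) by simp
    moreover have "q \<in> P" using that(2) P_iff by blast
    ultimately show False using p(2) by fastforce
  qed
  have lv: "kids F \<inter> X \<subseteq> leaves X" if F: "F \<in> splitters X p" for F
  proof
    fix k assume k: "k \<in> kids F \<inter> X"
    show "k \<in> leaves X"
    proof (rule ccontr)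
      assume "k \<notin> leaves X"
      then have kp: "k \<in> splitters X (mid12 (tri k))" using inner k by blast
      have rt: "root_of k = root_of F" using root_kid k by blast
      \<comment> \<open>In a red pattern \<open>p\<close> has generation at most one above
        \<open>gen F\<close> and the children are two above; in a green pattern these numbers are
        zero and one.\<close>
      have "\<exists>g. has_gen (root_of F) p g \<and> g < gen k"
        using F
      proof (cases rule: splitter_cases)
        case red
        have "k \<in> children Red F" using k red(1) by blast
        then have "gen k = Suc (Suc (gen F))" by auto
        then show ?thesis using red(3) mids_gen[of F] by (auto simp: mids_def)
      next
        case green
        have "k \<in> children Green F" using k green(1) by blast
        then have "gen k = Suc (gen F)" by auto
        then show ?thesis using green(3) mids_gen(1)[of F] by auto
      qed
      then show False using higher[OF F kp rt] mids_gen(1)[of k] rt by auto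
    qed
  qed
  obtain F where F: "F \<in> splitters X p" using p(1) P_iff by blast
  have "\<exists>e\<in>leaves X. newest_vertex p e"
    using F
  proof (cases rule: splitter_cases)
    case red
    have "Red1 F \<in> leaves X" "Red2 F \<in> leaves X" "Red4 F \<in> leaves X" using lv[OF F] red(1) by auto
    moreover have "newest_vertex p (Red1 F) \<or> newest_vertex p (Red2 F) \<or> newest_vertex p (Red4 F)"
      using red(3) by (cases "tri F") (auto simp: mids_def newest_vertex_def)
    ultimately show ?thesis by blast
  next
    case green
    have "Green1 F \<in> leaves X" using lv[OF F] green(1) by auto
    moreover have "newest_vertex p (Green1 F)"
      using green(3) by (cases "tri F") (auto simp: newest_vertex_def)
    ultimately show ?thesis by blast
  qed
  then obtain e where e: "e \<in> leaves X" "newest_vertex p e" by blast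
  have "p \<in> verts (tri e)" using e(2) by (cases "tri e") (simp add: newest_vertex_def)
  then have node: "p \<in> nodes (tri ` leaves X)" using e(1) by (auto simp: nodes_def)
  have "card (elems_at (leaves X) p) = 2 * card (splitters X p)"
    unfolding card_elems_at[OF splitter_not_node0[OF F]] using side_count_unrefined lv by simp
  moreover have "card (splitters X p) \<in> {1, 2}"
    using splitters_card_le_2[of p] F finite_splitters[of p] card_gt_0_iff[of "splitters X p"] by auto
  ultimately have "card (elems_at (leaves X) p) \<in> {2, 4}" by auto
  then have pre: "p \<in> pre_adm (nodes T0) (leaves X) (nodes (tri ` leaves X))"
    using node e splitter_not_node0[OF F] by (auto simp: pre_adm_def new_nodes_def)
  \<comment> \<open>The apex is the \<open>mid12\<close> of the father, whose \<open>mid23\<close>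
    is one generation later. So the blocking loop never reaches \<open>p\<close>.\<close>
  have "apex (tri m) \<noteq> p" if m: "m \<in> middles" for m
  proof
    assume pm: "apex (tri m) = p"
    obtain E where E: "m = Red4 E" "Red1 E \<in> leaves X" using m by (auto simp: red_middle_def)
    have EX: "Red1 E \<in> X" "E \<in> X" using E(2) leaves_X parent_X[of "Red1 E" E] by (auto simp: kids_eq)
    have "p = mid12 (tri E)" using pm E(1) by simp
    then have "E \<in> splitters X p" "E \<in> splitters X (mid23 (tri E))" "has_gen (root_of E) p (gen E)"
      using EX mids_gen(1)[of E] by (auto simp: splitters_def split_mids_def mids_def)
    then show False using higher mids_gen(2)[of E] by blast
  qed
  then have "p \<notin> blk" using blk_properties(3) pre by blast
  then show ?thesis using pre node adm_iff unfolding adm_def by blast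
qed

lemma leaves_initial: "X = Initial ` T0 \<Longrightarrow> tri ` leaves X = T0"
proof -
  assume X: "X = Initial ` T0"
  then have "leaves X = Initial ` T0" using Initial_not_kid unfolding leaves_def by blast
  then show ?thesis by (simp add: image_image)
qed

lemma finite_nodes: "finite (nodes (tri ` leaves X))"
proof -
  have "finite (verts t)" for t by (cases t) simp
  moreover have "finite (leaves X)" using finite_X finite_subset[of "leaves X" X] by (auto simp: leaves_def)
  ultimately show ?thesis by (simp add: nodes_def)
qed

end

section \<open>From RGB refinements to forests, and the iteration\<close>

lemma rgb_refinement_forest:
  assumes "conforming_triangulation \<Omega> T0" "rgb_refinement \<Omega> T0 T"
  shows "conforming_triangulation \<Omega> (tri ` T) \<and> (\<exists>X. forest T0 X \<and> T = leaves X)"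
  using assms(2)
proof induction
  case initial
  have "tri ` Initial ` T0 = T0" by (force simp: image_image)
  then show ?case
    using assms(1) initial_forest[OF conforming_triangulation_initial[OF assms(1)]] by metis
next
  case (step T T')
  then obtain X p where X: "forest T0 X" "T = leaves X"
    and T': "T' = (\<Union>e\<in>T. children (p e) e)" "conforming_triangulation \<Omega> (tri ` T')"
    unfolding rgb_step_def by blast
  then show ?case using forest.refine[OF X(1), of p] by metis
qed

theorem theorem2:
  fixes \<Omega> :: "point set"
    and T0 :: "ref_triangle set"
    and T :: "element set"
    and TT :: "nat \<Rightarrow> element set"
  assumes "polygonal_domain \<Omega>"
    and "conforming_triangulation \<Omega> T0"
    and "weak_BDD T0"
    and "rgb_refinement \<Omega> T0 T"
    and "TT 0 = T"
    and "\<And>i. TT (Suc i) = coarsen (nodes T0) (TT i) (nodes (tri ` TT i))"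
  shows "\<exists>M. tri ` TT M = T0"
proof -
  \<comment> \<open>Stated for an arbitrary index \<open>i\<close>, so that after one step the
    induction hypothesis applies at \<open>Suc i\<close>.\<close>
  have main: "\<exists>M. tri ` TT M = T0" if "forest T0 X" "TT i = leaves X" "no_hanging (tri ` leaves X)" for X i
    using that
  proof (induction "card (nodes (tri ` leaves X))" arbitrary: X i rule: less_induct)
    case less
    interpret forest T0 X by (rule less.prems(1))
    let ?N = "nodes (tri ` leaves X)"
    show ?case
    proof (cases "X = Initial ` T0")
      case True
      then show ?thesis using leaves_initial less.prems(2) by metis
    next
      case False
      interpret coarsening T0 X ?N by unfold_locales (rule less.prems(3))
      obtain X' where X': "forest T0 X'" "leaves X' = coarsen (nodes T0) (leaves X) ?N"
        using coarsen_forest by blast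
      have "nodes (tri ` leaves X') \<subset> ?N"
        using new_elements_nodes progress[OF less.prems(3) assms(3) False] unfolding X'(2) adm_def by blast
      then have "card (nodes (tri ` leaves X')) < card ?N" using finite_nodes psubset_card_mono by blast
      moreover have "TT (Suc i) = leaves X'" using assms(6) X'(2) less.prems(2) by simp
      ultimately show ?thesis
        using less.hyps[OF _ X'(1)] new_elements_no_hanging unfolding X'(2) by blast
    qed
  qed
  obtain X where X: "forest T0 X" "T = leaves X" and "conforming_triangulation \<Omega> (tri ` T)"
    using rgb_refinement_forest assms(2,4) by blast
  then show ?thesis
    using main[OF X(1), of 0] conforming_triangulation_no_hanging assms(5) by blast
qed

end
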